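(* Let $k=k(n)\ge 1$ and let $d_0,d_1,\ldots,d_k\ge 1$ be integers (all allowed to depend on $n$) such that $\sum_{j=0}^k d_j=n-1$, with all $d_j$ even whenever $n$ is odd. Define $d=\sum_{i=1}^k d_i$ and suppose that, as $n\to\infty$, $$\sum_{1 \le i \le j < t\le k} d_i d_j d_t^2=o(n)\quad\text{and}\quad d^3=o(n).$$ Define $\lambda_j=\frac{d_j}{n-1}$ for $0\le j\le k$. Then $$R(n;d_0,\ldots,d_k) = R'(n;d_0,\ldots,d_k) \Bigl(1 + O\Bigl( \frac {d^3}{n} + \frac{1}{n}\sum_{1 \le i \le j < t\le k} d_i d_j d_t^2 \Bigr)\Bigr),$$ where $$R'(n;d_0,\ldots,d_k) = \biggl( \prod_{i=0}^k \lambda_i^{\lambda_i}\biggr)^{\binom{n}{2}} \binom{n-1}{d_0,\ldots,d_k}^{n} e^{k/4}\, 2^{k/2}.$$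
   Context: For integers $d_0,d_1,\ldots,d_k\ge 1$ with $\sum_{i=0}^k d_i=n-1$, $R(n;d_0,\ldots,d_k)$ denotes the number of ways to partition the edge set of the complete graph $K_n$ on $n$ labelled vertices into spanning regular subgraphs of degrees $d_0,d_1,\ldots,d_k$. The factors are distinguished by their index, i.e. one counts sequences $(D_0,\ldots,D_k)$ of pairwise edge-disjoint spanning subgraphs with union $K_n$ such that $D_i$ is $d_i$-regular. $\binom{n-1}{d_0,\ldots,d_k}=\frac{(n-1)!}{d_0!\cdots d_k!}$ is the multinomial coefficient. Regular graphs are tacitly assumed to have even degree whenever the number of vertices is odd. Asymptotic statements are as $n\to\infty$, with $k$ and the $d_i$ functions of $n$. An empty sum is $0$. *)

theory Defs
  imports "HOL-Library.FuncSet" "HOL-Library.Landau_Symbols"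
begin

text \<open>
  The vertex set of \<open>K\<^sub>n\<close> is \<open>{..<n}\<close>. A spanning subgraph of \<open>K\<^sub>n\<close> contains all vertices,
  so it is represented by its set of edges. Degrees are given by a function \<open>d\<close> on \<open>nat\<close>
  of which only the values \<open>d 0, \<dots>, d k\<close> are used.
\<close>

definition complete_edges :: "nat \<Rightarrow> nat set set" where
  "complete_edges n = {e. e \<subseteq> {..<n} \<and> card e = 2}"

definition regular_spanning :: "nat \<Rightarrow> nat \<Rightarrow> nat set set \<Rightarrow> bool" where
  "regular_spanning n r E \<longleftrightarrow>
     E \<subseteq> complete_edges n \<and> (\<forall>v<n. card {e \<in> E. v \<in> e} = r)"

text \<open>
  The sequences are extensional functions on \<open>{..k}\<close>, so that each is counted
  exactly once.
\<close>

definition regular_factorizations ::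
    "nat \<Rightarrow> nat \<Rightarrow> (nat \<Rightarrow> nat) \<Rightarrow> (nat \<Rightarrow> nat set set) set" where
  "regular_factorizations n k d =
     {D \<in> extensional {..k}.
        (\<forall>i\<le>k. regular_spanning n (d i) (D i)) \<and>
        (\<forall>i\<le>k. \<forall>j\<le>k. i \<noteq> j \<longrightarrow> D i \<inter> D j = {}) \<and>
        (\<Union>i\<le>k. D i) = complete_edges n}"

definition num_factorizations :: "nat \<Rightarrow> nat \<Rightarrow> (nat \<Rightarrow> nat) \<Rightarrow> nat" where
  "num_factorizations n k d = card (regular_factorizations n k d)"

lemma finite_regular_factorizations: "finite (regular_factorizations n k d)"
proof (rule finite_subset)
  show "regular_factorizations n k d \<subseteq> {..k} \<rightarrow>\<^sub>E Pow (complete_edges n)"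
  proof
    fix D assume "D \<in> regular_factorizations n k d"
    then have "D \<in> extensional {..k}" "\<forall>i\<le>k. D i \<subseteq> complete_edges n"
      by (simp_all add: regular_factorizations_def regular_spanning_def)
    then show "D \<in> {..k} \<rightarrow>\<^sub>E Pow (complete_edges n)"
      by (simp add: PiE_iff)
  qed
  have "finite (complete_edges n)"
    unfolding complete_edges_def by (rule finite_subset[of _ "Pow {..<n}"]) auto
  then show "finite ({..k} \<rightarrow>\<^sub>E Pow (complete_edges n))"
    by (intro finite_PiE) auto
qed

definition multinomial_coeff :: "nat \<Rightarrow> nat \<Rightarrow> (nat \<Rightarrow> nat) \<Rightarrow> real" where
  "multinomial_coeff m k d = fact m / (\<Prod>i\<le>k. fact (d i))"

definition density :: "nat \<Rightarrow> (nat \<Rightarrow> nat) \<Rightarrow> nat \<Rightarrow> real" where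
  "density n d j = real (d j) / (real n - 1)"

definition estimate :: "nat \<Rightarrow> nat \<Rightarrow> (nat \<Rightarrow> nat) \<Rightarrow> real" where
  "estimate n k d =
     (\<Prod>i\<le>k. density n d i powr density n d i) ^ (n choose 2)
       * multinomial_coeff (n - 1) k d ^ n
       * exp (real k / 4) * 2 powr (real k / 2)"

text \<open>The index \<open>0\<close> is excluded from the following two sums.\<close>

definition degree_sum :: "nat \<Rightarrow> (nat \<Rightarrow> nat) \<Rightarrow> nat" where
  "degree_sum k d = (\<Sum>i=1..k. d i)"

definition mixed_sum :: "nat \<Rightarrow> (nat \<Rightarrow> nat) \<Rightarrow> nat" where
  "mixed_sum k d = (\<Sum>i=1..k. \<Sum>j=i..k. \<Sum>t=Suc j..k. d i * d j * (d t)\<^sup>2)"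

end

theory Submission
  imports Defs
begin

text \<open>
  The graph \<open>D\<^sub>0\<close> is the complement of the union of the others, so it suffices to count sequences
  \<open>D\<^sub>1, \<dots>, D\<^sub>k\<close> of pairwise disjoint regular graphs. They are chosen one after the other. The union of
  the graphs chosen so far is an \<open>x\<close>-regular graph \<open>X\<close>, and everything rests on a uniform estimate
  (\<open>ln_card_disjoint_regular\<close>) for the number of \<open>d\<close>-regular graphs that are edge-disjoint from \<open>X\<close>:
  with \<open>M = n d\<close> it equals
  \<open>M! / ((M/2)! 2\<^bsup>M/2\<^esup> d!\<^sup>n) \<sqdot> exp (- (d\<^sup>2 - 1)/4 - x d / 2 + O (d (d + x)\<^sup>2 / n))\<close>.

  To prove it, the \<open>M\<close> half-edges of a multigraph are labelled by its vertices, each vertex being used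
  \<open>d\<close> times. Such a word is simple if it has no loop, no edge of \<open>X\<close> and no repeated edge, and every
  graph to be counted comes from \<open>(M/2)! 2\<^bsup>M/2\<^esup>\<close> simple words. Words are grouped into levels by half the
  number of their bad positions, which is the number of these defects. A switching rotates the labels
  at three positions so as to destroy one defect. Counting the switchings between consecutive levels
  from both ends shows that the sizes \<open>a\<^sub>m\<close> of the levels satisfy
  \<open>m a\<^sub>m = A a\<^bsub>m-1\<^esub> (1 + O ((d (d + x) + m) / M))\<close> with \<open>A = (d\<^sup>2 - 1)/4 + x d / 2\<close>
  (\<open>level_upper\<close>, \<open>level_lower\<close>), as for a Poisson variable of mean \<open>A\<close>. Hence the proportion of
  simple words is close to \<open>exp (- A)\<close> (\<open>near_poisson.estimate_total\<close>). Words whose defects overlap,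
  such as those with a triple edge, do not belong to any level, but they are a proportion
  \<open>O (d (d + x)\<^sup>2 / n)\<close> of all words (\<open>card_untame\<close>). Words with a number of defects of order \<open>M\<close> lie
  beyond the reach of the ratio estimate; for them Markov's inequality suffices (\<open>words_covered\<close>).

  In the product over the factors the exponents add up to \<open>- ((\<Sum> d\<^sub>i)\<^sup>2 - k)/4\<close> (\<open>sum_means\<close>), and the
  errors add up to \<open>O (d\<^sup>3 / n)\<close> for \<open>d = \<Sum> d\<^sub>i\<close>, because \<open>d\<^sub>i (d\<^sub>1 + \<dots> + d\<^sub>i)\<^sup>2 \<le> d\<^sub>i d\<^sup>2\<close>. Stirling's formula
  and an expansion of the terms of the estimate that involve the large degree \<open>d\<^sub>0 = n - 1 - d\<close>
  (\<open>ln_estimate\<close>) show that the product agrees with the estimate up to a factor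
  \<open>1 + O (d\<^sup>3 / n)\<close>.
\<close>

section \<open>Words, bad positions and switchings\<close>

text \<open>
  The elements of \<open>P\<close> are the half-edges, called positions, and \<open>bar\<close> matches the two ends of an edge. The
  matching of positions is fixed and the labels vary, so that rearranging the labels preserves the degrees.
\<close>

locale pairing_words =
  fixes P :: "'p set" and bar :: "'p \<Rightarrow> 'p" and V :: "'v::linorder set"
    and X :: "'v \<Rightarrow> 'v \<Rightarrow> bool" and d x :: nat
  assumes finite_P: "finite P"
    and bar_mem: "p \<in> P \<Longrightarrow> bar p \<in> P"
    and bar_bar: "p \<in> P \<Longrightarrow> bar (bar p) = p"
    and bar_neq: "p \<in> P \<Longrightarrow> bar p \<noteq> p"
    and finite_V: "finite V"
    and X_irrefl: "\<not> X v v"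
    and X_sym: "X u v \<Longrightarrow> X v u"
    and X_regular: "v \<in> V \<Longrightarrow> card {u \<in> V. X v u} = x"
    and card_P: "card P = d * card V"
    and d_pos: "1 \<le> d"
begin

definition words :: "('p \<Rightarrow> 'v) set" where
  "words = {w \<in> P \<rightarrow>\<^sub>E V. \<forall>v\<in>V. card {p \<in> P. w p = v} = d}"

definition forb :: "'v \<Rightarrow> 'v \<Rightarrow> bool" where
  "forb u v \<longleftrightarrow> u = v \<or> X u v"

definition par :: "('p \<Rightarrow> 'v) \<Rightarrow> 'p \<Rightarrow> 'p \<Rightarrow> bool" where
  "par w p q \<longleftrightarrow> w p = w q \<and> w (bar p) = w (bar q)"

definition plain :: "('p \<Rightarrow> 'v) \<Rightarrow> 'p \<Rightarrow> bool" where
  "plain w p \<longleftrightarrow> \<not> forb (w p) (w (bar p)) \<and> (\<forall>q\<in>P. par w p q \<longrightarrow> q = p)"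

text \<open>
  A loop or an edge of \<open>X\<close> makes both of its positions bad. A double edge consists of four positions; the
  condition \<open>w p < w (bar p)\<close> selects one end of each of its two copies, so that defects of either
  kind contribute exactly two bad positions.
\<close>

definition bad :: "('p \<Rightarrow> 'v) \<Rightarrow> 'p set" where
  "bad w = {p \<in> P. forb (w p) (w (bar p)) \<or>
     (w p < w (bar p) \<and> (\<exists>q\<in>P. q \<noteq> p \<and> par w p q))}"

text \<open>
  In a tame word the defects do not overlap: edges occur at most twice, while loops and edges of \<open>X\<close> are
  not repeated at all. A loop is parallel to itself through \<open>bar\<close>, which is why the first
  clause also excludes repeated loops.
\<close>

definition tame :: "('p \<Rightarrow> 'v) \<Rightarrow> bool" where
  "tame w \<longleftrightarrow>
     (\<forall>p\<in>P. \<forall>q\<in>P. \<forall>r\<in>P. par w p q \<and> par w p r \<longrightarrow> p = q \<or> p = r \<or> q = r) \<and>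
     (\<forall>p\<in>P. \<forall>q\<in>P. par w p q \<and> X (w p) (w (bar p)) \<longrightarrow> p = q)"

definition rot :: "('p \<Rightarrow> 'v) \<Rightarrow> 'p \<Rightarrow> 'p \<Rightarrow> 'p \<Rightarrow> 'p \<Rightarrow> 'v" where
  "rot w p q r = w(p := w q, q := w r, r := w p)"

definition apart :: "'p \<Rightarrow> 'p \<Rightarrow> 'p \<Rightarrow> bool" where
  "apart p q r \<longleftrightarrow> p \<in> P \<and> q \<in> P \<and> r \<in> P \<and>
     q \<noteq> p \<and> q \<noteq> bar p \<and> r \<noteq> p \<and> r \<noteq> bar p \<and> r \<noteq> q \<and> r \<noteq> bar q"

text \<open>
  Two additional edges take part in a switching. With only one, the reverse operation would need the
  edge between the mates of two given positions to be harmless, and this can fail for almost all pairs of positions;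
  a second edge that can be chosen freely avoids the obstruction.
\<close>

definition switchable :: "('p \<Rightarrow> 'v) \<Rightarrow> 'p \<Rightarrow> 'p \<Rightarrow> 'p \<Rightarrow> bool" where
  "switchable w p q r \<longleftrightarrow> apart p q r \<and> p \<in> bad w \<and> plain w q \<and> plain w r \<and>
     plain (rot w p q r) p \<and> plain (rot w p q r) q \<and> plain (rot w p q r) r"

lemma forb_sym: "forb u v \<longleftrightarrow> forb v u"
  using X_sym unfolding forb_def by blast

lemma bar_eq_iff: "p \<in> P \<Longrightarrow> q \<in> P \<Longrightarrow> bar p = bar q \<longleftrightarrow> p = q"
  by (metis bar_bar)

lemma plain_bar: assumes "p \<in> P" shows "plain w (bar p) \<longleftrightarrow> plain w p"
proof -
  have *: "plain w (bar p)" if "plain w p" "p \<in> P" for p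
    using that unfolding plain_def par_def by (metis bar_bar bar_mem forb_sym)
  show ?thesis using *[of p] *[of "bar p"] assms bar_bar bar_mem by metis
qed

lemma plain_unique: "plain w p \<Longrightarrow> par w p q \<Longrightarrow> q \<in> P \<Longrightarrow> q = p"
  by (auto simp: plain_def)

lemma par_sym: "par w p q \<longleftrightarrow> par w q p"
  by (auto simp: par_def)

lemma plain_not_bad: "plain w p \<Longrightarrow> p \<notin> bad w"
  by (auto simp: plain_def bad_def)

lemma finite_bad: "finite (bad w)"
  using finite_P by (auto simp: bad_def)

lemma apart_perm:
  assumes "apart p q r"
  shows "apart p r q"
  using assms unfolding apart_def by (metis bar_bar)

lemma apart_neq:
  assumes "apart p q r"
  shows "p \<in> P" "q \<in> P" "r \<in> P" "bar p \<in> P" "bar q \<in> P" "bar r \<in> P"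
    "p \<noteq> q" "q \<noteq> p" "p \<noteq> r" "r \<noteq> p" "q \<noteq> r" "r \<noteq> q"
    "bar p \<noteq> p" "p \<noteq> bar p" "bar q \<noteq> q" "q \<noteq> bar q" "bar r \<noteq> r" "r \<noteq> bar r"
    "bar p \<noteq> q" "q \<noteq> bar p" "bar p \<noteq> r" "r \<noteq> bar p" "bar q \<noteq> p" "p \<noteq> bar q"
    "bar q \<noteq> r" "r \<noteq> bar q" "bar r \<noteq> p" "p \<noteq> bar r" "bar r \<noteq> q" "q \<noteq> bar r"
    "bar p \<noteq> bar q" "bar q \<noteq> bar p" "bar p \<noteq> bar r" "bar r \<noteq> bar p" "bar q \<noteq> bar r" "bar r \<noteq> bar q"
    "bar (bar p) = p" "bar (bar q) = q" "bar (bar r) = r"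
  using assms bar_neq bar_mem bar_bar unfolding apart_def by metis+

lemma rot_inverse:
  assumes "apart p q r"
  shows "rot (rot w p q r) p r q = w" "rot (rot w p r q) p q r = w"
  using apart_neq[OF assms] by (auto simp: rot_def fun_eq_iff)

lemma rot_simps:
  assumes "apart p q r"
  shows "rot w p q r p = w q" "rot w p q r q = w r" "rot w p q r r = w p"
    "rot w p q r (bar p) = w (bar p)" "rot w p q r (bar q) = w (bar q)" "rot w p q r (bar r) = w (bar r)"
  using apart_neq[OF assms] by (auto simp: rot_def)

definition touched :: "'p \<Rightarrow> 'p \<Rightarrow> 'p \<Rightarrow> 'p set" where
  "touched p q r = {p, bar p, q, bar q, r, bar r}"

lemma rot_untouched:
  assumes "apart p q r" "s \<in> P" "s \<notin> touched p q r"
  shows "rot w p q r s = w s" "rot w p q r (bar s) = w (bar s)"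
  using apart_neq[OF assms(1)] assms(2,3) bar_bar bar_eq_iff
  by (auto simp: rot_def touched_def)

lemma par_rot_untouched:
  assumes "apart p q r" "s \<in> P" "s \<notin> touched p q r" "t \<in> P" "t \<notin> touched p q r"
  shows "par (rot w p q r) s t \<longleftrightarrow> par w s t"
  using rot_untouched[OF assms(1)] assms by (simp add: par_def)

lemma words_comp:
  assumes "w \<in> words" "bij_betw \<pi> P P" "\<And>p. p \<notin> P \<Longrightarrow> \<pi> p = p"
  shows "w \<circ> \<pi> \<in> words"
proof -
  have "card {s \<in> P. (w \<circ> \<pi>) s = v} = card {s \<in> P. w s = v}" for v
  proof (rule bij_betw_same_card)
    show "bij_betw \<pi> {s \<in> P. (w \<circ> \<pi>) s = v} {s \<in> P. w s = v}"
      using assms(2) unfolding bij_betw_def by (auto intro: inj_on_subset)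
  qed
  moreover have "w \<circ> \<pi> \<in> P \<rightarrow>\<^sub>E V"
    using assms(1,3) bij_betwE[OF assms(2)] by (auto simp: words_def PiE_iff extensional_def)
  ultimately show ?thesis using assms(1) by (auto simp: words_def)
qed

lemma rot_words:
  assumes "apart p q r" "w \<in> words"
  shows "rot w p q r \<in> words"
proof -
  define \<pi> where "\<pi> = (\<lambda>s. if s = p then q else if s = q then r else if s = r then p else s)"
  note ne = apart_neq[OF assms(1)]
  have eq: "rot w p q r = w \<circ> \<pi>"
    using ne by (auto simp: rot_def \<pi>_def fun_eq_iff)
  have bij: "bij_betw \<pi> P P"
    by (rule bij_betw_byWitness[where f' = "\<lambda>s. if s = p then r else if s = q then p else if s = r then q else s"])
       (use ne in \<open>auto simp: \<pi>_def\<close>)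
  show ?thesis
    unfolding eq by (rule words_comp[OF assms(2) bij]) (use ne in \<open>auto simp: \<pi>_def\<close>)
qed

lemma plain_in_touched:
  assumes "apart p q r" "plain w p" "plain w q" "plain w r" "s \<in> touched p q r"
  shows "plain w s" "s \<in> P"
  using assms plain_bar apart_neq[OF assms(1)] by (auto simp: touched_def)

text \<open>
  The positions that are moved lie in plain edges afterwards, so parallel positions of the new word are
  untouched and were parallel before.
\<close>

lemma switch_tame:
  assumes "switchable w p q r" "tame w"
  shows "tame (rot w p q r)"
proof -
  let ?w' = "rot w p q r"
  have ap: "apart p q r" using assms by (simp add: switchable_def)
  have pl: "plain ?w' s" if "s \<in> touched p q r" for s
    using plain_in_touched[OF ap _ _ _ that] assms by (simp add: switchable_def)
  have out: "s \<notin> touched p q r \<and> t \<notin> touched p q r"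
    if "par ?w' s t" "s \<noteq> t" "s \<in> P" "t \<in> P" for s t
    using pl plain_unique par_sym that by metis
  have par: "par w s t" if "par ?w' s t" "s \<noteq> t" "s \<in> P" "t \<in> P" for s t
    using out[OF that] par_rot_untouched[OF ap] that by blast
  have lab: "X (w s) (w (bar s))" if "X (?w' s) (?w' (bar s))" "s \<in> P" "s \<notin> touched p q r" for s
    using rot_untouched[OF ap] that by metis
  show ?thesis
    unfolding tame_def
  proof (intro conjI ballI impI)
    fix s t u assume *: "s \<in> P" "t \<in> P" "u \<in> P" "par ?w' s t \<and> par ?w' s u"
    show "s = t \<or> s = u \<or> t = u"
      using * par assms(2) unfolding tame_def by blast
  next
    fix s t assume *: "s \<in> P" "t \<in> P" "par ?w' s t \<and> X (?w' s) (?w' (bar s))"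
    show "s = t"
      using * par out lab assms(2) unfolding tame_def by blast
  qed
qed

text \<open>
  A switching away from a loop or an edge of \<open>X\<close> cures the two ends of that edge. A switching away from one
  copy of a double edge cures the chosen end of this copy and the corresponding end \<open>t\<close> of the other copy.
\<close>

lemma switch_bad:
  assumes sw: "switchable w p q r" and tame: "tame w"
  shows "card (bad w) = card (bad (rot w p q r)) + 2"
proof -
  let ?w' = "rot w p q r"
  let ?T = "touched p q r"
  have ap: "apart p q r" and pbad: "p \<in> bad w" and plq: "plain w q" "plain w r"
    using sw by (auto simp: switchable_def)
  note ne = apart_neq[OF ap]
  have pl': "plain ?w' s" if "s \<in> ?T" for s
    using plain_in_touched[OF ap _ _ _ that] sw by (simp add: switchable_def)
  have plT: "plain w s" if "s \<in> {q, bar q, r, bar r}" for s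
    using that plq plain_bar ne by auto
  have nbad': "s \<notin> bad ?w'" if "s \<in> ?T" for s
    using plain_not_bad pl' that by blast
  have same: "?w' s = w s" "?w' (bar s) = w (bar s)" if "s \<in> P" "s \<notin> ?T" for s
    using rot_untouched[OF ap] that by auto
  have par': "par ?w' s t \<longleftrightarrow> t \<notin> ?T \<and> par w s t" if "s \<in> P" "s \<notin> ?T" "t \<in> P" "t \<noteq> s" for s t
    using par_rot_untouched[OF ap] that pl' plain_unique par_sym by metis
  have bad_untouched: "s \<in> bad ?w' \<longleftrightarrow> forb (w s) (w (bar s)) \<or>
      (w s < w (bar s) \<and> (\<exists>t\<in>P. t \<noteq> s \<and> t \<notin> ?T \<and> par w s t))" if "s \<in> P" "s \<notin> ?T" for s
    using that par' same[OF that] unfolding bad_def by auto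
  have touched_par: "t = p \<or> t = bar p" if "t \<in> ?T" "par w s t" "s \<noteq> t" "s \<in> P" for s t
    using that plT plain_unique par_sym unfolding touched_def by (metis insertE singletonD insertI1 insertI2)
  show ?thesis
  proof (cases "forb (w p) (w (bar p))")
    case True
    have "bad w = insert p (insert (bar p) (bad ?w'))"
    proof (intro set_eqI)
      fix s
      show "s \<in> bad w \<longleftrightarrow> s \<in> insert p (insert (bar p) (bad ?w'))"
      proof (cases "s \<in> ?T")
        case T: True
        have "bar p \<in> bad w"
          using True forb_sym ne(4,37) unfolding bad_def by simp
        moreover have "s \<notin> bad w" if "s \<in> {q, bar q, r, bar r}"
          using plT[OF that] plain_not_bad by blast
        ultimately show ?thesis
          using nbad'[OF T] T pbad unfolding touched_def by blast
      next
        case F: False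
        then have neq: "s \<noteq> p" "s \<noteq> bar p" by (auto simp: touched_def)
        show ?thesis
        proof (cases "s \<in> P")
          case s: True
          have "forb (w s) (w (bar s))" if "t \<in> ?T" "par w s t" "t \<noteq> s" for t
          proof -
            have "t = p \<or> t = bar p" using touched_par[OF that(1,2)] that s by blast
            then show ?thesis
              using that(2) True forb_sym ne(37) unfolding par_def by metis
          qed
          then have "s \<in> bad w \<longleftrightarrow> s \<in> bad ?w'"
            using s unfolding bad_untouched[OF s F] bad_def[of w] by blast
          then show ?thesis using neq by simp
        qed (use neq in \<open>auto simp: bad_def\<close>)
      qed
    qed
    moreover have "p \<notin> bad ?w'" "bar p \<notin> bad ?w'"
      using nbad' by (auto simp: touched_def)
    ultimately show ?thesis using ne(13,14) finite_bad by simp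
  next
    case False
    then obtain t where lt: "w p < w (bar p)" and t: "t \<in> P" "t \<noteq> p" "par w p t"
      using pbad by (auto simp: bad_def)
    have tT: "t \<notin> ?T"
    proof
      assume "t \<in> ?T"
      then have "t = p \<or> t = bar p" using touched_par t ne(1) by blast
      then show False using t(2,3) lt unfolding par_def by (metis less_irrefl)
    qed
    have tuniq: "s = t" if "s \<in> P" "s \<noteq> p" "par w p s" for s
      using tame that t ne(1) unfolding tame_def by blast
    have parpt: "par w t p" using t par_sym by blast
    have "bad w = insert p (insert t (bad ?w'))"
    proof (intro set_eqI)
      fix s
      show "s \<in> bad w \<longleftrightarrow> s \<in> insert p (insert t (bad ?w'))"
      proof (cases "s \<in> ?T")
        case T: True
        have "bar p \<notin> bad w"
          using False lt order_less_not_sym[OF lt] forb_sym[of "w p"] ne(37) unfolding bad_def by simp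
        moreover have "s \<notin> bad w" if "s \<in> {q, bar q, r, bar r}"
          using plT[OF that] plain_not_bad by blast
        ultimately show ?thesis
          using nbad'[OF T] T tT pbad unfolding touched_def by blast
      next
        case F: False
        then have neq: "s \<noteq> p" by (auto simp: touched_def)
        show ?thesis
        proof (cases "s = t")
          case True
          have "t \<in> bad w" using t parpt lt ne(1) unfolding bad_def par_def by auto
          then show ?thesis using True by simp
        next
          case st: False
          show ?thesis
          proof (cases "s \<in> P")
            case s: True
            have "\<not> w s < w (bar s)" if "u \<in> ?T" "par w s u" "u \<noteq> s" for u
            proof -
              have "u = p \<or> u = bar p" using touched_par that s by blast
              moreover have "u \<noteq> p" using tuniq[OF s neq] that st par_sym by blast
              ultimately have "u = bar p" by blast
              then show ?thesis using that(2) lt ne(37) unfolding par_def by (metis less_asym)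
            qed
            then have "(\<exists>u\<in>P. u \<noteq> s \<and> u \<notin> ?T \<and> par w s u) \<longleftrightarrow> (\<exists>u\<in>P. u \<noteq> s \<and> par w s u)"
              if "w s < w (bar s)"
              using that by blast
            then have "s \<in> bad w \<longleftrightarrow> s \<in> bad ?w'"
              using s unfolding bad_untouched[OF s F] bad_def[of w] by blast
            then show ?thesis using neq st by simp
          qed (use neq st in \<open>auto simp: bad_def\<close>)
        qed
      qed
    qed
    moreover have "p \<notin> bad ?w'" using nbad' by (auto simp: touched_def)
    moreover have "t \<notin> bad ?w'"
    proof
      assume "t \<in> bad ?w'"
      then have "forb (w t) (w (bar t)) \<or> (\<exists>u\<in>P. u \<noteq> t \<and> u \<notin> ?T \<and> par w t u)"
        using bad_untouched[OF t(1) tT] by blast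
      then obtain u where "u \<in> P" "u \<noteq> t" "u \<notin> ?T" "par w t u"
        using False t(3) unfolding par_def by metis
      moreover have "u \<noteq> p" using \<open>u \<notin> ?T\<close> by (auto simp: touched_def)
      moreover have "par w p u" using t(3) \<open>par w t u\<close> unfolding par_def by metis
      ultimately show False using tuniq[of u] by blast
    qed
    ultimately show ?thesis using t finite_bad by simp
  qed
qed

end

section \<open>Counting forward switchings\<close>

lemma card_Sigma_ge:
  assumes "finite A" "\<And>a. a \<in> A \<Longrightarrow> finite (B a)" "\<And>a. a \<in> A \<Longrightarrow> k \<le> card (B a)"
  shows "card A * k \<le> card (SIGMA a:A. B a)"
  using assms sum_bounded_below[of A k "\<lambda>a. card (B a)"] by (simp add: card_SigmaI)

lemma card_Sigma_le:
  assumes "finite A" "\<And>a. a \<in> A \<Longrightarrow> finite (B a)" "\<And>a. a \<in> A \<Longrightarrow> card (B a) \<le> k"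
  shows "card (SIGMA a:A. B a) \<le> card A * k"
  using assms sum_bounded_above[of A "\<lambda>a. card (B a)" k] by (simp add: card_SigmaI)

lemma card_Diff_ge: "finite S \<Longrightarrow> card S \<le> k \<Longrightarrow> card A - k \<le> card (A - S)"
  using diff_card_le_card_Diff[of S A] by linarith

context pairing_words
begin

definition present :: "('p \<Rightarrow> 'v) \<Rightarrow> 'v \<Rightarrow> 'v \<Rightarrow> bool" where
  "present w u v \<longleftrightarrow> (\<exists>s\<in>P. w s = u \<and> w (bar s) = v)"

text \<open>
  Placing the label of a position in \<open>near w v\<close> opposite to \<open>v\<close> would create a loop, an edge of \<open>X\<close> or a parallel edge.
\<close>

definition near :: "('p \<Rightarrow> 'v) \<Rightarrow> 'v \<Rightarrow> 'p set" where
  "near w v = {p \<in> P. forb v (w p) \<or> present w v (w p)}"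

definition nonplain :: "('p \<Rightarrow> 'v) \<Rightarrow> 'p set" where
  "nonplain w = {p \<in> P. \<not> plain w p}"

definition fibre :: "('p \<Rightarrow> 'v) \<Rightarrow> 'v \<Rightarrow> 'p set" where
  "fibre w v = {p \<in> P. w p = v}"

text \<open>
  The scale of all error terms: up to constants, \<open>D\<close> bounds both the number of positions near a vertex and
  the expected number of defects.
\<close>

definition D :: nat where "D = d * (d + x)"

lemma present_sym: "present w u v \<longleftrightarrow> present w v u"
  unfolding present_def by (metis bar_bar bar_mem)

lemma bij_bar: "bij_betw bar P P"
  by (rule bij_betw_byWitness[where f' = bar]) (auto simp: bar_bar bar_mem)

lemma card_bar_image: "S \<subseteq> P \<Longrightarrow> card (bar ` S) = card S"
  using bij_bar by (meson bij_betw_def card_image inj_on_subset)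

lemma card_bar_vimage: "S \<subseteq> P \<Longrightarrow> card {p \<in> P. bar p \<in> S} = card S"
proof -
  assume S: "S \<subseteq> P"
  have "{p \<in> P. bar p \<in> S} = bar ` S"
    using S bar_bar bar_mem by (auto simp: image_iff) metis+
  then show ?thesis using card_bar_image[OF S] by simp
qed

lemma finite_simps [simp]:
  "finite (near w v)" "finite (nonplain w)" "finite (fibre w v)" "finite (bad w)"
  using finite_P by (auto simp: near_def nonplain_def fibre_def finite_bad)

lemma word_mem: "w \<in> words \<Longrightarrow> p \<in> P \<Longrightarrow> w p \<in> V"
  by (auto simp: words_def)

lemma card_fibre: "w \<in> words \<Longrightarrow> v \<in> V \<Longrightarrow> card (fibre w v) = d"
  by (auto simp: words_def fibre_def)

lemma d_le_D: "d \<le> D" "d * d \<le> D" "x * d \<le> D" "1 \<le> D"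
  using d_pos by (auto simp: D_def algebra_simps intro: le_trans[of d "d*d"] trans_le_add1)

lemma card_X_positions:
  assumes "w \<in> words" "v \<in> V"
  shows "card {p \<in> P. X v (w p)} = x * d"
proof -
  have "{p \<in> P. X v (w p)} = (\<Union>u\<in>{u \<in> V. X v u}. fibre w u)"
    using assms word_mem by (auto simp: fibre_def)
  also have "card \<dots> = (\<Sum>u\<in>{u \<in> V. X v u}. card (fibre w u))"
    using finite_V by (intro card_UN_disjoint) (auto simp: fibre_def finite_P)
  also have "\<dots> = (\<Sum>u\<in>{u \<in> V. X v u}. d)"
    using assms card_fibre by (intro sum.cong) auto
  finally show ?thesis using X_regular[OF assms(2)] by simp
qed

lemma card_near:
  assumes "w \<in> words" "v \<in> V"
  shows "card (near w v) \<le> 2 * D"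
proof -
  have "near w v \<subseteq> fibre w v \<union> ({p \<in> P. X v (w p)} \<union> (\<Union>s\<in>fibre w v. fibre w (w (bar s))))"
    by (auto simp: near_def fibre_def present_def forb_def)
  then have "card (near w v) \<le> card (fibre w v \<union> ({p \<in> P. X v (w p)} \<union> (\<Union>s\<in>fibre w v. fibre w (w (bar s)))))"
    by (intro card_mono) (auto simp: finite_P)
  also have "\<dots> \<le> card (fibre w v) + (card {p \<in> P. X v (w p)} + card (\<Union>s\<in>fibre w v. fibre w (w (bar s))))"
    by (meson card_Un_le add_left_mono le_trans)
  also have "card (\<Union>s\<in>fibre w v. fibre w (w (bar s))) \<le> (\<Sum>s\<in>fibre w v. card (fibre w (w (bar s))))"
    by (intro card_UN_le) simp
  also have "\<dots> = (\<Sum>s\<in>fibre w v. d)"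
    using assms by (intro sum.cong refl card_fibre word_mem) (auto simp: fibre_def bar_mem)
  also have "\<dots> = d * d" using card_fibre assms by simp
  also have "card (fibre w v) + (card {p \<in> P. X v (w p)} + d * d) = d + (x * d + d * d)"
    using card_fibre card_X_positions assms by simp
  also have "\<dots> = d + D" by (simp add: D_def algebra_simps)
  finally show ?thesis using d_le_D by linarith
qed

text \<open>
  Of each double edge only one orientation is counted as bad; the other one is recovered by \<open>bar\<close>.
\<close>

lemma card_nonplain: "card (nonplain w) \<le> 2 * card (bad w)"
proof -
  have "nonplain w \<subseteq> bad w \<union> bar ` bad w"
  proof
    fix p assume "p \<in> nonplain w"
    then have p: "p \<in> P" "\<not> plain w p" by (auto simp: nonplain_def)
    show "p \<in> bad w \<union> bar ` bad w"
    proof (cases "forb (w p) (w (bar p))")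
      case True
      then show ?thesis using p by (auto simp: bad_def)
    next
      case False
      then obtain q where q: "q \<in> P" "par w p q" "q \<noteq> p" using p by (auto simp: plain_def)
      show ?thesis
      proof (cases "w p < w (bar p)")
        case True
        then show ?thesis using p q by (auto simp: bad_def)
      next
        case F: False
        then have "w (bar p) < w (bar (bar p))"
          using False p bar_bar by (auto simp: forb_def)
        moreover have "par w (bar p) (bar q)" "bar q \<noteq> bar p"
          using q p bar_bar by (auto simp: par_def) metis+
        ultimately have "bar p \<in> bad w" using bar_mem p q by (auto simp: bad_def)
        then show ?thesis using bar_bar p by (metis UnI2 image_eqI)
      qed
    qed
  qed
  then have "card (nonplain w) \<le> card (bad w \<union> bar ` bad w)"
    by (intro card_mono) auto
  also have "\<dots> \<le> card (bad w) + card (bar ` bad w)" by (rule card_Un_le)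
  also have "\<dots> \<le> card (bad w) + card (bad w)" by (intro add_left_mono card_image_le) simp
  finally show ?thesis by simp
qed

lemma rot_cycle:
  assumes "apart p q r"
  shows "rot w p q r = rot w q r p" "rot w p q r = rot w r p q"
  using apart_neq[OF assms] by (auto simp: rot_def fun_eq_iff)

lemma apart_cycle: "apart p q r \<Longrightarrow> apart q r p" "apart p q r \<Longrightarrow> apart r p q"
  unfolding apart_def by (metis bar_bar)+

text \<open>
  Since \<open>rot\<close> is invariant under cyclic shifts of its arguments, this also describes the edges at \<open>q\<close> and \<open>r\<close>.
\<close>

lemma plain_after_rot:
  assumes ap: "apart p q r"
    and "\<not> forb (w q) (w (bar p))" "\<not> present w (w q) (w (bar p))"
    and "{w q, w (bar p)} \<noteq> {w r, w (bar q)}" "{w q, w (bar p)} \<noteq> {w p, w (bar r)}"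
  shows "plain (rot w p q r) p"
  unfolding plain_def
proof (intro conjI ballI impI)
  note rs = rot_simps[OF ap]
  show "\<not> forb (rot w p q r p) (rot w p q r (bar p))"
    using assms(2) rs by simp
  fix s assume s: "s \<in> P" "par (rot w p q r) p s"
  have eq: "rot w p q r s = w q" "rot w p q r (bar s) = w (bar p)"
    using s rs unfolding par_def by auto
  show "s = p"
  proof (cases "s \<in> touched p q r")
    case False
    then have "w s = w q" "w (bar s) = w (bar p)"
      using eq rot_untouched[OF ap s(1) False] by auto
    then show ?thesis using assms(3) s unfolding present_def by blast
  next
    case True
    have "s \<noteq> bar p"
    proof
      assume "s = bar p"
      then have "w (bar p) = w q" using eq(1) rs by metis
      then show False using assms(2) by (simp add: forb_def)
    qed
    moreover have "s \<noteq> q" using eq rs assms(4) by metis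
    moreover have "s \<noteq> bar q" using eq rs assms(4) apart_neq(38)[OF ap] by (metis insert_commute)
    moreover have "s \<noteq> r" using eq rs assms(5) by metis
    moreover have "s \<noteq> bar r" using eq rs assms(5) apart_neq(39)[OF ap] by (metis insert_commute)
    ultimately show ?thesis using True unfolding touched_def by blast
  qed
qed

lemma plain_labels: "plain w q \<Longrightarrow> w q \<noteq> w (bar q)"
  by (auto simp: plain_def forb_def)

lemma not_near: "q \<in> P \<Longrightarrow> q \<notin> near w v \<Longrightarrow> \<not> forb (w q) v \<and> \<not> present w (w q) v"
  using forb_sym present_sym by (auto simp: near_def)

lemma not_near': "q \<in> P \<Longrightarrow> q \<notin> near w v \<Longrightarrow> \<not> forb v (w q) \<and> \<not> present w v (w q)"
  by (auto simp: near_def)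

text \<open>
  The excluded sets are small, so that nearly every choice of \<open>q\<close> and \<open>r\<close> yields a switching. Excluding
  \<open>w q = w p\<close>, \<open>w r \<in> {w p, w q}\<close> and \<open>w (bar r) = w q\<close> prevents the three new edges from being
  parallel to each other.
\<close>

lemma switchable_if:
  assumes p: "p \<in> bad w" and q: "q \<in> P" and r: "r \<in> P"
    and q': "q \<notin> nonplain w" "q \<notin> {p, bar p}" "q \<notin> near w (w (bar p))" "w q \<noteq> w p"
    and r': "r \<notin> nonplain w" "r \<notin> {p, bar p, q, bar q}" "r \<notin> near w (w (bar q))"
      "bar r \<notin> near w (w p)" "w r \<noteq> w q" "w r \<noteq> w p" "w (bar r) \<noteq> w q"
  shows "switchable w p q r"
proof -
  have pP: "p \<in> P" using p by (auto simp: bad_def)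
  have ap: "apart p q r" using pP q r q' r' by (auto simp: apart_def)
  have pl: "plain w q" "plain w r" using q r q' r' by (auto simp: nonplain_def)
  note ql = plain_labels[OF pl(1)] and rl = plain_labels[OF pl(2)]
  have 1: "plain (rot w p q r) p"
    using not_near[OF q q'(3)] q' r' ql
    by (intro plain_after_rot[OF ap]) (auto simp: doubleton_eq_iff)
  have 2: "plain (rot w q r p) q"
    using not_near[OF r r'(3)] q' r' ql rl
    by (intro plain_after_rot[OF apart_cycle(1)[OF ap]]) (auto simp: doubleton_eq_iff)
  have 3: "plain (rot w r p q) r"
    using not_near'[OF bar_mem[OF r] r'(4)] q' r' ql rl
    by (intro plain_after_rot[OF apart_cycle(2)[OF ap]]) (auto simp: doubleton_eq_iff)
  show ?thesis
    unfolding switchable_def using ap p pl 1 2 3 rot_cycle[OF ap] by metis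
qed

definition forward :: "('p \<Rightarrow> 'v) \<Rightarrow> ('p \<times> 'p \<times> 'p) set" where
  "forward w = {(p, q, r). switchable w p q r}"

text \<open>
  The switchings from tame words that end in \<open>w\<close>, each described by the positions it moves.
\<close>

definition backward :: "('p \<Rightarrow> 'v) \<Rightarrow> ('p \<times> 'p \<times> 'p) set" where
  "backward w = {(p, q, r). apart p q r \<and> tame (rot w p r q) \<and> switchable (rot w p r q) p q r}"

lemma forward_subset: "forward w \<subseteq> bad w \<times> P \<times> P"
  by (auto simp: forward_def switchable_def apart_def)

lemma card_forward_le: "card (forward w) \<le> card (bad w) * (card P)\<^sup>2"
  using card_mono[OF _ forward_subset] finite_P finite_bad
  by (simp add: card_cartesian_product power2_eq_square)

lemma card_forward_ge:
  assumes w: "w \<in> words"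
  shows "card (bad w) * (card P - (2 * card (bad w) + 11 * D))\<^sup>2 \<le> card (forward w)"
proof -
  let ?K = "2 * card (bad w) + 11 * D"
  define EA where "EA p = nonplain w \<union> ({p, bar p} \<union> (near w (w (bar p)) \<union> fibre w (w p)))" for p
  define EB where "EB p q = nonplain w \<union> ({p, bar p, q, bar q} \<union> (near w (w (bar q)) \<union>
     ({r \<in> P. bar r \<in> near w (w p)} \<union> (fibre w (w q) \<union> (fibre w (w p) \<union> {r \<in> P. bar r \<in> fibre w (w q)})))))" for p q
  have finE: "finite (EA p)" "finite (EB p q)" for p q
    using finite_P by (auto simp: EA_def EB_def)
  have A: "card P - ?K \<le> card (P - EA p)" if "p \<in> P" for p
  proof (rule card_Diff_ge[OF finE(1)])
    have "card (EA p) \<le> card (nonplain w) + (card {p, bar p} + (card (near w (w (bar p))) + card (fibre w (w p))))"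
      unfolding EA_def by (meson card_Un_le add_left_mono le_trans)
    also have "\<dots> \<le> 2 * card (bad w) + (2 + (2 * D + d))"
      using that w card_nonplain card_near card_fibre word_mem bar_mem
      by (intro add_mono) (auto simp: card_insert_if)
    finally show "card (EA p) \<le> ?K" using d_le_D by linarith
  qed
  have B: "card P - ?K \<le> card (P - EB p q)" if "p \<in> P" "q \<in> P" for p q
  proof (rule card_Diff_ge[OF finE(2)])
    have "card (EB p q) \<le> card (nonplain w) + (card {p, bar p, q, bar q} + (card (near w (w (bar q))) +
        (card {r \<in> P. bar r \<in> near w (w p)} + (card (fibre w (w q)) + (card (fibre w (w p)) + card {r \<in> P. bar r \<in> fibre w (w q)})))))"
      unfolding EB_def by (meson card_Un_le add_left_mono le_trans)
    also have "card {r \<in> P. bar r \<in> near w (w p)} = card (near w (w p))"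
      by (rule card_bar_vimage) (auto simp: near_def)
    also have "card {r \<in> P. bar r \<in> fibre w (w q)} = card (fibre w (w q))"
      by (rule card_bar_vimage) (auto simp: fibre_def)
    also have "card (nonplain w) + (card {p, bar p, q, bar q} + (card (near w (w (bar q))) +
        (card (near w (w p)) + (card (fibre w (w q)) + (card (fibre w (w p)) + card (fibre w (w q)))))))
        \<le> 2 * card (bad w) + (4 + (2 * D + (2 * D + (d + (d + d)))))"
      using that w card_nonplain card_near card_fibre word_mem bar_mem
      by (intro add_mono) (auto simp: card_insert_if)
    finally show "card (EB p q) \<le> ?K" using d_le_D by linarith
  qed
  have bP: "p \<in> bad w \<Longrightarrow> p \<in> P" for p by (auto simp: bad_def)
  let ?S = "SIGMA p:bad w. SIGMA q:P - EA p. P - EB p q"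
  have "card (bad w) * ((card P - ?K) * (card P - ?K)) \<le> card ?S"
  proof (intro card_Sigma_ge)
    fix p assume p: "p \<in> bad w"
    have "(card P - ?K) * (card P - ?K) \<le> card (P - EA p) * (card P - ?K)"
      using A bP p by (intro mult_right_mono) auto
    also have "\<dots> \<le> card (SIGMA q:P - EA p. P - EB p q)"
      using B bP p finite_P by (intro card_Sigma_ge) auto
    finally show "(card P - ?K) * (card P - ?K) \<le> card (SIGMA q:P - EA p. P - EB p q)" .
  qed (use finite_P in auto)
  also have "?S \<subseteq> forward w"
    using bar_mem unfolding forward_def EA_def EB_def
    by (auto intro!: switchable_if simp: fibre_def)
  then have "card ?S \<le> card (forward w)"
    using finite_subset[OF forward_subset] finite_P by (intro card_mono) auto
  finally show ?thesis by (simp add: power2_eq_square)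
qed

end

section \<open>Counting backward switchings\<close>

context pairing_words
begin

text \<open>
  A switching that ends in \<open>w\<close> started from a word in which the edge at \<open>p\<close> had the labels \<open>w r\<close> and
  \<open>w (bar p)\<close>. The next three definitions list the pairs \<open>(p, r)\<close> for which this edge was a loop, an edge of \<open>X\<close>,
  or a copy of the edge at \<open>s\<close>.
\<close>

definition loops :: "('p \<Rightarrow> 'v) \<Rightarrow> ('p \<times> 'p) set" where
  "loops w = (SIGMA p:P. {r \<in> P. w r = w (bar p)} - {bar p})"

definition crossings :: "('p \<Rightarrow> 'v) \<Rightarrow> ('p \<times> 'p) set" where
  "crossings w = (SIGMA p:P. {r \<in> P. X (w (bar p)) (w r)})"

definition copies :: "('p \<Rightarrow> 'v) \<Rightarrow> 'p \<Rightarrow> ('p \<times> 'p) set" where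
  "copies w s = ({p \<in> P. w (bar p) = w (bar s)} - {s}) \<times> (fibre w (w s) - {s})"

text \<open>
  By the orientation chosen for bad positions, only edges read upwards are copied by a switching.
\<close>

definition ascents :: "('p \<Rightarrow> 'v) \<Rightarrow> 'p set" where
  "ascents w = {s \<in> P. w s < w (bar s)}"

lemma finite_pairs [simp]:
  "finite (loops w)" "finite (crossings w)" "finite (copies w s)" "finite (ascents w)"
  using finite_P by (auto simp: loops_def crossings_def copies_def ascents_def)

lemma card_loops:
  assumes "w \<in> words"
  shows "card (loops w) = card P * (d - 1)"
proof -
  have "card ({r \<in> P. w r = w (bar p)} - {bar p}) = d - 1" if "p \<in> P" for p
    using card_fibre[OF assms word_mem[OF assms bar_mem[OF that]]] that finite_P bar_mem
    by (subst card_Diff_singleton) (auto simp: fibre_def)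
  then show ?thesis
    using finite_P by (simp add: loops_def card_SigmaI)
qed

lemma card_crossings:
  assumes "w \<in> words"
  shows "card (crossings w) = card P * (x * d)"
  using card_X_positions[OF assms word_mem[OF assms bar_mem]] finite_P
  by (simp add: crossings_def card_SigmaI)

lemma card_copies:
  assumes "w \<in> words" "s \<in> P"
  shows "card (copies w s) = (d - 1)\<^sup>2"
proof -
  have "card {p \<in> P. w (bar p) = w (bar s)} = card {p \<in> P. bar p \<in> fibre w (w (bar s))}"
    using bar_mem by (intro arg_cong[where f = card]) (auto simp: fibre_def)
  also have "\<dots> = d"
    using assms card_fibre word_mem bar_mem by (subst card_bar_vimage) (auto simp: fibre_def)
  finally have 1: "card ({p \<in> P. w (bar p) = w (bar s)} - {s}) = d - 1"
    using assms finite_P by (subst card_Diff_singleton) auto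
  have "card (fibre w (w s) - {s}) = d - 1"
    using assms card_fibre word_mem by (subst card_Diff_singleton) (auto simp: fibre_def)
  then show ?thesis using 1 by (simp add: copies_def card_cartesian_product power2_eq_square)
qed

lemma card_ascents_le: "2 * card (ascents w) \<le> card P"
proof -
  have "ascents w \<inter> bar ` ascents w = {}"
    using bar_bar by (auto simp: ascents_def)
  moreover have "ascents w \<union> bar ` ascents w \<subseteq> P"
    using bar_mem by (auto simp: ascents_def)
  moreover have "card (bar ` ascents w) = card (ascents w)"
    by (rule card_bar_image) (auto simp: ascents_def)
  ultimately show ?thesis
    using card_mono[OF finite_P, of "ascents w \<union> bar ` ascents w"] by (simp add: card_Un_disjoint)
qed

lemma card_plain_ascents:
  "card P = 2 * card (ascents w - nonplain w) + card (nonplain w)"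
proof -
  let ?A = "ascents w - nonplain w"
  have "P = (?A \<union> bar ` ?A) \<union> nonplain w"
  proof
    show "P \<subseteq> (?A \<union> bar ` ?A) \<union> nonplain w"
    proof
      fix p assume p: "p \<in> P"
      show "p \<in> (?A \<union> bar ` ?A) \<union> nonplain w"
      proof (cases "plain w p")
        case True
        then have "w p < w (bar p) \<or> w (bar p) < w p" using plain_labels neq_iff by metis
        then have "p \<in> ?A \<or> bar p \<in> ?A"
          using True p bar_bar bar_mem plain_bar by (auto simp: ascents_def nonplain_def)
        then show ?thesis using p bar_bar by (metis UnI1 UnI2 image_eqI)
      qed (use p in \<open>auto simp: nonplain_def\<close>)
    qed
  qed (use bar_mem in \<open>auto simp: ascents_def nonplain_def\<close>)
  moreover have "?A \<inter> bar ` ?A = {}"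
    using bar_bar by (auto simp: ascents_def)
  moreover have "(?A \<union> bar ` ?A) \<inter> nonplain w = {}"
    using plain_bar bar_mem by (auto simp: ascents_def nonplain_def)
  moreover have "card (bar ` ?A) = card ?A"
    by (rule card_bar_image) (auto simp: ascents_def)
  ultimately show ?thesis
    using card_Un_disjoint[of ?A "bar ` ?A"] card_Un_disjoint[of "?A \<union> bar ` ?A" "nonplain w"] by simp
qed

text \<open>
  If the defect at \<open>p\<close> was a double edge, then its other copy is still present in \<open>w\<close>, because \<open>q\<close> and \<open>r\<close> lay in
  plain edges.
\<close>

lemma backward_subset:
  "backward w \<subseteq> (\<lambda>((p, r), q). (p, q, r)) ` ((loops w \<union> crossings w \<union> (\<Union>s\<in>ascents w. copies w s)) \<times> P)"
proof
  fix t assume "t \<in> backward w"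
  then obtain p q r where t: "t = (p, q, r)" and sw: "switchable (rot w p r q) p q r"
    by (auto simp: backward_def)
  let ?w = "rot w p r q"
  have ap: "apart p q r" using sw by (simp add: switchable_def)
  note ne = apart_neq[OF ap]
  have ap': "apart p r q" using apart_perm[OF ap] .
  note rs = rot_simps[OF ap']
  have "p \<in> bad ?w" using sw by (simp add: switchable_def)
  then consider "w r = w (bar p)" | "X (w r) (w (bar p))"
    | s where "w r < w (bar p)" "s \<in> P" "s \<noteq> p" "par ?w p s"
    using rs unfolding bad_def forb_def by auto
  then have "(p, r) \<in> loops w \<union> crossings w \<union> (\<Union>s\<in>ascents w. copies w s)"
  proof cases
    case 1
    then show ?thesis using ne(1,3,22) by (simp add: loops_def)
  next
    case 2
    then show ?thesis using ne(1,3) X_sym by (simp add: crossings_def)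
  next
    case 3
    have pl: "plain ?w s'" if "s' \<in> {q, bar q, r, bar r}" for s'
      using that sw plain_bar ne(2,3) unfolding switchable_def by blast
    have "s \<notin> {q, bar q, r, bar r}"
    proof
      assume "s \<in> {q, bar q, r, bar r}"
      then have "p = s" using 3(4) pl plain_unique[of ?w s p] par_sym[of ?w] ne(1) by metis
      then show False using 3(3) by simp
    qed
    moreover have "s \<noteq> bar p"
      using 3(1,4) rs ne(37) unfolding par_def by (metis less_irrefl)
    ultimately have out: "s \<notin> touched p r q" using 3 by (auto simp: touched_def)
    have "w s = w r" "w (bar s) = w (bar p)"
      using rot_untouched[OF ap' 3(2) out] 3(4) rs unfolding par_def by auto
    then have "s \<in> ascents w" "(p, r) \<in> copies w s"
      using 3 out ne(1-3) by (auto simp: ascents_def copies_def fibre_def touched_def)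
    then show ?thesis by blast
  qed
  then show "t \<in> (\<lambda>((p, r), q). (p, q, r)) ` ((loops w \<union> crossings w \<union> (\<Union>s\<in>ascents w. copies w s)) \<times> P)"
    using t ne by force
qed

text \<open>
  The number of pairs \<open>(p, r)\<close> is at most \<open>M (d - 1) + M x d + (M/2) (d - 1)\<^sup>2\<close>, and \<open>q\<close> is arbitrary.
\<close>

lemma card_backward_le:
  assumes w: "w \<in> words"
  shows "2 * card (backward w) \<le> (card P)\<^sup>2 * (2 * (d - 1) + 2 * x * d + (d - 1)\<^sup>2)"
proof -
  let ?L = "loops w \<union> crossings w \<union> (\<Union>s\<in>ascents w. copies w s)"
  have "card (\<Union>s\<in>ascents w. copies w s) \<le> (\<Sum>s\<in>ascents w. card (copies w s))"
    by (intro card_UN_le) simp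
  also have "\<dots> = (\<Sum>s\<in>ascents w. (d - 1)\<^sup>2)"
    using w by (intro sum.cong refl card_copies) (auto simp: ascents_def)
  finally have 1: "card (\<Union>s\<in>ascents w. copies w s) \<le> card (ascents w) * (d - 1)\<^sup>2" by simp
  have "card ?L \<le> card (loops w) + card (crossings w) + card (\<Union>s\<in>ascents w. copies w s)"
    by (meson card_Un_le add_right_mono le_trans)
  then have "2 * card ?L \<le> 2 * (card P * (d - 1) + card P * (x * d)) + (2 * card (ascents w)) * (d - 1)\<^sup>2"
    using 1 card_loops[OF w] card_crossings[OF w] by (simp add: algebra_simps)
  also have "\<dots> \<le> 2 * (card P * (d - 1) + card P * (x * d)) + card P * (d - 1)\<^sup>2"
    using card_ascents_le by (intro add_left_mono mult_right_mono) auto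
  finally have L: "2 * card ?L \<le> card P * (2 * (d - 1) + 2 * x * d + (d - 1)\<^sup>2)"
    by (simp add: algebra_simps)
  have "card (backward w) \<le> card (?L \<times> P)"
    using finite_P by (intro surj_card_le[OF _ backward_subset]) auto
  then have "2 * card (backward w) \<le> (2 * card ?L) * card P"
    by (simp add: card_cartesian_product)
  also have "\<dots> \<le> (card P * (2 * (d - 1) + 2 * x * d + (d - 1)\<^sup>2)) * card P"
    using L by (intro mult_right_mono) auto
  finally show ?thesis by (simp add: power2_eq_square algebra_simps)
qed

text \<open>
  Restricting to plain edges makes the union of the sets of copies disjoint.
\<close>

definition insertable :: "('p \<Rightarrow> 'v) \<Rightarrow> ('p \<times> 'p) set" where
  "insertable w = loops w \<union> crossings w \<union> (\<Union>s\<in>ascents w - nonplain w. copies w s)"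

lemma finite_insertable [simp]: "finite (insertable w)"
  by (simp add: insertable_def)

lemma card_insertable:
  assumes w: "w \<in> words"
  shows "card P * (2 * (d - 1) + 2 * x * d + (d - 1)\<^sup>2) \<le> 2 * card (insertable w) + 2 * card (bad w) * D"
proof -
  let ?A = "ascents w - nonplain w"
  have uniq: "s = s'" if "s \<in> ?A" "s' \<in> ?A" "(p, r) \<in> copies w s" "(p, r) \<in> copies w s'" for s s' p r
  proof -
    have "plain w s" "s' \<in> P" using that(1,2) by (simp_all add: nonplain_def ascents_def)
    moreover have "w r = w s" "w (bar p) = w (bar s)" using that(3) by (simp_all add: copies_def fibre_def)
    moreover have "w r = w s'" "w (bar p) = w (bar s')" using that(4) by (simp_all add: copies_def fibre_def)
    ultimately have "par w s s'" unfolding par_def by metis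
    then show ?thesis using plain_unique \<open>plain w s\<close> \<open>s' \<in> P\<close> by metis
  qed
  have "card (\<Union>s\<in>?A. copies w s) = (\<Sum>s\<in>?A. card (copies w s))"
    by (rule card_UN_disjoint) (use uniq in auto)
  also have "\<dots> = (\<Sum>s\<in>?A. (d - 1)\<^sup>2)"
    using w by (intro sum.cong refl card_copies) (auto simp: ascents_def)
  finally have 1: "card (\<Union>s\<in>?A. copies w s) = card ?A * (d - 1)\<^sup>2" by simp
  have "(loops w \<union> crossings w) \<inter> (\<Union>s\<in>?A. copies w s) = {}"
  proof -
    have False if "s \<in> ?A" "(p, r) \<in> copies w s" "(p, r) \<in> loops w \<union> crossings w" for p r s
    proof -
      have "\<not> forb (w s) (w (bar s))" using that(1) by (auto simp: nonplain_def ascents_def plain_def)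
      moreover have "w s = w r" "w (bar s) = w (bar p)" using that(2) by (auto simp: copies_def fibre_def)
      ultimately show False using that(3) X_sym by (auto simp: loops_def crossings_def forb_def)
    qed
    then show ?thesis by auto
  qed
  then have "card (insertable w) = card (loops w \<union> crossings w) + card ?A * (d - 1)\<^sup>2"
    unfolding insertable_def using 1 by (subst card_Un_disjoint) auto
  also have "loops w \<inter> crossings w = {}"
    using X_irrefl by (auto simp: loops_def crossings_def)
  then have "card (loops w \<union> crossings w) = card P * (d - 1) + card P * (x * d)"
    using card_loops[OF w] card_crossings[OF w] by (simp add: card_Un_disjoint)
  finally have "2 * card (insertable w) + card (nonplain w) * (d - 1)\<^sup>2 =
      2 * (card P * (d - 1) + card P * (x * d)) + (2 * card ?A + card (nonplain w)) * (d - 1)\<^sup>2"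
    by (simp add: algebra_simps)
  also have "\<dots> = card P * (2 * (d - 1) + 2 * x * d + (d - 1)\<^sup>2)"
    unfolding card_plain_ascents[symmetric] by (simp add: algebra_simps)
  finally have "card P * (2 * (d - 1) + 2 * x * d + (d - 1)\<^sup>2) = 2 * card (insertable w) + card (nonplain w) * (d - 1)\<^sup>2"
    by simp
  also have "card (nonplain w) * (d - 1)\<^sup>2 \<le> 2 * card (bad w) * D"
  proof (intro mult_mono card_nonplain)
    have "(d - 1)\<^sup>2 \<le> d\<^sup>2" by (intro power_mono) auto
    then show "(d - 1)\<^sup>2 \<le> D" using d_le_D(2) by (simp add: power2_eq_square)
  qed auto
  finally show ?thesis by simp
qed

definition clones :: "('p \<Rightarrow> 'v) \<Rightarrow> 'p \<Rightarrow> 'p \<Rightarrow> 'p set" where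
  "clones w p r = {s \<in> P. w s = w r \<and> w (bar s) = w (bar p)}"

text \<open>
  The pairs for which an edge with labels \<open>w r\<close>, \<open>w (bar p)\<close> can be inserted without the defects
  overlapping: such an edge is parallel to nothing unless it is meant to double a plain edge.
\<close>

definition clean :: "('p \<Rightarrow> 'v) \<Rightarrow> ('p \<times> 'p) set" where
  "clean w = {(p, r) \<in> insertable w. plain w p \<and> plain w r \<and> clones w p r \<inter> nonplain w = {}}"

lemma insertable_near:
  assumes "(p, r) \<in> insertable w"
  shows "p \<in> P" "r \<in> P" "r \<in> near w (w (bar p))" "bar p \<in> near w (w r)"
proof -
  have "p \<in> P \<and> r \<in> P \<and> (forb (w r) (w (bar p)) \<or> present w (w r) (w (bar p)))"
    using assms X_sym bar_mem
    unfolding insertable_def loops_def crossings_def copies_def fibre_def forb_def present_def ascents_def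
    by auto
  then show "p \<in> P" "r \<in> P" "r \<in> near w (w (bar p))" "bar p \<in> near w (w r)"
    using forb_sym present_sym bar_mem by (auto simp: near_def)
qed

text \<open>
  Each of the at most \<open>2 card (bad w)\<close> positions in edges that are not plain spoils \<open>O (D)\<close> pairs: as \<open>p\<close>, as \<open>r\<close>, or
  as a parallel edge.
\<close>

lemma card_clean:
  assumes w: "w \<in> words"
  shows "card (insertable w) \<le> card (clean w) + 10 * card (bad w) * D"
proof -
  let ?N = "nonplain w"
  define E1 where "E1 = (SIGMA p:?N. near w (w (bar p)))"
  define E2 where "E2 = (SIGMA r:?N. {p \<in> P. bar p \<in> near w (w r)})"
  define E3 where "E3 = (SIGMA s:?N. {p \<in> P. bar p \<in> fibre w (w (bar s))} \<times> fibre w (w s))"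
  have NP: "s \<in> ?N \<Longrightarrow> s \<in> P" for s by (auto simp: nonplain_def)
  have fin: "finite E1" "finite E2" "finite E3" using finite_P by (auto simp: E1_def E2_def E3_def)
  have sub: "insertable w \<subseteq> clean w \<union> (E1 \<union> ((\<lambda>(r, p). (p, r)) ` E2 \<union> snd ` E3))"
  proof
    fix pr assume pr: "pr \<in> insertable w"
    obtain p r where [simp]: "pr = (p, r)" by (cases pr)
    note ins = insertable_near[OF pr[simplified]]
    show "pr \<in> clean w \<union> (E1 \<union> ((\<lambda>(r, p). (p, r)) ` E2 \<union> snd ` E3))"
    proof (cases "p \<in> ?N")
      case True
      then show ?thesis using ins by (auto simp: E1_def)
    next
      case p: False
      show ?thesis
      proof (cases "r \<in> ?N")
        case True
        then have "(r, p) \<in> E2" using ins by (auto simp: E2_def)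
        then show ?thesis by force
      next
        case r: False
        show ?thesis
        proof (cases "clones w p r \<inter> ?N = {}")
          case True
          then show ?thesis using p r pr ins by (auto simp: clean_def nonplain_def)
        next
          case False
          then obtain s where "s \<in> ?N" "w s = w r" "w (bar s) = w (bar p)" by (auto simp: clones_def)
          then have "(s, (p, r)) \<in> E3" using ins bar_mem by (auto simp: E3_def fibre_def)
          then show ?thesis by force
        qed
      qed
    qed
  qed
  have "finite (clean w)" by (rule finite_subset[OF _ finite_insertable[of w]]) (auto simp: clean_def)
  then have "card (insertable w) \<le> card (clean w \<union> (E1 \<union> ((\<lambda>(r, p). (p, r)) ` E2 \<union> snd ` E3)))"
    using fin by (intro card_mono sub) auto
  also have "\<dots> \<le> card (clean w) + (card E1 + (card ((\<lambda>(r, p). (p, r)) ` E2) + card (snd ` E3)))"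
    by (meson card_Un_le add_left_mono le_trans)
  also have "\<dots> \<le> card (clean w) + (card E1 + (card E2 + card E3))"
    by (intro add_left_mono add_mono card_image_le fin le_refl)
  also have "\<dots> \<le> card (clean w) + (card ?N * (2 * D) + (card ?N * (2 * D) + card ?N * D))"
  proof (intro add_left_mono add_mono)
    show "card E1 \<le> card ?N * (2 * D)"
      unfolding E1_def using w NP word_mem bar_mem by (intro card_Sigma_le card_near) auto
    show "card E2 \<le> card ?N * (2 * D)"
      unfolding E2_def
    proof (intro card_Sigma_le)
      fix r assume "r \<in> ?N"
      then show "card {p \<in> P. bar p \<in> near w (w r)} \<le> 2 * D"
        using card_near[OF w word_mem[OF w]] NP by (subst card_bar_vimage) (auto simp: near_def)
    qed (use finite_P in auto)
    show "card E3 \<le> card ?N * D"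
      unfolding E3_def
    proof (intro card_Sigma_le)
      fix s assume s: "s \<in> ?N"
      have "card {p \<in> P. bar p \<in> fibre w (w (bar s))} = d"
        using card_fibre[OF w word_mem[OF w bar_mem]] NP s by (subst card_bar_vimage) (auto simp: fibre_def)
      then show "card ({p \<in> P. bar p \<in> fibre w (w (bar s))} \<times> fibre w (w s)) \<le> D"
        using card_fibre[OF w word_mem[OF w]] NP s d_le_D by (simp add: card_cartesian_product)
    qed (use finite_P in auto)
  qed
  also have "\<dots> = card (clean w) + card ?N * (5 * D)" by simp
  also have "\<dots> \<le> card (clean w) + (2 * card (bad w)) * (5 * D)"
    using card_nonplain by (intro add_left_mono mult_right_mono) auto
  finally show ?thesis by simp
qed

text \<open>
  Undoing a switching at a clean pair creates exactly the desired defect. The new edges at \<open>q\<close> and \<open>r\<close> are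
  plain by the choice of \<open>q\<close>. The position \<open>p\<close> is parallel only to itself, to \<open>bar p\<close> if a loop was created, and to
  the single clone if an edge was doubled; hence the new word is tame.
\<close>

lemma backward_if:
  assumes w: "w \<in> words" "tame w" and pr: "(p, r) \<in> clean w"
    and q: "q \<in> P" "q \<notin> nonplain w" "q \<notin> {p, bar p, r, bar r}" "q \<notin> near w (w (bar r))"
      "bar q \<notin> near w (w p)" "w q \<noteq> w p" "q \<notin> clones w p r" "bar q \<notin> clones w p r"
  shows "(p, q, r) \<in> backward w"
proof -
  let ?w = "rot w p r q"
  have ins: "(p, r) \<in> insertable w" and pl: "plain w p" "plain w r" "plain w q"
    and cl: "\<And>s. s \<in> clones w p r \<Longrightarrow> plain w s"
    using pr q by (auto simp: clean_def nonplain_def clones_def)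
  note P = insertable_near(1,2)[OF ins]
  have ascD: "w s < w (bar s)" if "s \<in> ascents w" for s using that by (simp add: ascents_def)
  have clone_uniq: "s = s'" if "s \<in> clones w p r" "s' \<in> clones w p r" for s s'
    using plain_unique[OF cl[OF that(1)], of s'] that by (simp add: clones_def par_def)
  have copy: "\<exists>s\<in>clones w p r. s \<noteq> p \<and> s \<noteq> r \<and> w r < w (bar p)" if nf: "\<not> forb (w r) (w (bar p))"
  proof -
    obtain s where s: "s \<in> ascents w - nonplain w" "(p, r) \<in> copies w s"
      using nf ins X_sym by (auto simp: insertable_def loops_def crossings_def forb_def)
    then show ?thesis using ascD[of s]
      by (intro bexI[of _ s]) (auto simp: copies_def fibre_def clones_def ascents_def)
  qed
  have rp: "r \<noteq> p"
  proof
    assume "r = p"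
    show False
    proof (cases "forb (w r) (w (bar p))")
      case True
      then show False using pl(1) \<open>r = p\<close> by (simp add: plain_def)
    next
      case False
      then obtain s where "s \<in> clones w p r" "s \<noteq> p" using copy by blast
      moreover have "p \<in> clones w p r" using \<open>r = p\<close> P by (auto simp: clones_def)
      ultimately show False using clone_uniq by blast
    qed
  qed
  have rbp: "r \<noteq> bar p"
  proof
    assume "r = bar p"
    then have "(p, r) \<notin> loops w" "(p, r) \<notin> crossings w"
      using X_irrefl by (auto simp: loops_def crossings_def)
    then obtain s where "s \<in> ascents w" "(p, r) \<in> copies w s"
      using ins by (auto simp: insertable_def)
    then show False
      using ascD[of s] \<open>r = bar p\<close> unfolding copies_def fibre_def
      by (metis (mono_tags, lifting) DiffD1 mem_Collect_eq mem_Sigma_iff less_irrefl)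
  qed
  have ap: "apart p q r" using P q rp rbp by (auto simp: apart_def) (metis bar_bar)+
  note ne = apart_neq[OF ap]
  have ap': "apart p r q" using apart_perm[OF ap] .
  note rs = rot_simps[OF ap']
  note ql = plain_labels[OF pl(3)] and rl = plain_labels[OF pl(2)]
  have no: "\<not> forb (w q) (w (bar r))" "\<not> present w (w q) (w (bar r))"
      "\<not> forb (w p) (w (bar q))" "\<not> present w (w p) (w (bar q))"
    using not_near[OF q(1,4)] not_near'[OF bar_mem[OF q(1)] q(5)] by auto
  have sep: "{w q, w (bar r)} \<noteq> {w r, w (bar p)}" "{w p, w (bar q)} \<noteq> {w r, w (bar p)}"
  proof -
    have aux: "forb a b \<or> present w a b" if "{a, b} = {w r, w (bar p)}" for a b
    proof -
      have "present w (w r) (w (bar p))" if "\<not> forb (w r) (w (bar p))"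
        using copy[OF that] by (auto simp: clones_def present_def)
      then show ?thesis using that forb_sym present_sym by (metis doubleton_eq_iff)
    qed
    show "{w q, w (bar r)} \<noteq> {w r, w (bar p)}" "{w p, w (bar q)} \<noteq> {w r, w (bar p)}"
      using aux no by blast+
  qed
  have 2: "plain (rot w r q p) r"
    using no sep q(6) ql
    by (intro plain_after_rot[OF apart_cycle(1)[OF ap']]) (auto simp: doubleton_eq_iff)
  have 3: "plain (rot w q p r) q"
    using no sep q(6) ql
    by (intro plain_after_rot[OF apart_cycle(2)[OF ap']]) (auto simp: doubleton_eq_iff)
  have plq: "plain ?w q" and plr: "plain ?w r" using 2 3 rot_cycle[OF ap'] by metis+
  have out: "s \<notin> touched p r q" if "par ?w s t" "s \<noteq> t" "s \<in> P" "t \<in> P" "s \<noteq> p" "s \<noteq> bar p" for s t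
  proof
    assume "s \<in> touched p r q"
    then have "plain ?w s" using that plq plr plain_bar ne(2,3) unfolding touched_def by blast
    then show False using plain_unique that by blast
  qed
  have lab: "w s = w r \<and> w (bar s) = w (bar p)" if "par ?w p s" "s \<in> P" "s \<notin> touched p r q" for s
    using that rot_untouched[OF ap'] rs unfolding par_def by metis
  have lab': "par ?w p (bar s)" if "par ?w (bar p) s" "s \<in> P" for s
    using that ne(37) bar_bar unfolding par_def by metis
  \<comment> \<open>Besides p itself, only bar p and the unique clone can be parallel to p.\<close>
  have par_p: "s = bar p \<or> s \<in> clones w p r" if "par ?w p s" "s \<in> P" "s \<noteq> p" for s
  proof (cases "s = bar p")
    case False
    then have "s \<notin> touched p r q" using out[of s p] that P par_sym by blast
    then show ?thesis using lab that by (auto simp: clones_def)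
  qed simp
  have bar_clone: "forb (w r) (w (bar p))" if "par ?w p (bar p)"
    using that rs ne(37) unfolding par_def forb_def by metis
  have noclone: "clones w p r = {}" if "forb (w r) (w (bar p))"
    using cl that by (auto simp: clones_def plain_def)
  have par_p_uniq: "s = t" if "par ?w p s" "par ?w p t" "s \<in> P" "t \<in> P" "s \<noteq> p" "t \<noteq> p" for s t
    using par_p[OF that(1,3,5)] par_p[OF that(2,4,6)] that(1,2) bar_clone noclone clone_uniq by blast
  have par_pair: "par w s t" if "par ?w s t" "s \<noteq> t" "s \<in> P" "t \<in> P" "s \<noteq> p" "s \<noteq> bar p" "t \<noteq> p" "t \<noteq> bar p" for s t
    using par_rot_untouched[OF ap'] out[of s t] out[of t s] that par_sym by metis
  have par_trans: "par ?w t u" if "par ?w s t" "par ?w s u" for s t u using that by (simp add: par_def)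
  have uniq3: "s = t \<or> s = u \<or> t = u" if *: "s \<in> P" "t \<in> P" "u \<in> P" "par ?w s t" "par ?w s u" for s t u
  proof -
    have A: "t = u" if "p = s" "t \<noteq> p" "u \<noteq> p" using par_p_uniq * that by blast
    have A2: "s = u" if "p = t" "s \<noteq> p" "u \<noteq> p" using par_p_uniq[of s u] * par_sym par_trans that by blast
    have A3: "s = t" if "p = u" "s \<noteq> p" "t \<noteq> p" using par_p_uniq[of s t] * par_sym par_trans that by blast
    have B: "t = u" if "par ?w (bar p) t" "par ?w (bar p) u" "t \<noteq> bar p" "u \<noteq> bar p" "t \<in> P" "u \<in> P" for t u
    proof -
      have "bar t = bar u"
        using par_p_uniq[OF lab'[OF that(1,5)] lab'[OF that(2,6)]] that bar_mem bar_bar P by metis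
      then show ?thesis using that bar_bar by metis
    qed
    show ?thesis
    proof (cases "p \<in> {s, t, u} \<or> bar p \<in> {s, t, u}")
      case True
      then show ?thesis
      proof
        assume "bar p \<in> {s, t, u}"
        then consider "bar p = s" | "bar p = t" | "bar p = u" by blast
        then show ?thesis
        proof cases
          case 1 then show ?thesis using B[of t u] * by blast
        next
          case 2 then show ?thesis using B[of s u] * par_sym par_trans by blast
        next
          case 3 then show ?thesis using B[of s t] * par_sym par_trans by blast
        qed
      qed (use A A2 A3 in blast)
    next
      case False
      then have "s = t \<or> s = u \<or> (par w s t \<and> par w s u)" using par_pair * by blast
      then show ?thesis using w(2) * unfolding tame_def by blast
    qed
  qed
  have X_uniq: "s = t" if *: "s \<in> P" "t \<in> P" "par ?w s t" "X (?w s) (?w (bar s))" for s t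
  proof -
    have key: "t = p" if "par ?w p t" "t \<in> P" "X (?w p) (?w (bar p))" for t
    proof (rule ccontr)
      assume "t \<noteq> p"
      have F: "forb (w r) (w (bar p))" using that(3) rs by (simp add: forb_def)
      then have "t = bar p" using par_p[OF that(1,2) \<open>t \<noteq> p\<close>] noclone by blast
      then have "?w p = ?w (bar p)" using that(1) unfolding par_def by metis
      then show False using that(3) X_irrefl by metis
    qed
    have keyb: "t = bar p" if "par ?w (bar p) t" "t \<in> P" "X (?w (bar p)) (?w (bar (bar p)))" for t
    proof -
      have "bar t = p"
        using key[OF lab'[OF that(1,2)] bar_mem[OF that(2)]] that(3) ne(37) X_sym by metis
      then show ?thesis using bar_bar that(2) by metis
    qed
    have Xt: "X (?w t) (?w (bar t))" using * by (simp add: par_def)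
    show ?thesis
    proof (cases "p \<in> {s, t} \<or> bar p \<in> {s, t}")
      case True
      then show ?thesis using key keyb * Xt par_sym by blast
    next
      case False
      then have st: "s \<noteq> p" "s \<noteq> bar p" "t \<noteq> p" "t \<noteq> bar p" by auto
      show ?thesis
      proof (rule ccontr)
        assume neq: "s \<noteq> t"
        have "par w s t" using par_pair[OF *(3) neq *(1,2) st] .
        moreover have "X (w s) (w (bar s))"
          using rot_untouched[OF ap' *(1) out[OF *(3) neq *(1,2) st(1,2)]] *(4) by metis
        ultimately show False using w(2) * neq unfolding tame_def by blast
      qed
    qed
  qed
  have tame': "tame ?w" unfolding tame_def using uniq3 X_uniq by blast
  have pbad: "p \<in> bad ?w"
  proof (cases "forb (w r) (w (bar p))")
    case True
    then show ?thesis using P rs by (simp add: bad_def)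
  next
    case False
    then obtain s where s: "s \<in> clones w p r" "s \<noteq> p" "s \<noteq> r" "w r < w (bar p)" using copy by blast
    have sP: "s \<in> P" "w s = w r" "w (bar s) = w (bar p)" using s by (auto simp: clones_def)
    have "s \<notin> touched p r q"
    proof -
      have "s \<noteq> q" "s \<noteq> bar q" using q s ne(38) by auto
      moreover have "s \<noteq> bar p" using sP s ne(37) by (metis less_irrefl)
      moreover have "s \<noteq> bar r" using sP s ne(39) rl by metis
      ultimately show ?thesis using s by (auto simp: touched_def)
    qed
    then have "par ?w p s" using rot_untouched[OF ap' sP(1)] sP rs by (simp add: par_def)
    then show ?thesis using s sP P rs by (auto simp: bad_def)
  qed
  have inv: "rot ?w p q r = w" using rot_inverse(1)[OF ap'] .
  show ?thesis
    unfolding backward_def switchable_def using ap tame' pbad plq plr pl inv by auto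
qed

end

section \<open>Ratios of consecutive levels\<close>

text \<open>
  The union bound in the form in which it is used for events that are parametrised by positions and labels.
\<close>

lemma card_UN_bound:
  assumes "finite I" "\<And>i. i \<in> I \<Longrightarrow> real (card (E i)) \<le> b" "real (card I) \<le> c" "0 \<le> b"
  shows "real (card (\<Union>i\<in>I. E i)) \<le> c * b"
proof -
  have "real (card (\<Union>i\<in>I. E i)) \<le> real (\<Sum>i\<in>I. card (E i))"
    using card_UN_le[OF assms(1), of E] by (rule of_nat_mono)
  also have "\<dots> = (\<Sum>i\<in>I. real (card (E i)))" by simp
  also have "\<dots> \<le> real (card I) * b"
    using sum_bounded_above[of I "\<lambda>i. real (card (E i))" b] assms(2) by simp
  also have "\<dots> \<le> c * b" using assms by (intro mult_right_mono) auto
  finally show ?thesis .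
qed

lemma even_card_involution:
  assumes "finite S" "\<And>s. s \<in> S \<Longrightarrow> f s \<in> S" "\<And>s. s \<in> S \<Longrightarrow> f (f s) = s" "\<And>s. s \<in> S \<Longrightarrow> f s \<noteq> s"
  shows "even (card S)"
  using assms
proof (induction "card S" arbitrary: S rule: less_induct)
  case less
  show ?case
  proof (cases "S = {}")
    case False
    then obtain s where s: "s \<in> S" by blast
    let ?S = "S - {s, f s}"
    have fs: "f s \<in> S" "f s \<noteq> s" using less s by auto
    have c: "card S = card ?S + 2"
    proof -
      have "card {s, f s} = 2" using fs by simp
      moreover have "card ?S = card S - card {s, f s}"
        using s fs less.prems(1) by (intro card_Diff_subset) auto
      moreover have "card {s, f s} \<le> card S" using s fs less.prems(1) by (intro card_mono) auto
      ultimately show ?thesis by linarith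
    qed
    have "even (card ?S)"
    proof (rule less.hyps)
      show "f t \<in> ?S" if "t \<in> ?S" for t
        using that less.prems s by (metis Diff_iff insert_iff singletonD)
    qed (use c less.prems in auto)
    then show ?thesis using c by simp
  qed simp
qed

context pairing_words
begin

lemma card_backward_ge:
  assumes w: "w \<in> words" "tame w"
  shows "card (clean w) * (card P - (2 * card (bad w) + 11 * D)) \<le> card (backward w)"
proof -
  let ?K = "2 * card (bad w) + 11 * D"
  define E where "E pr = (case pr of (p, r) \<Rightarrow> nonplain w \<union> ({p, bar p, r, bar r} \<union> (near w (w (bar r)) \<union>
     ({q \<in> P. bar q \<in> near w (w p)} \<union> (fibre w (w p) \<union> (clones w p r \<union> {q \<in> P. bar q \<in> clones w p r}))))))" for pr
  have fin_cl: "finite (clones w p r)" for p r using finite_P by (simp add: clones_def)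
  have finE: "finite (E pr)" for pr
    using finite_P fin_cl by (auto simp: E_def split: prod.split)
  have fin: "finite (clean w)"
    by (rule finite_subset[OF _ finite_insertable[of w]]) (auto simp: clean_def)
  have E: "card P - ?K \<le> card (P - E pr)" if "pr \<in> clean w" for pr
  proof (rule card_Diff_ge[OF finE])
    obtain p r where pr: "pr = (p, r)" by (cases pr)
    have P: "p \<in> P" "r \<in> P" using that insertable_near by (auto simp: pr clean_def)
    have "is_singleton (clones w p r) \<or> clones w p r = {}"
    proof -
      have "s = t" if st: "s \<in> clones w p r" "t \<in> clones w p r" for s t
      proof -
        have "plain w s" using \<open>pr \<in> clean w\<close> st by (auto simp: pr clean_def nonplain_def clones_def)
        then show ?thesis using plain_unique[of w s t] st by (simp add: clones_def par_def)
      qed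
      then show ?thesis by (meson is_singletonI' empty_iff equals0I)
    qed
    then have cl: "card (clones w p r) \<le> 1" by (auto simp: is_singleton_altdef)
    have "card (E pr) \<le> card (nonplain w) + (card {p, bar p, r, bar r} + (card (near w (w (bar r))) +
     (card {q \<in> P. bar q \<in> near w (w p)} + (card (fibre w (w p)) + (card (clones w p r) + card {q \<in> P. bar q \<in> clones w p r})))))"
      unfolding E_def pr prod.case by (meson card_Un_le add_left_mono le_trans)
    also have "card {q \<in> P. bar q \<in> near w (w p)} = card (near w (w p))"
      by (rule card_bar_vimage) (auto simp: near_def)
    also have "card {q \<in> P. bar q \<in> clones w p r} = card (clones w p r)"
      by (rule card_bar_vimage) (auto simp: clones_def)
    also have "card (nonplain w) + (card {p, bar p, r, bar r} + (card (near w (w (bar r))) +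
     (card (near w (w p)) + (card (fibre w (w p)) + (card (clones w p r) + card (clones w p r))))))
      \<le> 2 * card (bad w) + (4 + (2 * D + (2 * D + (d + (1 + 1)))))"
      using P w card_nonplain card_near card_fibre word_mem bar_mem cl
      by (intro add_mono) (auto simp: card_insert_if)
    finally show "card (E pr) \<le> ?K" using d_le_D by linarith
  qed
  let ?S = "SIGMA pr:clean w. P - E pr"
  have "card (clean w) * (card P - ?K) \<le> card ?S"
    using E fin finite_P by (intro card_Sigma_ge) auto
  also have "\<dots> = card ((\<lambda>((p, r), q). (p, q, r)) ` ?S)"
    by (intro card_image[symmetric] inj_onI) auto
  also have "\<dots> \<le> card (backward w)"
  proof (rule card_mono)
    show "finite (backward w)"
      by (rule finite_subset[of _ "P \<times> P \<times> P"]) (use finite_P in \<open>auto simp: backward_def apart_def\<close>)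
    show "(\<lambda>((p, r), q). (p, q, r)) ` ?S \<subseteq> backward w"
    proof
      fix t assume "t \<in> (\<lambda>((p, r), q). (p, q, r)) ` ?S"
      then obtain p r q where t: "t = (p, q, r)" and *: "(p, r) \<in> clean w" "q \<in> P" "q \<notin> E (p, r)"
        by auto
      show "t \<in> backward w"
        unfolding t using * bar_mem by (intro backward_if[OF w *(1)]) (auto simp: E_def fibre_def)
    qed
  qed
  finally show ?thesis .
qed

definition level :: "nat \<Rightarrow> ('p \<Rightarrow> 'v) set" where
  "level m = {w \<in> words. tame w \<and> card (bad w) = 2 * m}"

lemma finite_words: "finite words"
  using finite_P finite_V by (intro finite_subset[OF _ finite_PiE[of P "\<lambda>_. V"]]) (auto simp: words_def)

lemma finite_level: "finite (level m)"
  using finite_words by (auto simp: level_def)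

lemma finite_switch [simp]: "finite (forward w)" "finite (backward w)"
  using finite_subset[OF forward_subset] finite_P
    finite_subset[of "backward w" "P \<times> P \<times> P"]
  by (auto simp: backward_def apart_def)

text \<open>
  Both sides count the switchings between the two levels: a switching is undone by the rotation in the opposite
  direction.
\<close>

lemma switching_double_count:
  "(\<Sum>w\<in>level (Suc m). card (forward w)) = (\<Sum>w\<in>level m. card (backward w))"
proof -
  let ?f = "\<lambda>(w, p, q, r). (rot w p q r, p, q, r)" and ?g = "\<lambda>(w, p, q, r). (rot w p r q, p, q, r)"
  have "bij_betw ?f (SIGMA w:level (Suc m). forward w) (SIGMA w:level m. backward w)"
  proof (rule bij_betw_byWitness[where f' = ?g])
    have ap: "apart p q r" if "(p, q, r) \<in> forward w" for p q r w
      using that by (simp add: forward_def switchable_def)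
    have ap': "apart p q r" if "(p, q, r) \<in> backward w" for p q r w
      using that by (simp add: backward_def switchable_def)
    show "\<forall>a\<in>SIGMA w:level (Suc m). forward w. ?g (?f a) = a"
      using rot_inverse(1)[OF ap] by auto
    show "\<forall>a\<in>SIGMA w:level m. backward w. ?f (?g a) = a"
      using rot_inverse(2)[OF ap'] by auto
    show "?f ` (SIGMA w:level (Suc m). forward w) \<subseteq> (SIGMA w:level m. backward w)"
    proof
      fix a assume "a \<in> ?f ` (SIGMA w:level (Suc m). forward w)"
      then obtain w p q r where a: "a = (rot w p q r, p, q, r)"
        and w: "w \<in> level (Suc m)" and f: "(p, q, r) \<in> forward w" by auto
      then have sw: "switchable w p q r" and t: "tame w" by (auto simp: forward_def level_def)
      show "a \<in> (SIGMA w:level m. backward w)"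
        unfolding a using switch_bad[OF sw t] switch_tame[OF sw t] rot_words[OF ap[OF f]] w sw t rot_inverse(1)[OF ap[OF f]]
        by (auto simp: level_def backward_def switchable_def)
    qed
    show "?g ` (SIGMA w:level m. backward w) \<subseteq> (SIGMA w:level (Suc m). forward w)"
    proof
      fix a assume "a \<in> ?g ` (SIGMA w:level m. backward w)"
      then obtain w p q r where a: "a = (rot w p r q, p, q, r)"
        and w: "w \<in> level m" and f: "(p, q, r) \<in> backward w" by auto
      then have sw: "switchable (rot w p r q) p q r" and t: "tame (rot w p r q)" by (auto simp: backward_def)
      show "a \<in> (SIGMA w:level (Suc m). forward w)"
        unfolding a using switch_bad[OF sw t] rot_words[OF apart_perm[OF ap'[OF f]]] w sw t rot_inverse(2)[OF ap'[OF f]]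
        by (auto simp: level_def forward_def)
    qed
  qed
  then have "card (SIGMA w:level (Suc m). forward w) = card (SIGMA w:level m. backward w)"
    by (rule bij_betw_same_card)
  then show ?thesis using finite_level by (simp add: card_SigmaI)
qed

text \<open>
  The expected number of defects of a random word, up to lower-order terms: \<open>(d - 1)/2\<close> loops, \<open>x d / 2\<close> edges of
  \<open>X\<close> and \<open>(d - 1)\<^sup>2 / 4\<close> double edges.
\<close>

definition mean :: real where
  "mean = (real d ^ 2 - 1) / 4 + real x * real d / 2"

lemma mean_alt: "4 * mean = real (2 * (d - 1) + 2 * x * d + (d - 1)\<^sup>2)"
  using d_pos by (simp add: mean_def of_nat_diff field_simps power2_eq_square)

lemma mean_nonneg: "0 \<le> mean"
  using mean_alt by (metis of_nat_0_le_iff zero_le_mult_iff zero_less_numeral not_le)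

lemma mean_le: "mean \<le> real D"
proof -
  have "4 * mean \<le> 4 * real D"
    by (simp add: mean_def D_def power2_eq_square field_simps)
  then show ?thesis by simp
qed

text \<open>
  This allows the errors of order \<open>D\<close> in the backward count to be absorbed as relative errors. The mean vanishes
  only for perfect matchings without a forbidden graph, where no defect is possible.
\<close>

lemma D_le_mean: "mean = 0 \<or> real D \<le> 8 * mean"
proof (cases "d = 1")
  case True
  have "mean = real x / 2" "D = 1 + x" unfolding mean_def D_def by (simp_all add: True)
  then show ?thesis by (cases "x = 0") auto
next
  case False
  then have "2 \<le> d" using d_pos by simp
  then have "(2::real) * 2 \<le> real d * real d" by (intro mult_mono) auto
  moreover have "0 \<le> real d * real x" by simp
  moreover have "real D = real d * real d + real d * real x" by (simp add: D_def algebra_simps)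
  moreover have "8 * mean = 2 * (real d * real d) - 2 + 4 * (real d * real x)"
    by (simp add: mean_def power2_eq_square)
  ultimately have "real D \<le> 8 * mean" by linarith
  then show ?thesis by simp
qed

text \<open>
  Together with the next lemma, this says that consecutive levels have nearly the ratio of Poisson weights. The
  constant 100 is generous.
\<close>

lemma level_upper:
  assumes "card P > 0"
  shows "real (card (level (Suc m))) * real (Suc m) * (1 - 100 / real (card P) * (real D + real (Suc m)))
      \<le> mean * real (card (level m))"
proof -
  let ?K = "2 * (2 * Suc m) + 11 * D" and ?M = "real (card P)" and ?a = "real (card (level (Suc m)))"
  have "2 * Suc m * (card P - ?K)\<^sup>2 \<le> card (forward w)" if "w \<in> level (Suc m)" for w
  proof -
    have "w \<in> words" "card (bad w) = 2 * Suc m" using that by (simp_all only: level_def mem_Collect_eq)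
    then show ?thesis using card_forward_ge[of w] by metis
  qed
  then have "card (level (Suc m)) * (2 * Suc m * (card P - ?K)\<^sup>2) \<le> (\<Sum>w\<in>level (Suc m). card (forward w))"
    using sum_bounded_below[of "level (Suc m)" "2 * Suc m * (card P - ?K)\<^sup>2" "\<lambda>w. card (forward w)"]
    by (simp only: of_nat_id)
  also have "\<dots> = (\<Sum>w\<in>level m. card (backward w))" by (rule switching_double_count)
  finally have "2 * (card (level (Suc m)) * (2 * Suc m * (card P - ?K)\<^sup>2)) \<le> (\<Sum>w\<in>level m. 2 * card (backward w))"
    by (simp add: sum_distrib_left[symmetric])
  also have "\<dots> \<le> card (level m) * ((card P)\<^sup>2 * (2 * (d - 1) + 2 * x * d + (d - 1)\<^sup>2))"
    using sum_bounded_above[of "level m" "\<lambda>w. 2 * card (backward w)", OF card_backward_le] by (simp add: level_def)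
  finally have "real (2 * (card (level (Suc m)) * (2 * Suc m * (card P - ?K)\<^sup>2))) \<le>
      real (card (level m) * ((card P)\<^sup>2 * (2 * (d - 1) + 2 * x * d + (d - 1)\<^sup>2)))"
    by (rule of_nat_mono)
  then have "real 2 * (real 2 * (?a * real (Suc m) * real (card P - ?K)^2)) \<le> 4 * (mean * real (card (level m)) * ?M^2)"
    unfolding of_nat_mult mean_alt[symmetric] of_nat_power by (simp only: mult_ac)
  then have 1: "4 * (?a * real (Suc m) * real (card P - ?K)^2) \<le> 4 * (mean * real (card (level m)) * ?M^2)"
    by linarith
  \<comment> \<open>If \<open>?K\<close> exceeds the number of positions, the truncated difference is 0, but then the left-hand side is
    not positive.\<close>
  have "?M^2 * (1 - 100 / ?M * (real D + real (Suc m))) \<le> real (card P - ?K)^2"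
  proof (cases "?K \<le> card P")
    case True
    have "?M^2 * (1 - 100 / ?M * (real D + real (Suc m))) = ?M^2 - 100 * ?M * (real D + real (Suc m))"
      using assms by (simp add: field_simps power2_eq_square)
    also have "\<dots> \<le> ?M^2 - 2 * ?M * real ?K"
      using assms by (simp add: field_simps)
    also have "\<dots> \<le> (?M - real ?K)^2" by (simp add: power2_eq_square algebra_simps)
    also have "?M - real ?K = real (card P - ?K)" using True by (simp only: of_nat_diff)
    finally show ?thesis .
  next
    case False
    then have "?M \<le> real ?K" by linarith
    then have "?M \<le> 100 * (real D + real (Suc m))" by simp
    then have "1 \<le> 100 / ?M * (real D + real (Suc m))" using assms by (simp add: field_simps)
    then have "?M^2 * (1 - 100 / ?M * (real D + real (Suc m))) \<le> 0"
      by (intro mult_nonneg_nonpos) auto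
    then show ?thesis by (meson order_trans zero_le_power2)
  qed
  then have "?a * real (Suc m) * (?M^2 * (1 - 100 / ?M * (real D + real (Suc m)))) \<le> ?a * real (Suc m) * real (card P - ?K)^2"
    by (intro mult_left_mono) auto
  also have "\<dots> \<le> mean * real (card (level m)) * ?M^2" using 1 by linarith
  finally have "?M^2 * (?a * real (Suc m) * (1 - 100 / ?M * (real D + real (Suc m)))) \<le> ?M^2 * (mean * real (card (level m)))"
    by (simp add: mult_ac)
  then show ?thesis using assms by (simp only: mult_le_cancel_left_pos zero_less_power of_nat_0_less_iff)
qed

lemma level_lower:
  assumes "card P > 0"
  shows "mean * real (card (level m)) * (1 - 100 / real (card P) * (real D + real (Suc m)))
      \<le> real (card (level (Suc m))) * real (Suc m)"
proof (cases "mean = 0 \<or> 1 \<le> 100 / real (card P) * (real D + real (Suc m))")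
  case True
  then have "mean * real (card (level m)) * (1 - 100 / real (card P) * (real D + real (Suc m))) \<le> 0"
    using mean_nonneg by (elim disjE, simp) (rule mult_nonneg_nonpos, auto)
  then show ?thesis by (meson order_trans of_nat_0_le_iff mult_nonneg_nonneg)
next
  case False
  let ?K = "2 * (2 * m) + 11 * D" and ?M = "real (card P)"
  have DM: "real D \<le> 8 * mean" using D_le_mean False by blast
  have small: "100 * (real D + real (Suc m)) < ?M" using False assms by (simp add: field_simps)
  then have K: "real ?K \<le> ?M" by simp
  have bw: "2 * mean * ?M\<^sup>2 * (1 - 100 / ?M * (real D + real (Suc m))) \<le> real (card (backward w))" if "w \<in> level m" for w
  proof -
    have w: "w \<in> words" "tame w" "card (bad w) = 2 * m" using that by (auto simp: level_def)
    have "card P * (2 * (d - 1) + 2 * x * d + (d - 1)\<^sup>2) \<le> 2 * card (clean w) + 22 * (2 * m) * D"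
      using card_insertable[OF w(1)] card_clean[OF w(1)] unfolding w(3) by (simp add: algebra_simps)
    then have "real (card P * (2 * (d - 1) + 2 * x * d + (d - 1)\<^sup>2)) \<le> real (2 * card (clean w) + 22 * (2 * m) * D)"
      by (rule of_nat_mono)
    then have "?M * (4 * mean) \<le> 2 * real (card (clean w)) + 44 * real m * real D"
      unfolding of_nat_mult[of "card P"] mean_alt[symmetric] by simp
    also have "44 * real m * real D \<le> 44 * real m * (8 * mean)"
      using DM by (intro mult_left_mono) auto
    finally have c: "2 * mean * (?M - 88 * real m) \<le> real (card (clean w))"
      by (simp add: algebra_simps)
    have "2 * mean * ?M\<^sup>2 * (1 - 100 / ?M * (real D + real (Suc m))) = 2 * mean * (?M\<^sup>2 - 100 * ?M * (real D + real (Suc m)))"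
      using assms by (simp add: field_simps power2_eq_square)
    also have "\<dots> \<le> 2 * mean * ((?M - 88 * real m) * (?M - real ?K))"
    proof (intro mult_left_mono)
      have "(?M - 88 * real m) * (?M - real ?K) = ?M\<^sup>2 - ?M * (88 * real m + real ?K) + 88 * real m * real ?K"
        by (simp add: power2_eq_square algebra_simps)
      moreover have "?M * (88 * real m + real ?K) \<le> ?M * (100 * (real D + real (Suc m)))"
        by (intro mult_left_mono) auto
      ultimately show "?M\<^sup>2 - 100 * ?M * (real D + real (Suc m)) \<le> (?M - 88 * real m) * (?M - real ?K)"
        using mult.assoc[of 100 ?M] mult.left_commute[of 100 ?M] zero_le_mult_iff[of "88 * real m" "real ?K"]
        by linarith
    qed (use mean_nonneg in auto)
    also have "\<dots> \<le> real (card (clean w)) * (?M - real ?K)"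
      using c K by (simp only: mult.assoc[symmetric]) (intro mult_right_mono, auto)
    also have "\<dots> = real (card (clean w) * (card P - ?K))"
      using K by (simp only: of_nat_mult of_nat_diff of_nat_le_iff)
    also have "\<dots> \<le> real (card (backward w))"
      using card_backward_ge[OF w(1,2)] unfolding w(3) by (rule of_nat_mono)
    finally show ?thesis .
  qed
  have "real (card (level m)) * (2 * mean * ?M\<^sup>2 * (1 - 100 / ?M * (real D + real (Suc m)))) \<le> (\<Sum>w\<in>level m. real (card (backward w)))"
    using sum_bounded_below[OF bw] by simp
  also have "\<dots> = real (\<Sum>w\<in>level (Suc m). card (forward w))"
    unfolding switching_double_count by simp
  also have "\<dots> \<le> real (card (level (Suc m)) * (2 * Suc m * (card P)\<^sup>2))"
  proof (rule of_nat_mono)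
    have "card (forward w) \<le> 2 * Suc m * (card P)\<^sup>2" if "w \<in> level (Suc m)" for w
    proof -
      have "card (bad w) = 2 * Suc m" using that by (simp_all only: level_def mem_Collect_eq)
      then show ?thesis using card_forward_le[of w] by metis
    qed
    then show "(\<Sum>w\<in>level (Suc m). card (forward w)) \<le> card (level (Suc m)) * (2 * Suc m * (card P)\<^sup>2)"
      using sum_bounded_above[of "level (Suc m)" "\<lambda>w. card (forward w)" "2 * Suc m * (card P)\<^sup>2"]
      by (simp only: of_nat_id)
  qed
  finally have "(2 * ?M\<^sup>2) * (mean * real (card (level m)) * (1 - 100 / ?M * (real D + real (Suc m))))
      \<le> (2 * ?M\<^sup>2) * (real (card (level (Suc m))) * real (Suc m))"
    by (simp only: of_nat_mult of_nat_power of_nat_numeral mult_ac)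
  then show ?thesis using assms by (subst (asm) mult_le_cancel_left_pos) auto
qed

end

section \<open>Degenerate words are rare\<close>

context pairing_words
begin

text \<open>
  Prescribing the label of one more position \<open>p\<close> costs a factor of about \<open>d / M\<close>: interchanging the labels at
  \<open>p\<close> and at a free position \<open>y\<close> moves the prescribed label to one of its \<open>d\<close> occurrences, and there are
  \<open>M - card Q\<close> choices of \<open>y\<close>.
\<close>

lemma card_agree:
  assumes "finite Q" "Q \<subseteq> P" "\<And>q. q \<in> Q \<Longrightarrow> g q \<in> V"
  shows "card {w \<in> words. \<forall>q\<in>Q. w q = g q} * (\<Prod>i<card Q. card P - i) \<le> d ^ card Q * card words"
  using assms
proof (induction Q)
  case empty
  then show ?case by simp
next
  case (insert p Q)
  define S where "S = {w \<in> words. \<forall>q\<in>Q. w q = g q}"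
  define S' where "S' = {w \<in> words. \<forall>q\<in>insert p Q. w q = g q}"
  have fin: "finite S" "finite S'" using finite_words by (auto simp: S_def S'_def)
  have sw: "w(p := w y, y := w p) \<in> words" if "w \<in> words" "y \<in> P" for w y
  proof -
    define \<pi> where "\<pi> = (\<lambda>s. if s = p then y else if s = y then p else s)"
    have eq: "w(p := w y, y := w p) = w \<circ> \<pi>" by (auto simp: \<pi>_def fun_eq_iff)
    have bij: "bij_betw \<pi> P P"
      by (rule bij_betw_byWitness[where f' = \<pi>]) (use insert that in \<open>auto simp: \<pi>_def\<close>)
    show ?thesis
      unfolding eq by (rule words_comp[OF that(1) bij]) (use insert.prems that in \<open>auto simp: \<pi>_def\<close>)
  qed
  have "card S' * (card P - card Q) = card (S' \<times> (P - Q))"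
    using insert.hyps insert.prems finite_P by (subst card_cartesian_product) (simp add: card_Diff_subset)
  also have "\<dots> \<le> card (SIGMA w:S. fibre w (g p))"
  proof (rule card_inj_on_le[where f = "\<lambda>(w, y). (w(p := w y, y := w p), y)"])
    show "inj_on (\<lambda>(w, y). (w(p := w y, y := w p), y)) (S' \<times> (P - Q))"
    proof (rule inj_on_inverseI)
      show "(\<lambda>(w, y). (w(p := w y, y := w p), y)) ((\<lambda>(w, y). (w(p := w y, y := w p), y)) a) = a" for a
        by (auto simp: fun_eq_iff split: prod.split)
    qed
    show "(\<lambda>(w, y). (w(p := w y, y := w p), y)) ` (S' \<times> (P - Q)) \<subseteq> (SIGMA w:S. fibre w (g p))"
      using sw insert.hyps by (auto simp: S_def S'_def fibre_def)
    show "finite (SIGMA w:S. fibre w (g p))" using fin by auto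
  qed
  also have "\<dots> \<le> card S * d"
    using fin card_fibre insert.prems by (intro card_Sigma_le) (auto simp: S_def)
  finally have 1: "card S' * (card P - card Q) \<le> card S * d" .
  have "card S' * (\<Prod>i<card (insert p Q). card P - i) = (card S' * (card P - card Q)) * (\<Prod>i<card Q. card P - i)"
    using insert.hyps by (simp add: mult_ac)
  also have "\<dots> \<le> (card S * d) * (\<Prod>i<card Q. card P - i)" using 1 by (rule mult_right_mono) simp
  also have "\<dots> = d * (card S * (\<Prod>i<card Q. card P - i))" by simp
  also have "\<dots> \<le> d * (d ^ card Q * card words)"
    using insert by (intro mult_left_mono) (auto simp: S_def)
  finally show ?case using insert.hyps by (simp add: S'_def mult_ac)
qed

text \<open>
  At most six positions are ever prescribed, so the factors \<open>M - i\<close> may be replaced by \<open>M / 2\<close> as soon as \<open>M \<ge> 12\<close>.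
\<close>

lemma card_event:
  assumes "12 \<le> card P" "Q \<subseteq> P" "\<And>q. q \<in> Q \<Longrightarrow> g q \<in> V" "card Q = s" "s \<le> 6"
    and "E \<subseteq> {w \<in> words. \<forall>q\<in>Q. w q = g q}"
  shows "real (card E) \<le> (2 * real d / real (card P)) ^ s * real (card words)"
proof -
  let ?S = "{w \<in> words. \<forall>q\<in>Q. w q = g q}"
  have finQ: "finite Q" using assms(2) finite_P by (rule finite_subset)
  have "(real (card P) / 2) ^ s = (\<Prod>i<s. real (card P) / 2)" by simp
  also have "\<dots> \<le> (\<Prod>i<s. real (card P - i))"
    using assms(1,5) by (intro prod_mono) (auto simp: of_nat_diff)
  finally have "real (card ?S) * (real (card P) / 2) ^ s \<le> real (card ?S) * (\<Prod>i<s. real (card P - i))"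
    by (rule mult_left_mono) simp
  also have "\<dots> = real (card ?S * (\<Prod>i<card Q. card P - i))" using assms(4) by simp
  also have "\<dots> \<le> real (d ^ card Q * card words)"
    using card_agree[OF finQ assms(2,3)] by (rule of_nat_mono)
  finally have "real (card ?S) * (real (card P) / 2) ^ s \<le> real d ^ s * real (card words)"
    using assms(4) by simp
  then have "real (card ?S) \<le> (2 * real d / real (card P)) ^ s * real (card words)"
    using assms(1) by (simp add: field_simps power_mult_distrib power_divide)
  moreover have "card E \<le> card ?S"
    using finite_words by (intro card_mono assms(6)) auto
  ultimately show ?thesis by linarith
qed

lemma card_loop_event:
  assumes "12 \<le> card P" "p \<in> P"
  shows "real (card {w \<in> words. forb (w p) (w (bar p))})
    \<le> real (card V * (1 + x)) * ((2 * real d / real (card P))\<^sup>2 * real (card words))"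
proof -
  let ?I = "SIGMA v:V. insert v {u \<in> V. X v u}"
  have cI: "card ?I = card V * (1 + x)"
    using finite_V X_regular X_irrefl by (simp add: card_SigmaI)
  have "{w \<in> words. forb (w p) (w (bar p))} \<subseteq> (\<Union>i\<in>?I. {w \<in> words. w p = fst i \<and> w (bar p) = snd i})"
    using word_mem bar_mem assms(2) by (auto simp: forb_def)
  then have "card {w \<in> words. forb (w p) (w (bar p))} \<le> card (\<Union>i\<in>?I. {w \<in> words. w p = fst i \<and> w (bar p) = snd i})"
    using finite_words finite_V by (intro card_mono) auto
  then have "real (card {w \<in> words. forb (w p) (w (bar p))}) \<le> real (card (\<Union>i\<in>?I. {w \<in> words. w p = fst i \<and> w (bar p) = snd i}))"
    by (rule of_nat_mono)
  also have "\<dots> \<le> real (card V * (1 + x)) * ((2 * real d / real (card P))\<^sup>2 * real (card words))"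
  proof (rule card_UN_bound)
    fix i assume i: "i \<in> ?I"
    show "real (card {w \<in> words. w p = fst i \<and> w (bar p) = snd i}) \<le> (2 * real d / real (card P))\<^sup>2 * real (card words)"
      by (rule card_event[where Q = "{p, bar p}" and g = "\<lambda>q. if q = p then fst i else snd i"])
         (use assms i bar_mem bar_neq[OF assms(2)] not_sym[OF bar_neq[OF assms(2)]] in auto)
  qed (use cI finite_V in auto)
  finally show ?thesis .
qed

lemma card_double_event:
  assumes "12 \<le> card P" "p \<in> P" "q \<in> P" "q \<noteq> p" "q \<noteq> bar p" "I \<subseteq> V \<times> V" "card I \<le> c"
  shows "real (card {w \<in> words. par w p q \<and> (w p, w (bar p)) \<in> I})
    \<le> real c * ((2 * real d / real (card P)) ^ 4 * real (card words))"
proof -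
  have fI: "finite I" using finite_subset[OF assms(6)] finite_V by simp
  let ?E = "\<lambda>i. {w \<in> words. w p = fst i \<and> w q = fst i \<and> w (bar p) = snd i \<and> w (bar q) = snd i}"
  have "{w \<in> words. par w p q \<and> (w p, w (bar p)) \<in> I} \<subseteq> (\<Union>i\<in>I. ?E i)"
  proof
    fix w assume "w \<in> {w \<in> words. par w p q \<and> (w p, w (bar p)) \<in> I}"
    then show "w \<in> (\<Union>i\<in>I. ?E i)"
      by (intro UN_I[of "(w p, w (bar p))"]) (auto simp: par_def)
  qed
  then have "card {w \<in> words. par w p q \<and> (w p, w (bar p)) \<in> I} \<le> card (\<Union>i\<in>I. ?E i)"
    using finite_words fI by (intro card_mono) auto
  then have "real (card {w \<in> words. par w p q \<and> (w p, w (bar p)) \<in> I}) \<le> real (card (\<Union>i\<in>I. ?E i))"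
    by (rule of_nat_mono)
  also have "\<dots> \<le> real c * ((2 * real d / real (card P)) ^ 4 * real (card words))"
  proof (rule card_UN_bound[OF fI])
    fix i assume i: "i \<in> I"
    have ne: "bar p \<noteq> bar q" "bar q \<noteq> p" "bar p \<noteq> p" "bar q \<noteq> q"
      using assms bar_bar bar_neq by metis+
    show "real (card (?E i)) \<le> (2 * real d / real (card P)) ^ 4 * real (card words)"
      by (rule card_event[where Q = "{p, bar p, q, bar q}" and g = "\<lambda>s. if s = p \<or> s = q then fst i else snd i"])
         (use assms i bar_mem ne in \<open>auto simp: card_insert_if\<close>)
  qed (use assms in auto)
  finally show ?thesis .
qed

lemma card_triple_event:
  assumes "12 \<le> card P" "p \<in> P" "q \<in> P" "r \<in> P" "distinct [p, bar p, q, bar q, r, bar r]"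
  shows "real (card {w \<in> words. par w p q \<and> par w p r})
    \<le> real ((card V)\<^sup>2) * ((2 * real d / real (card P)) ^ 6 * real (card words))"
proof -
  let ?E = "\<lambda>i. {w \<in> words. w p = fst i \<and> w q = fst i \<and> w r = fst i \<and>
    w (bar p) = snd i \<and> w (bar q) = snd i \<and> w (bar r) = snd i}"
  have "{w \<in> words. par w p q \<and> par w p r} \<subseteq> (\<Union>i\<in>V \<times> V. ?E i)"
  proof
    fix w assume w: "w \<in> {w \<in> words. par w p q \<and> par w p r}"
    then have "w p \<in> V" "w (bar p) \<in> V" using word_mem bar_mem assms(2) by auto
    then show "w \<in> (\<Union>i\<in>V \<times> V. ?E i)"
      using w by (intro UN_I[of "(w p, w (bar p))"]) (auto simp: par_def)
  qed
  then have "card {w \<in> words. par w p q \<and> par w p r} \<le> card (\<Union>i\<in>V \<times> V. ?E i)"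
    using finite_words finite_V by (intro card_mono) auto
  then have "real (card {w \<in> words. par w p q \<and> par w p r}) \<le> real (card (\<Union>i\<in>V \<times> V. ?E i))"
    by (rule of_nat_mono)
  also have "\<dots> \<le> real ((card V)\<^sup>2) * ((2 * real d / real (card P)) ^ 6 * real (card words))"
  proof (rule card_UN_bound)
    fix i assume i: "i \<in> V \<times> V"
    have ne: "bar p \<noteq> p" "bar p \<noteq> q" "bar p \<noteq> r" "bar q \<noteq> p" "bar q \<noteq> q" "bar q \<noteq> r" "bar r \<noteq> p" "bar r \<noteq> q" "bar r \<noteq> r"
      using assms(5) by auto
    have six: "card {p, bar p, q, bar q, r, bar r} = 6" using distinct_card[OF assms(5)] by simp
    show "real (card (?E i)) \<le> (2 * real d / real (card P)) ^ 6 * real (card words)"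
    proof (rule card_event[where Q = "{p, bar p, q, bar q, r, bar r}" and g = "\<lambda>s. if s = p \<or> s = q \<or> s = r then fst i else snd i"])
      show "{p, bar p, q, bar q, r, bar r} \<subseteq> P" using assms(2-4) bar_mem by simp
      show "?E i \<subseteq> {w \<in> words. \<forall>s\<in>{p, bar p, q, bar q, r, bar r}. w s = (if s = p \<or> s = q \<or> s = r then fst i else snd i)}"
        by (rule Collect_mono) (simp add: ne)
      show "(if s = p \<or> s = q \<or> s = r then fst i else snd i) \<in> V" for s
        using i by (simp add: mem_Times_iff)
    qed (use assms(1) six in simp_all)
  qed (use finite_V in \<open>auto simp: card_cartesian_product power2_eq_square\<close>)
  finally show ?thesis .
qed

text \<open>
  The bad positions of loops and edges of \<open>X\<close> are paired by \<open>bar\<close>, those of double edges by parallelism.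
  Evenness ensures that every tame word belongs to a level.
\<close>

lemma even_card_bad:
  assumes "tame w"
  shows "even (card (bad w))"
proof -
  define H where "H = {p \<in> P. forb (w p) (w (bar p))}"
  define T where "T = {p \<in> P. \<not> forb (w p) (w (bar p)) \<and> w p < w (bar p) \<and> (\<exists>q\<in>P. q \<noteq> p \<and> par w p q)}"
  have fin: "finite H" "finite T" using finite_P by (auto simp: H_def T_def)
  have "even (card H)"
    by (rule even_card_involution[where f = bar])
       (use fin bar_mem bar_bar bar_neq forb_sym in \<open>auto simp: H_def\<close>)
  moreover have "even (card T)"
  proof (rule even_card_involution[where f = "\<lambda>p. SOME q. q \<in> P \<and> q \<noteq> p \<and> par w p q"])
    let ?f = "\<lambda>p. SOME q. q \<in> P \<and> q \<noteq> p \<and> par w p q"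
    have f: "?f p \<in> P \<and> ?f p \<noteq> p \<and> par w p (?f p)" if "p \<in> T" for p
      using that someI_ex[of "\<lambda>q. q \<in> P \<and> q \<noteq> p \<and> par w p q"] by (auto simp: T_def)
    have T_par: "q \<in> T" if "p \<in> T" "q \<in> P" "q \<noteq> p" "par w p q" for p q
    proof -
      have "w q = w p" "w (bar q) = w (bar p)" using that(4) by (simp_all add: par_def)
      then show ?thesis using that(1-3) by (auto simp: T_def par_def)
    qed
    show fT: "?f p \<in> T" if "p \<in> T" for p using T_par[OF that] f[OF that] by blast
    show "?f p \<noteq> p" if "p \<in> T" for p using f that by blast
    have T_uniq: "r = p" if "p \<in> T" "q \<in> P" "r \<in> P" "q \<noteq> p" "r \<noteq> q" "par w p q" "par w q r" for p q r
    proof -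
      have "par w p r" "p \<in> P" using that by (simp_all add: par_def T_def)
      then show ?thesis using assms that unfolding tame_def by blast
    qed
    show "?f (?f p) = p" if "p \<in> T" for p
      using T_uniq[OF that] f[OF that] f[OF fT[OF that]] by blast
  qed (rule fin)
  moreover have "bad w = H \<union> T" "H \<inter> T = {}" by (auto simp: bad_def H_def T_def)
  ultimately show ?thesis using fin by (simp add: card_Un_disjoint)
qed

text \<open>
  The expected number of triple edges is at most of order \<open>d\<^sup>4 / M\<close>, and the expected number of pairs of
  parallel loops or parallel edges of \<open>X\<close> is at most of order \<open>d\<^sup>3 (1 + x) / M\<close>. Both are \<open>O (D\<^sup>2 / M)\<close>.
\<close>

lemma card_untame:
  assumes "12 \<le> card P"
  shows "real (card {w \<in> words. \<not> tame w}) \<le> 96 * (real D)\<^sup>2 / real (card P) * real (card words)"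
proof -
  let ?W = "real (card words)" and ?M = "real (card P)" and ?n = "real (card V)"
  define I3 where "I3 = {(p, q, r). p \<in> P \<and> q \<in> P \<and> r \<in> P \<and> distinct [p, bar p, q, bar q, r, bar r]}"
  define I2 where "I2 = {(p, q). p \<in> P \<and> q \<in> P \<and> q \<noteq> p \<and> q \<noteq> bar p}"
  define J where "J = (SIGMA v:V. insert v {u \<in> V. X v u})"
  define U3 where "U3 = (\<Union>(p, q, r)\<in>I3. {w \<in> words. par w p q \<and> par w p r})"
  define U2 where "U2 = (\<Union>(p, q)\<in>I2. {w \<in> words. par w p q \<and> (w p, w (bar p)) \<in> J})"
  have I3: "I3 \<subseteq> P \<times> P \<times> P" and I2: "I2 \<subseteq> P \<times> P" by (auto simp: I3_def I2_def)
  have fin: "finite I3" "finite I2" using finite_P finite_subset[OF I3] finite_subset[OF I2] by auto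
  have cI3: "card I3 \<le> card P ^ 3"
    using card_mono[OF _ I3] finite_P by (simp add: card_cartesian_product power3_eq_cube)
  have cI2: "card I2 \<le> (card P)\<^sup>2"
    using card_mono[OF _ I2] finite_P by (simp add: card_cartesian_product power2_eq_square)
  have cJ: "card J = card V * (1 + x)" "J \<subseteq> V \<times> V"
    using finite_V X_regular X_irrefl by (auto simp: J_def card_SigmaI)
  have sub: "{w \<in> words. \<not> tame w} \<subseteq> U3 \<union> U2"
  proof
    fix w assume "w \<in> {w \<in> words. \<not> tame w}"
    then have w: "w \<in> words" "\<not> tame w" by auto
    have U2I: "w \<in> U2" if "p \<in> P" "q \<in> P" "q \<noteq> p" "q \<noteq> bar p" "par w p q" "forb (w p) (w (bar p))" for p q
    proof -
      have "(w p, w (bar p)) \<in> J" using that w word_mem bar_mem by (auto simp: J_def forb_def)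
      then show ?thesis using that w by (auto simp: U2_def I2_def)
    qed
    show "w \<in> U3 \<union> U2"
    proof (cases "\<exists>p q. p \<in> P \<and> q \<in> P \<and> q \<noteq> p \<and> par w p q \<and> forb (w p) (w (bar p)) \<and> q \<noteq> bar p")
      case True
      then show ?thesis using U2I by blast
    next
      case False
      then have no: "q = bar p" if "p \<in> P" "q \<in> P" "q \<noteq> p" "par w p q" "forb (w p) (w (bar p))" for p q
        using that by blast
      have "\<not> (par w p q \<and> X (w p) (w (bar p)))" if "p \<in> P" "q \<in> P" "q \<noteq> p" for p q
      proof
        assume *: "par w p q \<and> X (w p) (w (bar p))"
        then have "q = bar p" using no that by (auto simp: forb_def)
        then have "w p = w (bar p)" using * unfolding par_def by metis
        then show False using * X_irrefl by metis
      qed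
      then obtain p q r where pqr: "p \<in> P" "q \<in> P" "r \<in> P" "par w p q" "par w p r" "p \<noteq> q" "p \<noteq> r" "q \<noteq> r"
        using w(2) unfolding tame_def by metis
      have nf: "\<not> forb (w p) (w (bar p))"
        using no[of p q] no[of p r] pqr by metis
      then have lab: "w p \<noteq> w (bar p)" by (simp add: forb_def)
      have eqs: "w q = w p" "w r = w p" "w (bar q) = w (bar p)" "w (bar r) = w (bar p)"
        using pqr by (auto simp: par_def)
      have "distinct [p, bar p, q, bar q, r, bar r]"
        using pqr lab eqs bar_eq_iff[of p q] bar_eq_iff[of p r] bar_eq_iff[of q r]
        unfolding distinct.simps list.set by (metis empty_iff insert_iff)
      then have "(p, q, r) \<in> I3" using pqr by (simp add: I3_def)
      then show ?thesis using w pqr by (auto simp: U3_def)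
    qed
  qed
  have fU: "finite U3" "finite U2"
    using finite_words by (auto simp: U3_def U2_def intro: finite_subset[OF _ finite_words])
  have M0: "?M > 0" using assms by simp
  have Mn: "?M = real d * ?n" using card_P by simp
  have n0: "?n > 0" "real d > 0" using M0 Mn d_pos by (auto simp: zero_less_mult_iff)
  have "real (card U3) \<le> ?M ^ 3 * (real ((card V)\<^sup>2) * ((2 * real d / ?M) ^ 6 * ?W))"
    unfolding U3_def
  proof (rule card_UN_bound[OF fin(1)])
    show "real (card (case i of (p, q, r) \<Rightarrow> {w \<in> words. par w p q \<and> par w p r}))
        \<le> real ((card V)\<^sup>2) * ((2 * real d / ?M) ^ 6 * ?W)" if "i \<in> I3" for i
      using that card_triple_event[OF assms] by (auto simp: I3_def)
    show "real (card I3) \<le> ?M ^ 3" using cI3 of_nat_mono[of "card I3" "card P ^ 3"] by simp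
  qed auto
  also have "\<dots> = 64 * (real d ^ 4) / ?M * ?W"
    unfolding Mn using n0 by (simp add: field_simps eval_nat_numeral)
  finally have 3: "real (card U3) \<le> 64 * (real d ^ 4) / ?M * ?W" .
  have "real (card U2) \<le> ?M ^ 2 * (real (card V * (1 + x)) * ((2 * real d / ?M) ^ 4 * ?W))"
    unfolding U2_def
  proof (rule card_UN_bound[OF fin(2)])
    show "real (card (case i of (p, q) \<Rightarrow> {w \<in> words. par w p q \<and> (w p, w (bar p)) \<in> J}))
        \<le> real (card V * (1 + x)) * ((2 * real d / ?M) ^ 4 * ?W)" if "i \<in> I2" for i
      using that card_double_event[where c = "card V * (1 + x)", OF assms _ _ _ _ cJ(2)] cJ(1) by (auto simp: I2_def)
    show "real (card I2) \<le> ?M ^ 2" using cI2 of_nat_mono[of "card I2" "(card P)\<^sup>2"] by simp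
  qed auto
  also have "\<dots> = 16 * (real d ^ 3 * (1 + real x)) / ?M * ?W"
    unfolding Mn using n0 by (simp add: field_simps eval_nat_numeral)
  finally have 2: "real (card U2) \<le> 16 * (real d ^ 3 * (1 + real x)) / ?M * ?W" .
  have "64 * (real d ^ 4) + 16 * (real d ^ 3 * (1 + real x)) \<le> 96 * (real D)\<^sup>2"
  proof -
    have "real d ^ 3 * 1 \<le> real d ^ 3 * real d" using d_pos by (intro mult_left_mono) auto
    then have "real d ^ 3 \<le> real d ^ 4" by (simp add: eval_nat_numeral)
    moreover have "(real D)\<^sup>2 = real d ^ 4 + 2 * (real d ^ 3 * real x) + (real d * real x)\<^sup>2"
      by (simp add: D_def eval_nat_numeral algebra_simps)
    moreover have "0 \<le> (real d * real x)\<^sup>2" "0 \<le> real d ^ 3 * real x" "0 \<le> real d ^ 4" by simp_all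
    moreover have "real d ^ 3 * (1 + real x) = real d ^ 3 + real d ^ 3 * real x" by (simp add: algebra_simps)
    ultimately show ?thesis by linarith
  qed
  then have "(64 * (real d ^ 4) + 16 * (real d ^ 3 * (1 + real x))) / ?M * ?W \<le> 96 * (real D)\<^sup>2 / ?M * ?W"
    using M0 by (intro mult_right_mono divide_right_mono) auto
  moreover have "real (card {w \<in> words. \<not> tame w}) \<le> real (card U3 + card U2)"
    using card_mono[OF _ sub] fU card_Un_le[of U3 U2] by (intro of_nat_mono) auto
  ultimately show ?thesis using 2 3 by (simp add: add_divide_distrib distrib_right)
qed

lemma sum_card_bad:
  assumes "12 \<le> card P"
  shows "(\<Sum>w\<in>words. real (card (bad w))) \<le> 24 * real D * real (card words)"
proof -
  let ?W = "real (card words)" and ?M = "real (card P)" and ?n = "real (card V)"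
  have M0: "?M > 0" using assms by simp
  have Mn: "?M = real d * ?n" using card_P by simp
  have n0: "?n > 0" "real d > 0" using M0 Mn d_pos by (auto simp: zero_less_mult_iff)
  have one: "real (card {w \<in> words. p \<in> bad w}) \<le> real (card V * (1 + x)) * ((2 * real d / ?M)\<^sup>2 * ?W)
      + ?M * (real ((card V)\<^sup>2) * ((2 * real d / ?M) ^ 4 * ?W))" if p: "p \<in> P" for p
  proof -
    define U where "U = (\<Union>q\<in>P - {p, bar p}. {w \<in> words. par w p q \<and> (w p, w (bar p)) \<in> V \<times> V})"
    have "{w \<in> words. p \<in> bad w} \<subseteq> {w \<in> words. forb (w p) (w (bar p))} \<union> U"
    proof
      fix w assume "w \<in> {w \<in> words. p \<in> bad w}"
      then have w: "w \<in> words" "p \<in> bad w" by auto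
      show "w \<in> {w \<in> words. forb (w p) (w (bar p))} \<union> U"
      proof (cases "forb (w p) (w (bar p))")
        case False
        then obtain q where q: "w p < w (bar p)" "q \<in> P" "q \<noteq> p" "par w p q" using w by (auto simp: bad_def)
        then have "q \<noteq> bar p" unfolding par_def by (metis less_irrefl)
        then show ?thesis using q w p word_mem bar_mem by (auto simp: U_def)
      qed (use w in simp)
    qed
    moreover have fU: "finite U" using finite_words by (auto simp: U_def intro: finite_subset[OF _ finite_words])
    ultimately have "card {w \<in> words. p \<in> bad w} \<le> card ({w \<in> words. forb (w p) (w (bar p))} \<union> U)"
      using finite_words by (intro card_mono) auto
    also have "\<dots> \<le> card {w \<in> words. forb (w p) (w (bar p))} + card U" by (rule card_Un_le)
    finally have "real (card {w \<in> words. p \<in> bad w}) \<le> real (card {w \<in> words. forb (w p) (w (bar p))} + card U)"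
      by (rule of_nat_mono)
    moreover have "real (card U) \<le> ?M * (real ((card V)\<^sup>2) * ((2 * real d / ?M) ^ 4 * ?W))"
      unfolding U_def
    proof (rule card_UN_bound)
      show "real (card {w \<in> words. par w p q \<and> (w p, w (bar p)) \<in> V \<times> V})
          \<le> real ((card V)\<^sup>2) * ((2 * real d / ?M) ^ 4 * ?W)" if "q \<in> P - {p, bar p}" for q
        using that by (intro card_double_event[OF assms p]) (simp_all add: card_cartesian_product power2_eq_square)
      show "real (card (P - {p, bar p})) \<le> ?M" using card_mono[OF finite_P, of "P - {p, bar p}"] by simp
    qed (use finite_P in auto)
    ultimately show ?thesis using card_loop_event[OF assms p] by simp
  qed
  have "(\<Sum>w\<in>words. real (card (bad w))) = (\<Sum>w\<in>words. \<Sum>p\<in>P. if p \<in> bad w then 1 else 0)"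
  proof (intro sum.cong refl)
    fix w
    have "{p \<in> P. p \<in> bad w} = bad w" by (auto simp: bad_def)
    then show "real (card (bad w)) = (\<Sum>p\<in>P. if p \<in> bad w then 1 else 0)"
      using finite_P by (simp add: sum.If_cases Int_def)
  qed
  also have "\<dots> = (\<Sum>p\<in>P. \<Sum>w\<in>words. if p \<in> bad w then 1 else 0)" by (rule sum.swap)
  also have "\<dots> = (\<Sum>p\<in>P. real (card {w \<in> words. p \<in> bad w}))"
    using finite_words by (simp add: sum.If_cases Int_def)
  also have "\<dots> \<le> ?M * (real (card V * (1 + x)) * ((2 * real d / ?M)\<^sup>2 * ?W)
      + ?M * (real ((card V)\<^sup>2) * ((2 * real d / ?M) ^ 4 * ?W)))"
    using sum_bounded_above[OF one] by simp
  also have "\<dots> = (4 * (real d * (1 + real x)) + 16 * (real d)\<^sup>2) * ?W"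
    unfolding Mn using n0 by (simp add: field_simps eval_nat_numeral)
  also have "\<dots> \<le> (24 * real D) * ?W"
  proof (rule mult_right_mono)
    have "real d * 1 \<le> real d * real d" using d_pos by (intro mult_left_mono) auto
    moreover have "0 \<le> real d * real x" by simp
    moreover have "real D = real d * real d + real d * real x" by (simp add: D_def algebra_simps)
    moreover have "4 * (real d * (1 + real x)) + 16 * (real d)\<^sup>2 = 4 * (real d * 1) + 4 * (real d * real x) + 16 * (real d * real d)"
      by (simp add: power2_eq_square algebra_simps)
    ultimately show "4 * (real d * (1 + real x)) + 16 * (real d)\<^sup>2 \<le> 24 * real D"
      by linarith
  qed simp
  finally show ?thesis by simp
qed

text \<open>
  Markov's inequality bounds the words with more than \<open>N\<close> defects. This is sharp enough because \<open>N\<close> may be taken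
  of order \<open>M\<close>, and \<open>D / M \<le> D\<^sup>2 / M\<close>.
\<close>

lemma words_covered:
  assumes "12 \<le> card P"
  shows "real (card words) - (\<Sum>m\<le>N. real (card (level m)))
    \<le> (96 * (real D)\<^sup>2 / real (card P) + 12 * real D / real (Suc N)) * real (card words)"
proof -
  define B where "B = {w \<in> words. 2 * Suc N \<le> card (bad w)}"
  have "words \<subseteq> {w \<in> words. \<not> tame w} \<union> B \<union> (\<Union>m\<le>N. level m)"
  proof
    fix w assume w: "w \<in> words"
    show "w \<in> {w \<in> words. \<not> tame w} \<union> B \<union> (\<Union>m\<le>N. level m)"
    proof (cases "tame w")
      case True
      then obtain m where m: "card (bad w) = 2 * m" using even_card_bad by (metis evenE)
      then show ?thesis using w True by (cases "m \<le> N") (auto simp: B_def level_def)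
    qed (use w in auto)
  qed
  then have "card words \<le> card ({w \<in> words. \<not> tame w} \<union> B \<union> (\<Union>m\<le>N. level m))"
    using finite_words finite_level by (intro card_mono) (auto simp: B_def)
  also have "\<dots> \<le> card {w \<in> words. \<not> tame w} + card B + card (\<Union>m\<le>N. level m)"
    by (meson card_Un_le add_right_mono le_trans)
  also have "card (\<Union>m\<le>N. level m) \<le> (\<Sum>m\<le>N. card (level m))" by (rule card_UN_le) simp
  finally have "real (card words) \<le> real (card {w \<in> words. \<not> tame w} + card B + (\<Sum>m\<le>N. card (level m)))"
    by (intro of_nat_mono) simp
  moreover have "real (card B) * real (2 * Suc N) \<le> 24 * real D * real (card words)"
  proof -
    have "real (card B) * real (2 * Suc N) \<le> (\<Sum>w\<in>B. real (card (bad w)))"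
      by (rule sum_bounded_below) (auto simp: B_def)
    also have "\<dots> \<le> (\<Sum>w\<in>words. real (card (bad w)))"
      using finite_words by (intro sum_mono2) (auto simp: B_def)
    finally show ?thesis using sum_card_bad[OF assms] by simp
  qed
  then have "real (card B) \<le> 12 * real D / real (Suc N) * real (card words)"
    by (simp add: field_simps)
  ultimately show ?thesis using card_untame[OF assms] by (simp add: distrib_right)
qed

lemma levels_disjoint: "(\<Sum>m\<le>N. card (level m)) \<le> card words"
proof -
  have "(\<Sum>m\<le>N. card (level m)) = card (\<Union>m\<le>N. level m)"
    using finite_level by (intro card_UN_disjoint[symmetric]) (auto simp: level_def)
  also have "\<dots> \<le> card words" using finite_words by (intro card_mono) (auto simp: level_def)
  finally show ?thesis .
qed

end

section \<open>Nearly Poisson sequences\<close>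

lemma poisson_partial_sum:
  fixes A :: real assumes "0 \<le> A"
  shows "(\<Sum>m\<le>N. A ^ m / fact m) \<le> exp A"
proof -
  have "(\<lambda>m. A ^ m / fact m) sums exp A"
    using exp_converges[of A] by (simp add: field_simps scaleR_conv_of_real)
  then show ?thesis using sum_le_suminf[of "\<lambda>m. A ^ m / fact m" "{..N}"] assms
    by (auto simp: sums_iff)
qed

lemma poisson_step: "real (Suc m) * (A ^ Suc m / fact (Suc m)) = A * (A ^ m / fact m)"
  by (simp del: of_nat_Suc)

lemma poisson_first_moment:
  fixes A :: real assumes "0 \<le> A"
  shows "(\<Sum>m\<le>N. real m * (A ^ m / fact m)) \<le> A * exp A"
proof (cases N)
  case 0
  then show ?thesis using assms by simp
next
  case (Suc K)
  have "(\<Sum>m\<le>N. real m * (A ^ m / fact m)) = (\<Sum>m\<le>K. real (Suc m) * (A ^ Suc m / fact (Suc m)))"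
    unfolding Suc sum.atMost_Suc_shift by simp
  also have "\<dots> = (\<Sum>m\<le>K. A * (A ^ m / fact m))"
    by (intro sum.cong refl poisson_step)
  also have "\<dots> = A * (\<Sum>m\<le>K. A ^ m / fact m)" by (simp add: sum_distrib_left)
  also have "\<dots> \<le> A * exp A" using poisson_partial_sum assms by (intro mult_left_mono) auto
  finally show ?thesis .
qed

lemma poisson_second_moment:
  fixes A :: real assumes "0 \<le> A"
  shows "(\<Sum>m\<le>N. (real m)\<^sup>2 * (A ^ m / fact m)) \<le> (A\<^sup>2 + A) * exp A"
proof (cases N)
  case 0
  then show ?thesis using assms by simp
next
  case (Suc K)
  have "(\<Sum>m\<le>N. (real m)\<^sup>2 * (A ^ m / fact m)) = (\<Sum>m\<le>K. (real (Suc m))\<^sup>2 * (A ^ Suc m / fact (Suc m)))"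
    unfolding Suc sum.atMost_Suc_shift by simp
  also have "\<dots> = (\<Sum>m\<le>K. A * (real m * (A ^ m / fact m)) + A * (A ^ m / fact m))"
  proof (intro sum.cong refl)
    fix m
    have "(real (Suc m))\<^sup>2 * (A ^ Suc m / fact (Suc m)) = real (Suc m) * (real (Suc m) * (A ^ Suc m / fact (Suc m)))"
      by (simp only: power2_eq_square mult.assoc)
    also have "\<dots> = real (Suc m) * (A * (A ^ m / fact m))" by (simp only: poisson_step)
    also have "real (Suc m) * (A * t) = A * (real m * t) + A * t" for t :: real by (simp add: algebra_simps)
    finally show "(real (Suc m))\<^sup>2 * (A ^ Suc m / fact (Suc m)) = A * (real m * (A ^ m / fact m)) + A * (A ^ m / fact m)" .
  qed
  also have "\<dots> = A * (\<Sum>m\<le>K. real m * (A ^ m / fact m)) + A * (\<Sum>m\<le>K. A ^ m / fact m)"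
    by (simp add: sum_distrib_left sum.distrib)
  also have "\<dots> \<le> A * (A * exp A) + A * exp A"
    using poisson_partial_sum poisson_first_moment assms by (intro add_mono mult_left_mono) auto
  finally show ?thesis by (simp add: power2_eq_square algebra_simps)
qed

text \<open>
  Markov's inequality for the Poisson distribution.
\<close>

lemma poisson_tail:
  fixes A :: real assumes "0 \<le> A"
  shows "exp A \<le> (\<Sum>m\<le>N. A ^ m / fact m) + A * exp A / real (Suc N)"
proof (rule LIMSEQ_le_const2)
  have "(\<lambda>m. A ^ m / fact m) sums exp A"
    using exp_converges[of A] by (simp add: field_simps scaleR_conv_of_real)
  then show "(\<lambda>K. \<Sum>m\<le>K. A ^ m / fact m) \<longlonglongrightarrow> exp A" by (simp add: sums_def_le)
  show "\<exists>K0. \<forall>K\<ge>K0. (\<Sum>m\<le>K. A ^ m / fact m) \<le> (\<Sum>m\<le>N. A ^ m / fact m) + A * exp A / real (Suc N)"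
  proof (intro exI[of _ N] allI impI)
    fix K assume K: "K \<ge> N"
    have "(\<Sum>m\<in>{..K} - {..N}. A ^ m / fact m) * real (Suc N) = (\<Sum>m\<in>{..K} - {..N}. real (Suc N) * (A ^ m / fact m))"
      by (simp add: sum_distrib_left sum_distrib_right mult.commute)
    also have "\<dots> \<le> (\<Sum>m\<in>{..K} - {..N}. real m * (A ^ m / fact m))"
      using assms by (intro sum_mono mult_right_mono) auto
    also have "\<dots> \<le> (\<Sum>m\<le>K. real m * (A ^ m / fact m))"
      using assms by (intro sum_mono2) auto
    also have "\<dots> \<le> A * exp A" by (rule poisson_first_moment[OF assms])
    finally have "(\<Sum>m\<in>{..K} - {..N}. A ^ m / fact m) \<le> A * exp A / real (Suc N)"
      by (simp add: field_simps del: of_nat_Suc)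
    moreover have "(\<Sum>m\<le>K. A ^ m / fact m) = (\<Sum>m\<in>{..K} - {..N}. A ^ m / fact m) + (\<Sum>m\<le>N. A ^ m / fact m)"
      using K by (intro sum.subset_diff) auto
    ultimately show "(\<Sum>m\<le>K. A ^ m / fact m) \<le> (\<Sum>m\<le>N. A ^ m / fact m) + A * exp A / real (Suc N)"
      by linarith
  qed
qed

text \<open>
  Sequences whose consecutive ratios are those of Poisson weights up to a relative error that is small for
  \<open>m\<close> much smaller than \<open>M\<close>, but not for larger \<open>m\<close>.
\<close>

locale near_poisson =
  fixes a :: "nat \<Rightarrow> real" and A D M :: real
  assumes a_nonneg: "0 \<le> a m" and A_nonneg: "0 \<le> A" and A_le: "A \<le> D" and D_ge: "1 \<le> D"
    and M_ge: "100000 * D\<^sup>2 \<le> M"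
    and upper: "a (Suc m) * real (Suc m) * (1 - 100 / M * (D + real (Suc m))) \<le> A * a m"
    and lower: "A * a m * (1 - 100 / M * (D + real (Suc m))) \<le> a (Suc m) * real (Suc m)"
begin

text \<open>
  A bound for the relative errors accumulated over the first \<open>m\<close> ratios.
\<close>

definition err :: "nat \<Rightarrow> real" where "err m = 100 / M * (D * real m + (real m)\<^sup>2)"

lemma D_le_sq: "D \<le> D\<^sup>2"
  using mult_left_mono[of 1 D D] D_ge by (simp add: power2_eq_square)

lemma M_pos: "0 < M" "100000 \<le> M" "100000 * D \<le> M"
  using D_ge D_le_sq M_ge by linarith+

lemma err_nonneg: "0 \<le> err m"
  using D_ge M_pos by (auto simp: err_def)

lemma err_Suc: "err m + 100 / M * (D + real (Suc m)) \<le> err (Suc m)"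
proof -
  have "c * (D * real (Suc m) + (real (Suc m))\<^sup>2) = c * (D * real m + (real m)\<^sup>2) + c * (D + real (Suc m)) + c * real m" for c
    by (simp add: power2_eq_square algebra_simps)
  moreover have "0 \<le> 100 / M * real m" using M_pos by simp
  ultimately show ?thesis unfolding err_def by simp
qed

lemma err_upper: "err m \<le> 1 \<Longrightarrow> a m * fact m * (1 - err m) \<le> A ^ m * a 0"
proof (induction m)
  case 0
  then show ?case by (simp add: err_def)
next
  case (Suc m)
  let ?u = "100 / M * (D + real (Suc m))"
  have u: "0 \<le> ?u" using D_ge M_pos by auto
  have em: "err m \<le> 1" using Suc.prems err_Suc[of m] u by linarith
  have "(1 - u) * (1 - e) = 1 - u - e + u * e" for u e :: real by (simp add: algebra_simps)
  from this[of ?u "err m"] have "1 - err (Suc m) \<le> (1 - ?u) * (1 - err m)"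
    using err_Suc[of m] mult_nonneg_nonneg[OF u err_nonneg[of m]] by linarith
  then have "a (Suc m) * fact (Suc m) * (1 - err (Suc m)) \<le> a (Suc m) * fact (Suc m) * ((1 - ?u) * (1 - err m))"
    using a_nonneg by (intro mult_left_mono) auto
  also have "\<dots> = (a (Suc m) * real (Suc m) * (1 - ?u)) * (fact m * (1 - err m))"
    by (simp only: fact_Suc of_nat_fact of_nat_mult mult_ac)
  also have "\<dots> \<le> (A * a m) * (fact m * (1 - err m))"
    using upper em by (intro mult_right_mono) auto
  also have "\<dots> = A * (a m * fact m * (1 - err m))" by (simp only: mult_ac)
  also have "\<dots> \<le> A * (A ^ m * a 0)" using Suc.IH em A_nonneg by (intro mult_left_mono) auto
  finally show ?case by (simp add: mult_ac)
qed

lemma err_lower: "A ^ m * a 0 * (1 - err m) \<le> a m * fact m"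
proof (induction m)
  case 0
  then show ?case by (simp add: err_def)
next
  case (Suc m)
  let ?u = "100 / M * (D + real (Suc m))"
  have u: "0 \<le> ?u" using D_ge M_pos by auto
  show ?case
  proof (cases "?u \<le> 1")
    case False
    then have "1 - err (Suc m) \<le> 0" using err_Suc[of m] err_nonneg[of m] by linarith
    then have "A ^ Suc m * a 0 * (1 - err (Suc m)) \<le> 0"
      using A_nonneg a_nonneg by (intro mult_nonneg_nonpos) auto
    then show ?thesis using a_nonneg[of "Suc m"] by (meson mult_nonneg_nonneg fact_ge_zero order_trans)
  next
    case True
    have "(1 - e) * (1 - u) = 1 - u - e + u * e" for u e :: real by (simp add: algebra_simps)
    from this[of "err m" ?u] have "1 - err (Suc m) \<le> (1 - err m) * (1 - ?u)"
      using err_Suc[of m] mult_nonneg_nonneg[OF u err_nonneg[of m]] by linarith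
    then have "A ^ Suc m * a 0 * (1 - err (Suc m)) \<le> A ^ Suc m * a 0 * ((1 - err m) * (1 - ?u))"
      using A_nonneg a_nonneg by (intro mult_left_mono) auto
    also have "\<dots> = (A ^ m * a 0 * (1 - err m)) * (A * (1 - ?u))" by (simp only: power_Suc mult_ac)
    also have "\<dots> \<le> (a m * fact m) * (A * (1 - ?u))"
      using Suc.IH A_nonneg True by (intro mult_right_mono) auto
    also have "\<dots> = fact m * (A * a m * (1 - ?u))" by (simp only: mult_ac)
    also have "\<dots> \<le> fact m * (a (Suc m) * real (Suc m))"
      using lower by (intro mult_left_mono) auto
    finally show ?thesis by (simp add: mult_ac)
  qed
qed

lemma sum_err:
  "(\<Sum>m\<le>N. A ^ m / fact m * err m) \<le> 300 * (D\<^sup>2 / M) * exp A"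
proof -
  have "(\<Sum>m\<le>N. A ^ m / fact m * err m) =
      100 / M * (D * (\<Sum>m\<le>N. real m * (A ^ m / fact m)) + (\<Sum>m\<le>N. (real m)\<^sup>2 * (A ^ m / fact m)))"
    by (simp add: err_def sum_distrib_left sum.distrib algebra_simps)
  also have "\<dots> \<le> 100 / M * (D * (A * exp A) + (A\<^sup>2 + A) * exp A)"
    using poisson_first_moment[OF A_nonneg] poisson_second_moment[OF A_nonneg] M_pos D_ge
    by (intro mult_left_mono add_mono) auto
  also have "\<dots> \<le> 100 / M * (D\<^sup>2 * exp A + (D\<^sup>2 + D\<^sup>2) * exp A)"
  proof (intro mult_left_mono add_mono mult_right_mono)
    show "A\<^sup>2 \<le> D\<^sup>2" using A_nonneg A_le by (intro power_mono) auto
    show "A \<le> D\<^sup>2" using A_le D_le_sq by linarith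
    have "D * A \<le> D * D" using A_le D_ge by (intro mult_left_mono) auto
    then show "D * (A * exp A) \<le> D\<^sup>2 * exp A"
      using mult_right_mono[of "D * A" "D * D" "exp A"] by (simp add: power2_eq_square mult.assoc)
  qed (use M_pos in auto)
  finally show ?thesis by (simp add: field_simps)
qed

text \<open>
  The terms up to \<open>N\<close> of order \<open>M\<close> cover almost all of \<open>W\<close>. Among them, those up to order \<open>sqrt M\<close> are compared
  directly with the Poisson weights, since their accumulated error is at most \<open>1/2\<close>. For the remaining
  ones the error may be exponentially large; they are negligible because applying the ratio bound
  twice gives the second moment \<open>\<Sum> m (m - 1) a\<^sub>m \<le> 4 A\<^sup>2 \<Sum> a\<^sub>m\<close>.
\<close>

lemma estimate_total:
  assumes W: "\<And>N. (\<Sum>m\<le>N. a m) \<le> W"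
    and cover: "\<And>N. W - (\<Sum>m\<le>N. a m) \<le> (96 * D\<^sup>2 / M + 12 * D / real (Suc N)) * W"
  shows "\<bar>a 0 * exp A - W\<bar> \<le> 20000 * (D\<^sup>2 / M) * W"
proof -
  define t where "t = D\<^sup>2 / M"
  have t: "0 \<le> t" "t \<le> 1 / 100000" using M_pos M_ge by (auto simp: t_def field_simps)
  have DM: "D / M \<le> t" unfolding t_def using M_pos D_le_sq by (intro divide_right_mono) auto
  define N where "N = nat \<lfloor>M / 400\<rfloor>"
  have N: "real N \<le> M / 400" "M / 400 \<le> real (Suc N)"
    using M_pos by (auto simp: N_def) linarith+
  have frac: "D / real (Suc N) \<le> 400 * t"
  proof -
    have "D / real (Suc N) \<le> D / (M / 400)" using N M_pos D_ge by (intro divide_left_mono) auto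
    also have "\<dots> = 400 * (D / M)" by simp
    finally show ?thesis using DM by linarith
  qed
  define S where "S = (\<Sum>m\<le>N. a m)"
  have W0: "0 \<le> W" using W[of 0] a_nonneg[of 0] by simp
  have S0: "0 \<le> S" "S \<le> W" using W a_nonneg by (auto simp: S_def intro: sum_nonneg)
  have SW: "W * (1 - 4896 * t) \<le> S"
  proof -
    have "96 * D\<^sup>2 / M + 12 * D / real (Suc N) \<le> 4896 * t" using frac by (simp add: t_def)
    then have "(96 * D\<^sup>2 / M + 12 * D / real (Suc N)) * W \<le> 4896 * t * W" using W0 by (rule mult_right_mono)
    then show ?thesis using cover[of N] by (simp add: S_def algebra_simps)
  qed
  have half: "a (Suc m) * real (Suc m) \<le> 2 * A * a m" if "Suc m \<le> N" for m
  proof -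
    have "real (Suc m) \<le> real N" using that by (rule of_nat_mono)
    then have "100 * (D + real (Suc m)) \<le> M / 2" using N(1) M_pos(1,3) by argo
    then have "100 / M * (D + real (Suc m)) \<le> 1 / 2" using M_pos(1) by (simp add: pos_divide_le_eq)
    then have "a (Suc m) * real (Suc m) * (1 / 2) \<le> a (Suc m) * real (Suc m) * (1 - 100 / M * (D + real (Suc m)))"
      using a_nonneg by (intro mult_left_mono) auto
    then show ?thesis using upper[of m] by linarith
  qed
  \<comment> \<open>On \<open>G\<close> the accumulated error is at most \<open>1/2\<close>; outside, \<open>m\<^sup>2\<close> is of order at least \<open>M\<close>.\<close>
  define G where "G = {m \<in> {..N}. (real m)\<^sup>2 \<le> M / 1600}"
  have tail: "(\<Sum>m\<in>{..N} - G. a m) \<le> 12800 * t * S"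
  proof -
    have two: "2 \<le> m" if "m \<in> {..N} - G" for m
    proof (rule ccontr)
      assume "\<not> 2 \<le> m"
      then have "real m ^ 2 \<le> 1 ^ 2" by (intro power_mono) auto
      then show False using that M_pos by (auto simp: G_def)
    qed
    have bound: "a m * (M / 3200) \<le> 4 * A\<^sup>2 * a (m - 2)" if mG: "m \<in> {..N} - G" for m
    proof -
      obtain l where l: "m = Suc (Suc l)" using two[OF mG] by (metis add_2_eq_Suc le_Suc_ex)
      have "M / 1600 \<le> (real m)\<^sup>2" using mG by (auto simp: G_def)
      also have "(real m)\<^sup>2 \<le> 2 * (real m * real (Suc l))" by (simp add: l power2_eq_square algebra_simps)
      finally have "a m * (M / 3200) \<le> a m * (real m * real (Suc l))"
        using a_nonneg by (intro mult_left_mono) auto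
      also have "\<dots> = (a m * real m) * real (Suc l)" by simp
      also have "\<dots> \<le> (2 * A * a (Suc l)) * real (Suc l)"
        unfolding l using mG half[of "Suc l"] by (intro mult_right_mono) (auto simp: l)
      also have "\<dots> = 2 * A * (a (Suc l) * real (Suc l))" by simp
      also have "\<dots> \<le> 2 * A * (2 * A * a l)"
        using mG half[of l] A_nonneg by (intro mult_left_mono) (auto simp: l)
      finally show ?thesis by (simp add: l power2_eq_square)
    qed
    have "(\<Sum>m\<in>{..N} - G. a m) * (M / 3200) \<le> (\<Sum>m\<in>{..N} - G. 4 * A\<^sup>2 * a (m - 2))"
      unfolding sum_distrib_right by (intro sum_mono bound)
    also have "\<dots> = 4 * A\<^sup>2 * (\<Sum>m\<in>{..N} - G. a (m - 2))" by (simp add: sum_distrib_left)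
    also have "(\<Sum>m\<in>{..N} - G. a (m - 2)) = (\<Sum>l\<in>(\<lambda>m. m - 2) ` ({..N} - G). a l)"
    proof (rule sum.reindex_cong[symmetric, where l = "\<lambda>m. m - 2"])
      show "inj_on (\<lambda>m. m - 2) ({..N} - G)" using two by (intro inj_onI) (metis le_add_diff_inverse2)
    qed auto
    also have "\<dots> \<le> S" unfolding S_def using a_nonneg by (intro sum_mono2) auto
    finally have "(\<Sum>m\<in>{..N} - G. a m) * (M / 3200) \<le> 4 * A\<^sup>2 * S" by (simp add: mult_left_mono)
    also have "\<dots> \<le> 4 * D\<^sup>2 * S" using A_nonneg A_le S0 by (intro mult_right_mono mult_left_mono power_mono) auto
    finally show ?thesis using M_pos by (simp add: t_def field_simps)
  qed
  have main: "(\<Sum>m\<in>G. a m) \<le> a 0 * exp A * (1 + 600 * t)"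
  proof -
    have bound: "a m \<le> a 0 * (A ^ m / fact m + 2 * (A ^ m / fact m * err m))" if "m \<in> G" for m
    proof -
      have m: "(real m)\<^sup>2 \<le> M / 1600" using that by (simp add: G_def)
      have "(D * real m)\<^sup>2 \<le> (M / 400)\<^sup>2"
      proof -
        have "(D * real m)\<^sup>2 = D\<^sup>2 * (real m)\<^sup>2" by (simp add: power_mult_distrib)
        also have "\<dots> \<le> (M / 100000) * (M / 1600)" using M_ge m M_pos by (intro mult_mono) auto
        also have "\<dots> \<le> (M / 400)\<^sup>2" by (simp add: power2_eq_square)
        finally show ?thesis .
      qed
      then have "D * real m \<le> M / 400" by (rule power2_le_imp_le) (use M_pos in simp)
      then have e: "err m \<le> 1 / 2" using m M_pos by (simp add: err_def field_simps)
      have "a m * fact m * 1 \<le> a m * fact m * ((1 - err m) * (1 + 2 * err m))"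
      proof (intro mult_left_mono)
        have "(1 - err m) * (1 + 2 * err m) = 1 + err m * (1 - 2 * err m)" by (simp add: algebra_simps)
        then show "1 \<le> (1 - err m) * (1 + 2 * err m)" using e err_nonneg[of m] by simp
      qed (use a_nonneg in auto)
      also have "\<dots> = (a m * fact m * (1 - err m)) * (1 + 2 * err m)" by simp
      also have "\<dots> \<le> (A ^ m * a 0) * (1 + 2 * err m)"
        using err_upper[of m] e err_nonneg[of m] by (intro mult_right_mono) auto
      finally show ?thesis by (simp add: field_simps)
    qed
    have "(\<Sum>m\<in>G. a m) \<le> (\<Sum>m\<in>G. a 0 * (A ^ m / fact m + 2 * (A ^ m / fact m * err m)))"
      by (rule sum_mono[OF bound])
    also have "\<dots> \<le> (\<Sum>m\<le>N. a 0 * (A ^ m / fact m + 2 * (A ^ m / fact m * err m)))"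
      using a_nonneg A_nonneg err_nonneg by (intro sum_mono2) (auto simp: G_def)
    also have "\<dots> = a 0 * ((\<Sum>m\<le>N. A ^ m / fact m) + 2 * (\<Sum>m\<le>N. A ^ m / fact m * err m))"
      by (simp only: sum_distrib_left sum.distrib distrib_left)
    also have "\<dots> \<le> a 0 * (exp A + 2 * (300 * t * exp A))"
      using poisson_partial_sum[OF A_nonneg] sum_err a_nonneg
      by (intro mult_left_mono add_mono) (auto simp: t_def)
    finally show ?thesis by (simp add: algebra_simps)
  qed
  have "S = (\<Sum>m\<in>{..N} - G. a m) + (\<Sum>m\<in>G. a m)"
    unfolding S_def by (rule sum.subset_diff) (auto simp: G_def)
  then have S1: "S * (1 - 12800 * t) \<le> a 0 * exp A * (1 + 600 * t)" using tail main by (simp add: algebra_simps)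
  have low: "W * (1 - 20000 * t) \<le> a 0 * exp A"
  proof -
    have "(1 - 20000 * t) * (1 + 600 * t) \<le> (1 - 4896 * t) * (1 - 12800 * t)"
    proof -
      have "(1 - 4896 * t) * (1 - 12800 * t) - (1 - 20000 * t) * (1 + 600 * t) = 1704 * t + 74668800 * (t * t)"
        by (simp add: algebra_simps)
      then show ?thesis using t mult_nonneg_nonneg[OF t(1) t(1)] by linarith
    qed
    then have "W * (1 - 20000 * t) * (1 + 600 * t) \<le> W * (1 - 4896 * t) * (1 - 12800 * t)"
      using W0 by (simp add: mult.assoc mult_left_mono)
    also have "\<dots> \<le> S * (1 - 12800 * t)" using SW t by (intro mult_right_mono) auto
    also note S1
    finally show ?thesis using t by (subst (asm) mult_le_cancel_right_pos) auto
  qed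
  have up: "a 0 * exp A * (1 - 700 * t) \<le> W"
  proof -
    have tailA: "A * exp A / real (Suc N) \<le> 400 * t * exp A"
    proof -
      have "A / real (Suc N) \<le> D / real (Suc N)" using A_le by (intro divide_right_mono) auto
      then have "A / real (Suc N) * exp A \<le> 400 * t * exp A" using frac by (intro mult_right_mono) auto
      then show ?thesis by simp
    qed
    have "a 0 * exp A * (1 - 700 * t) = a 0 * (exp A - 400 * t * exp A - 300 * t * exp A)"
      by (simp add: algebra_simps)
    also have "\<dots> \<le> a 0 * ((\<Sum>m\<le>N. A ^ m / fact m) - (\<Sum>m\<le>N. A ^ m / fact m * err m))"
      using poisson_tail[OF A_nonneg, of N] tailA sum_err[of N, folded t_def]
      by (intro mult_left_mono a_nonneg) linarith
    also have "\<dots> = (\<Sum>m\<le>N. a 0 * (A ^ m / fact m) * (1 - err m))"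
      unfolding sum_subtractf[symmetric] sum_distrib_left
      by (intro sum.cong refl) (simp add: right_diff_distrib)
    also have "\<dots> \<le> (\<Sum>m\<le>N. a m)"
      using err_lower by (intro sum_mono) (simp add: field_simps)
    also have "\<dots> \<le> W" by (rule W)
    finally show ?thesis .
  qed
  have "a 0 * exp A \<le> W * (1 + 20000 * t)"
  proof -
    have "1 \<le> (1 - 700 * t) * (1 + 20000 * t)"
    proof -
      have "t * t \<le> 1 / 100000 * t" using t by (intro mult_right_mono) auto
      then show ?thesis using t by (simp add: algebra_simps)
    qed
    then have "a 0 * exp A * 1 \<le> a 0 * exp A * ((1 - 700 * t) * (1 + 20000 * t))"
      using a_nonneg by (intro mult_left_mono) auto
    also have "\<dots> = (a 0 * exp A * (1 - 700 * t)) * (1 + 20000 * t)" by simp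
    also have "\<dots> \<le> W * (1 + 20000 * t)" using up t by (intro mult_right_mono) auto
    finally show ?thesis by simp
  qed
  then show ?thesis using low by (simp add: t_def[symmetric] abs_le_iff algebra_simps)
qed

end

section \<open>Regular graphs that avoid a regular graph\<close>

text \<open>
  The multinomial coefficient \<open>(d \<sqdot> card V)! / d!\<^bsup>card V\<^esup>\<close>, by choosing the positions of one label after another.
\<close>

lemma card_equal_fibres:
  fixes P :: "'p set" and V :: "'v set"
  assumes "finite V" "finite P" "card P = d * card V"
  shows "card {w \<in> P \<rightarrow>\<^sub>E V. \<forall>v\<in>V. card {p \<in> P. w p = v} = d} * fact d ^ card V = (fact (card P) :: nat)"
  using assms
proof (induction V arbitrary: P)
  case empty
  then have "P = {}" by simp
  then show ?case by simp
next
  case (insert v V)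
  define W where "W P V = {w \<in> P \<rightarrow>\<^sub>E V. \<forall>v\<in>V. card {p \<in> P. w p = v} = d}" for P :: "'p set" and V :: "'v set"
  define \<S> where "\<S> = {S. S \<subseteq> P \<and> card S = d}"
  have fin: "finite \<S>" using insert.prems by (auto simp: \<S>_def)
  have cP: "card P = d + d * card V" using insert by simp
  let ?f = "\<lambda>w. ({p \<in> P. w p = v}, restrict w {p \<in> P. w p \<noteq> v})"
  let ?g = "\<lambda>(S, u) p. if p \<in> S then v else u p"
  have "bij_betw ?f (W P (insert v V)) (SIGMA S:\<S>. W (P - S) V)"
  proof (rule bij_betw_byWitness[where f' = ?g])
    show "\<forall>w\<in>W P (insert v V). ?g (?f w) = w"
      by (auto simp: W_def fun_eq_iff PiE_iff extensional_def)
    show "\<forall>a\<in>SIGMA S:\<S>. W (P - S) V. ?f (?g a) = a"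
    proof
      fix a assume "a \<in> (SIGMA S:\<S>. W (P - S) V)"
      then obtain S u where a: "a = (S, u)" "S \<subseteq> P" and u: "u \<in> (P - S) \<rightarrow>\<^sub>E V"
        by (auto simp: \<S>_def W_def)
      have "u p \<noteq> v" if "p \<in> P - S" for p using u that insert.hyps by (auto simp: PiE_iff)
      then have "{p \<in> P. (if p \<in> S then v else u p) = v} = S" "{p \<in> P. (if p \<in> S then v else u p) \<noteq> v} = P - S"
        using a(2) by auto
      moreover have "restrict (\<lambda>p. if p \<in> S then v else u p) (P - S) = u"
        using u by (auto simp: fun_eq_iff restrict_def PiE_iff extensional_def)
      ultimately show "?f (?g a) = a" using a by simp
    qed
    show "?f ` W P (insert v V) \<subseteq> (SIGMA S:\<S>. W (P - S) V)"
    proof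
      fix a assume "a \<in> ?f ` W P (insert v V)"
      then obtain w where w: "w \<in> W P (insert v V)" and a: "a = ?f w" by blast
      define R where "R = {p \<in> P. w p \<noteq> v}"
      have wP: "\<And>p. p \<in> P \<Longrightarrow> w p \<in> insert v V" and deg: "\<And>u. u \<in> insert v V \<Longrightarrow> card {p \<in> P. w p = u} = d"
        using w by (auto simp: W_def)
      have eq: "P - {p \<in> P. w p = v} = R" by (auto simp: R_def)
      have "restrict w R \<in> R \<rightarrow>\<^sub>E V" using wP by (auto simp: R_def)
      moreover have "card {p \<in> R. restrict w R p = u} = d" if "u \<in> V" for u
      proof -
        have "{p \<in> R. restrict w R p = u} = {p \<in> P. w p = u}" using that insert.hyps by (auto simp: R_def)
        then show ?thesis using deg that by simp
      qed
      ultimately have "restrict w R \<in> W R V" by (simp add: W_def)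
      then show "a \<in> (SIGMA S:\<S>. W (P - S) V)"
        using deg[of v] unfolding a R_def[symmetric] by (auto simp: \<S>_def eq)
    qed
    show "?g ` (SIGMA S:\<S>. W (P - S) V) \<subseteq> W P (insert v V)"
    proof
      fix a assume "a \<in> ?g ` (SIGMA S:\<S>. W (P - S) V)"
      then obtain S u where a: "a = ?g (S, u)" and S: "S \<subseteq> P" "card S = d" and u: "u \<in> W (P - S) V"
        by (auto simp: \<S>_def)
      have "u p \<noteq> v" if "p \<in> P - S" for p using u that insert.hyps by (auto simp: W_def PiE_iff)
      then have "{p \<in> P. (if p \<in> S then v else u p) = v} = S" using S by auto
      moreover have "{p \<in> P. (if p \<in> S then v else u p) = z} = {p \<in> P - S. u p = z}" if "z \<in> V" for z
        using that insert.hyps by auto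
      moreover have "(\<lambda>p. if p \<in> S then v else u p) \<in> P \<rightarrow>\<^sub>E insert v V"
        using u S by (auto simp: W_def PiE_iff extensional_def)
      ultimately show "a \<in> W P (insert v V)"
        unfolding a using u S by (auto simp: W_def)
    qed
  qed
  then have "card (W P (insert v V)) = card (SIGMA S:\<S>. W (P - S) V)" by (rule bij_betw_same_card)
  also have "\<dots> = (\<Sum>S\<in>\<S>. card (W (P - S) V))"
  proof (rule card_SigmaI[OF fin])
    show "\<forall>S\<in>\<S>. finite (W (P - S) V)"
    proof
      fix S
      have "finite ((P - S) \<rightarrow>\<^sub>E V)" using insert.hyps insert.prems by (intro finite_PiE) auto
      then show "finite (W (P - S) V)" by (rule rev_finite_subset) (simp add: W_def)
    qed
  qed
  finally have "card (W P (insert v V)) * fact d ^ card (insert v V)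
      = (\<Sum>S\<in>\<S>. card (W (P - S) V) * fact d ^ card V) * fact d"
    using insert.hyps by (simp add: sum_distrib_left mult_ac)
  also have "(\<Sum>S\<in>\<S>. card (W (P - S) V) * fact d ^ card V) = (\<Sum>S\<in>\<S>. fact (d * card V))"
  proof (rule sum.cong[OF refl])
    fix S assume "S \<in> \<S>"
    then have S: "finite (P - S)" "card (P - S) = d * card V"
      using insert.prems cP by (auto simp: \<S>_def card_Diff_subset finite_subset)
    show "card (W (P - S) V) * fact d ^ card V = fact (d * card V)"
      using insert.IH[OF S] S by (simp add: W_def)
  qed
  also have "\<dots> = (card P choose d) * fact (d * card V)"
    using n_subsets[OF insert.prems(1)] by (simp add: \<S>_def)
  also have "\<dots> * fact d = fact (card P)"
    using binomial_fact_lemma[of d "card P"] cP by (simp add: mult_ac)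
  finally show ?case by (simp only: W_def)
qed

context pairing_words
begin

lemma card_words: "card words * fact d ^ card V = fact (card P)"
  using card_equal_fibres[OF finite_V finite_P card_P] by (simp add: words_def)

lemma level_0: "level 0 = {w \<in> words. \<forall>p\<in>P. plain w p}"
proof (intro set_eqI iffI)
  fix w assume "w \<in> level 0"
  then have w: "w \<in> words" "card (bad w) = 0" by (auto simp: level_def)
  then have "card (nonplain w) = 0" using card_nonplain[of w] by simp
  then have "nonplain w = {}" by simp
  then show "w \<in> {w \<in> words. \<forall>p\<in>P. plain w p}" using w by (auto simp: nonplain_def)
next
  fix w assume w: "w \<in> {w \<in> words. \<forall>p\<in>P. plain w p}"
  then have "bad w = {}" using plain_not_bad by (auto simp: bad_def)
  moreover have "tame w" using w plain_unique unfolding tame_def by blast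
  ultimately show "w \<in> level 0" using w by (simp add: level_def)
qed

lemma card_simple_words:
  assumes "100000 * (real D)\<^sup>2 \<le> real (card P)"
  shows "\<bar>real (card (level 0)) * exp mean - real (card words)\<bar>
    \<le> 20000 * ((real D)\<^sup>2 / real (card P)) * real (card words)"
proof -
  have D1: "1 \<le> real D" using d_le_D by simp
  then have "1 \<le> (real D)\<^sup>2" by (rule one_le_power)
  then have "100000 \<le> real (card P)" using assms by linarith
  then have M: "0 < card P" "12 \<le> card P" by linarith+
  interpret near_poisson "\<lambda>m. real (card (level m))" mean "real D" "real (card P)"
    using level_upper level_lower mean_nonneg mean_le D1 assms M by unfold_locales auto
  show ?thesis
  proof (rule estimate_total)
    show "(\<Sum>m\<le>N. real (card (level m))) \<le> real (card words)" for N
      using of_nat_mono[OF levels_disjoint[of N], where 'a = real] by simp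
    show "real (card words) - (\<Sum>m\<le>N. real (card (level m)))
        \<le> (96 * (real D)\<^sup>2 / real (card P) + 12 * real D / real (Suc N)) * real (card words)" for N
      using words_covered[OF M(2)] by blast
  qed
qed

end

lemma card_injections_same:
  assumes "finite E" "card E = m"
  shows "card {e \<in> {..<m} \<rightarrow>\<^sub>E E. inj_on e {..<m}} = fact m"
  using card_inj_on_subset_funcset[of "{..<m}" E "{..<m}"] assms
  by (simp add: fact_prod_rev atLeast0LessThan)

lemma finite_complete_edges: "finite (complete_edges n)"
  unfolding complete_edges_def by (rule finite_subset[of _ "Pow {..<n}"]) auto

lemma card_regular_spanning:
  assumes "regular_spanning n d E"
  shows "2 * card E = n * d" "finite E"
proof -
  have E: "E \<subseteq> complete_edges n" and deg: "\<And>v. v < n \<Longrightarrow> card {e \<in> E. v \<in> e} = d"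
    using assms by (auto simp: regular_spanning_def)
  show fin: "finite E" using E finite_complete_edges by (rule finite_subset)
  have "card (SIGMA v:{..<n}. {e \<in> E. v \<in> e}) = n * d" using deg fin by (simp add: card_SigmaI)
  moreover have "card (SIGMA e:E. {v \<in> {..<n}. v \<in> e}) = card E * 2"
  proof -
    have "card {v \<in> {..<n}. v \<in> e} = 2" if "e \<in> E" for e
    proof -
      have "{v \<in> {..<n}. v \<in> e} = e" using that E by (auto simp: complete_edges_def)
      then show ?thesis using that E by (auto simp: complete_edges_def)
    qed
    then show ?thesis using fin by (simp add: card_SigmaI)
  qed
  moreover have "card (SIGMA v:{..<n}. {e \<in> E. v \<in> e}) = card (SIGMA e:E. {v \<in> {..<n}. v \<in> e})"
    by (rule bij_betw_same_card[where f = prod.swap], rule bij_betw_byWitness[where f' = prod.swap]) auto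
  ultimately show "2 * card E = n * d" by simp
qed

definition disjoint_regular :: "nat \<Rightarrow> nat \<Rightarrow> nat set set \<Rightarrow> nat set set set" where
  "disjoint_regular n d F = {E. regular_spanning n d E \<and> E \<inter> F = {}}"

definition half_edges :: "nat \<Rightarrow> (nat \<times> bool) set" where
  "half_edges m = {..<m} \<times> UNIV"

lemma half_edges_iff: "p \<in> half_edges m \<longleftrightarrow> fst p < m"
  by (cases p) (auto simp: half_edges_def)

lemma card_half_edges: "card (half_edges m) = 2 * m" and finite_half_edges: "finite (half_edges m)"
  by (simp_all add: half_edges_def card_cartesian_product)

definition opposite :: "nat \<times> bool \<Rightarrow> nat \<times> bool" where
  "opposite p = (fst p, \<not> snd p)"

text \<open>
  The positions are the pairs \<open>(i, b)\<close> of an edge index \<open>i < m\<close> and a flag for the end of the edge.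
\<close>

locale forbidden_graph =
  fixes n d x m :: nat and F :: "nat set set"
  assumes F: "regular_spanning n x F" and m: "2 * m = n * d" and d1: "1 \<le> d"
begin

lemma pairing_words_half_edges: "pairing_words (half_edges m) opposite {..<n} (\<lambda>u v. {u, v} \<in> F) d x"
proof
  show "card {u \<in> {..<n}. {v, u} \<in> F} = x" if "v \<in> {..<n}" for v
  proof -
    have "bij_betw (\<lambda>u. {v, u}) {u \<in> {..<n}. {v, u} \<in> F} {e \<in> F. v \<in> e}"
    proof (rule bij_betw_imageI)
      show "inj_on (\<lambda>u. {v, u}) {u \<in> {..<n}. {v, u} \<in> F}"
        by (auto intro!: inj_onI simp: doubleton_eq_iff)
      show "(\<lambda>u. {v, u}) ` {u \<in> {..<n}. {v, u} \<in> F} = {e \<in> F. v \<in> e}"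
      proof (intro equalityI subsetI)
        fix e assume e: "e \<in> {e \<in> F. v \<in> e}"
        then have "e \<subseteq> {..<n}" "card e = 2" using F by (auto simp: regular_spanning_def complete_edges_def)
        then obtain a b where "e = {a, b}" by (auto simp: card_2_iff)
        then show "e \<in> (\<lambda>u. {v, u}) ` {u \<in> {..<n}. {v, u} \<in> F}"
          using e \<open>e \<subseteq> {..<n}\<close> by (auto simp: insert_commute)
      qed auto
    qed
    then show ?thesis
      using F that bij_betw_same_card by (fastforce simp: regular_spanning_def)
  qed
  show "{u, v} \<in> F \<Longrightarrow> {v, u} \<in> F" for u v by (simp add: insert_commute)
  show "{v, v} \<notin> F" for v using F by (auto simp: regular_spanning_def complete_edges_def)
  show "card (half_edges m) = d * card {..<n}" using m by (simp add: card_half_edges mult.commute)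
qed (use d1 finite_half_edges in \<open>auto simp: half_edges_iff opposite_def prod_eq_iff\<close>)

sublocale pairing_words "half_edges m" opposite "{..<n}" "\<lambda>u v. {u, v} \<in> F" d x
  by (rule pairing_words_half_edges)

definition edge_at :: "(nat \<times> bool \<Rightarrow> nat) \<Rightarrow> nat \<Rightarrow> nat set" where
  "edge_at w i = {w (i, False), w (i, True)}"

lemma edge_at_eq: "edge_at w i = {w (i, b), w (i, \<not> b)}"
  by (cases b) (auto simp: edge_at_def)

lemma edge_at_mem: "w (i, b) \<in> edge_at w i"
  by (cases b) (auto simp: edge_at_def)

lemma card_fibre_eq_degree:
  assumes "\<And>i. i < m \<Longrightarrow> w (i, False) \<noteq> w (i, True)" "inj_on (edge_at w) {..<m}"
  shows "card {p \<in> half_edges m. w p = v} = card {e \<in> edge_at w ` {..<m}. v \<in> e}"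
proof (rule bij_betw_same_card[where f = "\<lambda>p. edge_at w (fst p)"], rule bij_betw_imageI)
  have ne: "w (i, b) \<noteq> w (i, \<not> b)" if "i < m" for i b using assms(1)[OF that] by (cases b) auto
  show "inj_on (\<lambda>p. edge_at w (fst p)) {p \<in> half_edges m. w p = v}"
  proof (rule inj_onI)
    fix p q
    assume *: "p \<in> {p \<in> half_edges m. w p = v}" "q \<in> {p \<in> half_edges m. w p = v}"
      "edge_at w (fst p) = edge_at w (fst q)"
    obtain i b j c where pq: "p = (i, b)" "q = (j, c)" by (cases p, cases q)
    have "i = j" using assms(2) * by (auto simp: half_edges_iff inj_on_def pq)
    moreover have "b = c"
      using * ne[of i b] \<open>i = j\<close> by (cases b; cases c) (auto simp: half_edges_iff pq)
    ultimately show "p = q" by (simp add: pq)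
  qed
  show "(\<lambda>p. edge_at w (fst p)) ` {p \<in> half_edges m. w p = v} = {e \<in> edge_at w ` {..<m}. v \<in> e}"
  proof (intro equalityI subsetI)
    fix e assume "e \<in> {e \<in> edge_at w ` {..<m}. v \<in> e}"
    then obtain i where i: "i < m" "e = edge_at w i" "v \<in> edge_at w i" by auto
    then obtain b where "v = w (i, b)" by (auto simp: edge_at_def)
    then show "e \<in> (\<lambda>p. edge_at w (fst p)) ` {p \<in> half_edges m. w p = v}"
      using i by (auto simp: half_edges_iff intro!: image_eqI[of _ _ "(i, b)"])
  qed (use edge_at_mem[of w] in \<open>auto simp: half_edges_iff\<close>)
qed

text \<open>
  The simple words are the orientations and enumerations of the edges of the graphs to be counted.
\<close>

lemma level_0_edges:
  "w \<in> level 0 \<longleftrightarrow> w \<in> half_edges m \<rightarrow>\<^sub>E {..<n} \<and> (\<forall>i<m. w (i, False) \<noteq> w (i, True)) \<and>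
     inj_on (edge_at w) {..<m} \<and> edge_at w ` {..<m} \<in> disjoint_regular n d F"
proof
  assume "w \<in> level 0"
  then have w: "w \<in> words" and pl: "\<And>p. p \<in> half_edges m \<Longrightarrow> plain w p" by (auto simp: level_0)
  have PiE: "w \<in> half_edges m \<rightarrow>\<^sub>E {..<n}" using w by (simp add: words_def)
  have ne: "w (i, False) \<noteq> w (i, True)" if "i < m" for i
    using pl[of "(i, False)"] that by (auto simp: half_edges_iff plain_def forb_def opposite_def)
  have noF: "edge_at w i \<notin> F" if "i < m" for i
    using pl[of "(i, False)"] that by (auto simp: half_edges_iff plain_def forb_def opposite_def edge_at_def)
  have inj: "inj_on (edge_at w) {..<m}"
  proof (rule inj_onI)
    fix i j assume ij: "i \<in> {..<m}" "j \<in> {..<m}" "edge_at w i = edge_at w j"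
    have "par w (i, False) (j, False) \<or> par w (i, False) (j, True)"
      using ij(3) by (auto simp: edge_at_def par_def opposite_def doubleton_eq_iff)
    then obtain c where "par w (i, False) (j, c)" by blast
    then have "(j, c) = (i, False)"
      using plain_unique[OF pl, of "(i, False)" "(j, c)"] ij by (simp add: half_edges_iff)
    then show "i = j" by simp
  qed
  have "regular_spanning n d (edge_at w ` {..<m})"
    unfolding regular_spanning_def
  proof (intro conjI allI impI)
    show "edge_at w ` {..<m} \<subseteq> complete_edges n"
      using PiE ne by (auto simp: complete_edges_def edge_at_def PiE_iff half_edges_iff card_insert_if)
    show "card {e \<in> edge_at w ` {..<m}. v \<in> e} = d" if "v < n" for v
      using card_fibre_eq_degree[OF ne inj] w that by (simp add: words_def)
  qed
  then show "w \<in> half_edges m \<rightarrow>\<^sub>E {..<n} \<and> (\<forall>i<m. w (i, False) \<noteq> w (i, True)) \<and>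
     inj_on (edge_at w) {..<m} \<and> edge_at w ` {..<m} \<in> disjoint_regular n d F"
    using PiE ne inj noF by (auto simp: disjoint_regular_def)
next
  assume *: "w \<in> half_edges m \<rightarrow>\<^sub>E {..<n} \<and> (\<forall>i<m. w (i, False) \<noteq> w (i, True)) \<and>
     inj_on (edge_at w) {..<m} \<and> edge_at w ` {..<m} \<in> disjoint_regular n d F"
  then have reg: "regular_spanning n d (edge_at w ` {..<m})" and noF: "edge_at w ` {..<m} \<inter> F = {}"
    by (auto simp: disjoint_regular_def)
  have "w \<in> words"
    using * reg card_fibre_eq_degree[of w] by (auto simp: words_def regular_spanning_def)
  moreover have "plain w p" if p: "p \<in> half_edges m" for p
  proof -
    obtain i b where ib: "p = (i, b)" "i < m" using p by (cases p) (auto simp: half_edges_iff)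
    have ne: "w (i, b) \<noteq> w (i, \<not> b)" using * ib by (cases b) auto
    have "edge_at w i \<notin> F" using noF ib by auto
    then have "\<not> forb (w p) (w (opposite p))"
      using ne by (auto simp: ib forb_def opposite_def edge_at_eq[of w i b])
    moreover have "q = p" if q: "q \<in> half_edges m" "par w p q" for q
    proof -
      obtain j c where jc: "q = (j, c)" "j < m" using q by (cases q) (auto simp: half_edges_iff)
      have eq: "w (i, b) = w (j, c)" "w (i, \<not> b) = w (j, \<not> c)"
        using q(2) by (auto simp: par_def opposite_def ib jc)
      then have "edge_at w i = edge_at w j" unfolding edge_at_eq[of w i b] edge_at_eq[of w j c] by simp
      then have "i = j" using * ib jc by (auto simp: inj_on_def)
      then show ?thesis using eq ne ib jc by (cases b; cases c) auto
    qed
    ultimately show ?thesis by (simp add: plain_def)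
  qed
  ultimately show "w \<in> level 0" by (simp add: level_0)
qed

text \<open>
  A simple word amounts to a graph, an enumeration of its \<open>m\<close> edges, and a flag for each edge that tells whether the
  smaller end comes first.
\<close>

lemma card_level_0: "card (level 0) = card (disjoint_regular n d F) * (fact m * 2 ^ m)"
proof -
  let ?G = "disjoint_regular n d F"
  define T where "T = (SIGMA E:?G. {e \<in> {..<m} \<rightarrow>\<^sub>E E. inj_on e {..<m}} \<times> ({..<m} \<rightarrow>\<^sub>E (UNIV :: bool set)))"
  let ?f = "\<lambda>w. (edge_at w ` {..<m}, restrict (edge_at w) {..<m}, restrict (\<lambda>i. w (i, False) < w (i, True)) {..<m})"
  let ?g = "\<lambda>(E :: nat set set, e, up). restrict (\<lambda>(i, b). if b = up i then Max (e i) else Min (e i)) (half_edges m)"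
  have finG: "finite ?G"
    by (rule finite_subset[of _ "Pow (complete_edges n)"]) (use finite_complete_edges in \<open>auto simp: disjoint_regular_def regular_spanning_def\<close>)
  have cE: "card E = m" "finite E" if "E \<in> ?G" for E
    using that card_regular_spanning[of n d E] m by (auto simp: disjoint_regular_def)
  have onto: "e ` {..<m} = E" if "E \<in> ?G" "e \<in> {..<m} \<rightarrow>\<^sub>E E" "inj_on e {..<m}" for E e
    using that cE[OF that(1)] by (intro card_subset_eq) (auto simp: card_image)
  have two: "Min a < Max a" "{Min a, Max a} = a" "a \<subseteq> {..<n}" if "E \<in> ?G" "a \<in> E" for E a
  proof -
    have a: "a \<subseteq> {..<n}" "card a = 2"
      using that by (auto simp: disjoint_regular_def regular_spanning_def complete_edges_def)
    then obtain u v where "a = {u, v}" "u \<noteq> v" by (auto simp: card_2_iff)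
    then show "Min a < Max a" "{Min a, Max a} = a" by (cases "u < v"; auto simp: min_def max_def)+
    show "a \<subseteq> {..<n}" by (rule a(1))
  qed
  have g_at: "?g (E, e, up) (i, b) = (if b = up i then Max (e i) else Min (e i))" if "i < m" for E e up i b
    using that by (simp add: half_edges_iff)
  have g_edge: "edge_at (?g (E, e, up)) i = e i" "?g (E, e, up) (i, False) \<noteq> ?g (E, e, up) (i, True)"
      "(?g (E, e, up) (i, False) < ?g (E, e, up) (i, True)) = up i"
    if "i < m" "E \<in> ?G" "e \<in> {..<m} \<rightarrow>\<^sub>E E" for E e up i
  proof -
    have "e i \<in> E" using that by auto
    note t = two[OF that(2) this]
    show "edge_at (?g (E, e, up)) i = e i" "?g (E, e, up) (i, False) \<noteq> ?g (E, e, up) (i, True)"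
      "(?g (E, e, up) (i, False) < ?g (E, e, up) (i, True)) = up i"
      unfolding edge_at_def g_at[OF that(1)] using t by (auto simp: insert_commute)
  qed
  have "bij_betw ?f (level 0) T"
  proof (rule bij_betw_byWitness[where f' = ?g])
    show "\<forall>w\<in>level 0. ?g (?f w) = w"
    proof
      fix w assume w: "w \<in> level 0"
      show "?g (?f w) = w"
      proof
        fix p :: "nat \<times> bool"
        obtain i b where p: "p = (i, b)" by (cases p)
        show "?g (?f w) p = w p"
        proof (cases "i < m")
          case True
          have "w (i, False) \<noteq> w (i, True)" using w True by (simp add: level_0_edges)
          then show ?thesis
            unfolding p g_at[OF True] using True
            by (cases b; cases "w (i, False) < w (i, True)") (auto simp: edge_at_def max_def min_def)
        next
          case False
          then show ?thesis using w by (simp add: level_0_edges p half_edges_iff PiE_iff extensional_def)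
        qed
      qed
    qed
    show "\<forall>t\<in>T. ?f (?g t) = t"
    proof
      fix t assume "t \<in> T"
      then obtain E e up where t: "t = (E, e, up)" and E: "E \<in> ?G" and e: "e \<in> {..<m} \<rightarrow>\<^sub>E E" "inj_on e {..<m}"
        and up: "up \<in> {..<m} \<rightarrow>\<^sub>E (UNIV :: bool set)" by (auto simp: T_def)
      have "edge_at (?g t) ` {..<m} = e ` {..<m}"
        unfolding t using g_edge(1)[OF _ E e(1)] by (intro image_cong) auto
      then have 1: "edge_at (?g t) ` {..<m} = E" using onto[OF E e] by simp
      have 2: "restrict (edge_at (?g t)) {..<m} = e"
        unfolding t using g_edge(1)[OF _ E e(1)] e(1) by (intro ext) (auto simp: restrict_def PiE_iff extensional_def)
      have 3: "restrict (\<lambda>i. ?g t (i, False) < ?g t (i, True)) {..<m} = up"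
        unfolding t using g_edge(3)[OF _ E e(1)] up
        by (intro ext) (simp only: restrict_def PiE_iff extensional_def, auto)
      show "?f (?g t) = t" using 1 2 3 unfolding t by simp
    qed
    show "?f ` level 0 \<subseteq> T"
    proof
      fix t assume "t \<in> ?f ` level 0"
      then obtain w where w: "w \<in> level 0" and t: "t = ?f w" by blast
      show "t \<in> T" unfolding t T_def using w[unfolded level_0_edges] by (auto simp: inj_on_restrict_eq)
    qed
    show "?g ` T \<subseteq> level 0"
    proof
      fix w assume "w \<in> ?g ` T"
      then obtain E e up where w: "w = ?g (E, e, up)" and E: "E \<in> ?G" and e: "e \<in> {..<m} \<rightarrow>\<^sub>E E" "inj_on e {..<m}"
        by (auto simp: T_def)
      have im: "edge_at w ` {..<m} = E"
      proof -
        have "edge_at w ` {..<m} = e ` {..<m}" unfolding w using g_edge(1)[OF _ E e(1)] by (intro image_cong) auto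
        then show ?thesis using onto[OF E e] by simp
      qed
      have inj: "inj_on (edge_at w) {..<m}"
        using e(2) g_edge(1)[OF _ E e(1), of _ up] unfolding w by (simp add: inj_on_def)
      have rng: "w (i, b) < n" if "i < m" for i b
      proof -
        have "edge_at w i \<in> E" using im that by blast
        then have "edge_at w i \<subseteq> {..<n}" using two(3)[OF E] by blast
        then show ?thesis by (cases b) (auto simp: edge_at_def)
      qed
      have PiE: "w \<in> half_edges m \<rightarrow>\<^sub>E {..<n}"
      proof (rule PiE_I)
        show "w p \<in> {..<n}" if "p \<in> half_edges m" for p using that rng by (cases p) (auto simp: half_edges_iff)
        show "w p = undefined" if "p \<notin> half_edges m" for p using that by (simp add: w)
      qed
      have "w (i, False) \<noteq> w (i, True)" if "i < m" for i
        unfolding w by (rule g_edge(2)[OF that E e(1)])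
      then show "w \<in> level 0" using PiE inj E by (simp add: level_0_edges im)
    qed
  qed
  then have "card (level 0) = card T" by (rule bij_betw_same_card)
  also have "\<dots> = (\<Sum>E\<in>?G. fact m * 2 ^ m)"
    unfolding T_def
  proof (subst card_SigmaI[OF finG])
    show "\<forall>E\<in>?G. finite ({e \<in> {..<m} \<rightarrow>\<^sub>E E. inj_on e {..<m}} \<times> ({..<m} \<rightarrow>\<^sub>E (UNIV :: bool set)))"
    proof
      fix E assume "E \<in> ?G"
      then have "finite ({..<m} \<rightarrow>\<^sub>E E)" using cE by (intro finite_PiE) auto
      then have "finite {e \<in> {..<m} \<rightarrow>\<^sub>E E. inj_on e {..<m}}" by (rule rev_finite_subset) auto
      then show "finite ({e \<in> {..<m} \<rightarrow>\<^sub>E E. inj_on e {..<m}} \<times> ({..<m} \<rightarrow>\<^sub>E (UNIV :: bool set)))"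
        by (intro finite_cartesian_product finite_PiE) auto
    qed
    show "(\<Sum>E\<in>?G. card ({e \<in> {..<m} \<rightarrow>\<^sub>E E. inj_on e {..<m}} \<times> ({..<m} \<rightarrow>\<^sub>E (UNIV :: bool set)))) = (\<Sum>E\<in>?G. fact m * 2 ^ m)"
    proof (intro sum.cong refl)
      fix E assume "E \<in> ?G"
      then show "card ({e \<in> {..<m} \<rightarrow>\<^sub>E E. inj_on e {..<m}} \<times> ({..<m} \<rightarrow>\<^sub>E (UNIV :: bool set))) = fact m * 2 ^ m"
        using card_injections_same[OF cE(2) cE(1)] by (simp add: card_cartesian_product card_PiE)
    qed
  qed
  finally show ?thesis by simp
qed

text \<open>
  Here \<open>D\<^sup>2 / M = d (d + x)\<^sup>2 / n\<close>. Passing to logarithms turns the product over the factors into a sum.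
\<close>

lemma ln_card_disjoint_regular:
  assumes small: "100000 * (real d * (real d + real x)\<^sup>2) \<le> real n"
  shows "disjoint_regular n d F \<noteq> {}"
    and "\<bar>ln (real (card (disjoint_regular n d F))) -
      (ln (fact (n * d)) - ln (fact m) - real m * ln 2 - real n * ln (fact d)
        - ((real d ^ 2 - 1) / 4 + real x * real d / 2))\<bar>
    \<le> 40000 * (real d * (real d + real x)\<^sup>2 / real n)"
proof -
  let ?N = "real (card (disjoint_regular n d F))"
  define t where "t = real d * (real d + real x)\<^sup>2 / real n"
  have d0: "0 < real d" using d1 by simp
  have "0 < real d * (real d + real x)\<^sup>2" using d0 by (simp add: add_pos_nonneg)
  then have n0: "0 < real n" using small by linarith
  have t: "0 \<le> t" "t \<le> 1 / 100000" using small n0 by (auto simp: t_def field_simps)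
  have cP: "card (half_edges m) = n * d" using m by (simp add: card_half_edges)
  have Deq: "(real D)\<^sup>2 = real d * (real d * (real d + real x)\<^sup>2)"
    by (simp add: D_def power2_eq_square)
  have tD: "(real D)\<^sup>2 / real (card (half_edges m)) = t"
    unfolding Deq cP t_def using d0 n0 by simp
  have W: "real (card words) * fact d ^ n = fact (n * d)"
    using arg_cong[OF card_words, of real] cP by simp
  have W0: "0 < real (card words)"
  proof (rule ccontr)
    assume "\<not> ?thesis"
    then have "real (card words) = 0" by simp
    then show False using W by (simp del: of_nat_eq_0_iff)
  qed
  have "100000 * (real D)\<^sup>2 \<le> real (card (half_edges m))"
    unfolding Deq cP using mult_left_mono[OF small, of "real d"] d0 by (simp add: algebra_simps)
  from card_simple_words[OF this, unfolded tD]
  have "\<bar>?N * (fact m * 2 ^ m) * exp mean - real (card words)\<bar> \<le> 20000 * t * real (card words)"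
    by (simp add: card_level_0)
  then have "\<bar>?N * (fact m * 2 ^ m) * exp mean / real (card words) - 1\<bar> \<le> 20000 * t"
    using W0 by (simp add: abs_le_iff field_simps)
  moreover define r where "r = ?N * (fact m * 2 ^ m) * exp mean / real (card words)"
  ultimately have r: "\<bar>r - 1\<bar> \<le> 20000 * t" by simp
  then have r_pos: "1 / 2 \<le> r" using t by linarith
  then have N0: "0 < ?N" unfolding r_def using W0 by (auto simp: zero_le_mult_iff zero_less_mult_iff intro: ccontr)
  then show "disjoint_regular n d F \<noteq> {}" by auto
  have "\<bar>ln r\<bar> \<le> 40000 * t"
  proof -
    have "\<bar>ln (1 + (r - 1)) - (r - 1)\<bar> \<le> 2 * (r - 1)\<^sup>2"
      using r t by (intro abs_ln_one_plus_x_minus_x_bound) linarith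
    moreover have "2 * (r - 1)\<^sup>2 \<le> 1 * \<bar>r - 1\<bar>"
    proof -
      have "2 * (r - 1)\<^sup>2 = (2 * \<bar>r - 1\<bar>) * \<bar>r - 1\<bar>" by (simp add: power2_eq_square)
      also have "\<dots> \<le> 1 * \<bar>r - 1\<bar>" using r t by (intro mult_right_mono) auto
      finally show ?thesis .
    qed
    ultimately show ?thesis using r by simp
  qed
  moreover have "ln r = ln ?N - (ln (fact (n * d)) - ln (fact m) - real m * ln 2 - real n * ln (fact d) - mean)"
  proof -
    have lW: "ln (real (card words)) = ln (fact (n * d)) - real n * ln (fact d)"
      unfolding W[symmetric] using W0 by (simp add: ln_mult ln_realpow)
    show ?thesis unfolding r_def using N0 W0 by (simp add: ln_mult ln_div ln_realpow lW)
  qed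
  ultimately show "\<bar>ln ?N - (ln (fact (n * d)) - ln (fact m) - real m * ln 2 - real n * ln (fact d)
        - ((real d ^ 2 - 1) / 4 + real x * real d / 2))\<bar> \<le> 40000 * (real d * (real d + real x)\<^sup>2 / real n)"
    by (simp add: mean_def t_def)
qed

end

section \<open>Stirling's formula and the complementary degree\<close>

text \<open>
  The derivative of the remainder is \<open>z\<^sup>2 / (1 + z)\<close>, which lies between \<open>0\<close> and \<open>2 z\<^sup>2\<close>.
\<close>

lemma ln_third_order:
  fixes y :: real
  assumes "- 1 / 2 \<le> y"
  shows "\<bar>ln (1 + y) - y + y\<^sup>2 / 2\<bar> \<le> 2 / 3 * \<bar>y\<bar> ^ 3"
    and "0 \<le> y \<Longrightarrow> 0 \<le> ln (1 + y) - y + y\<^sup>2 / 2"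
proof -
  define g where "g = (\<lambda>y::real. ln (1 + y) - y + y\<^sup>2 / 2)"
  define h where "h = (\<lambda>y. 2 / 3 * y ^ 3 - g y)"
  have dg: "(g has_real_derivative z\<^sup>2 / (1 + z)) (at z)" if "- 1 / 2 \<le> z" for z
    unfolding g_def using that by (auto intro!: derivative_eq_intros simp: field_simps power2_eq_square)
  have dh: "(h has_real_derivative 2 * z\<^sup>2 - z\<^sup>2 / (1 + z)) (at z)" if "- 1 / 2 \<le> z" for z
    unfolding h_def using that dg[OF that] by (auto intro!: derivative_eq_intros)
  have pos: "0 \<le> z\<^sup>2 / (1 + z)" "0 \<le> 2 * z\<^sup>2 - z\<^sup>2 / (1 + z)" if "- 1 / 2 \<le> z" for z :: real
  proof -
    show "0 \<le> z\<^sup>2 / (1 + z)" using that by simp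
    have "z\<^sup>2 / (1 + z) \<le> z\<^sup>2 / (1 / 2)" using that by (intro divide_left_mono) auto
    then show "0 \<le> 2 * z\<^sup>2 - z\<^sup>2 / (1 + z)" by simp
  qed
  have mono: "g a \<le> g b" "h a \<le> h b" if "- 1 / 2 \<le> a" "a \<le> b" for a b
  proof -
    show "g a \<le> g b"
      by (rule DERIV_nonneg_imp_nondecreasing[OF that(2)]) (use dg pos(1) that in \<open>meson order_trans\<close>)
    show "h a \<le> h b"
      by (rule DERIV_nonneg_imp_nondecreasing[OF that(2)]) (use dh pos(2) that in \<open>meson order_trans\<close>)
  qed
  have zero: "g 0 = 0" "h 0 = 0" by (simp_all add: g_def h_def)
  have "0 \<le> g y \<and> g y \<le> 2 / 3 * y ^ 3" if "0 \<le> y"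
    using mono[of 0 y] that zero by (simp add: h_def)
  moreover have "2 / 3 * y ^ 3 \<le> g y \<and> g y \<le> 0" if "y \<le> 0"
    using mono[of y 0] that zero assms by (simp add: h_def)
  ultimately show "0 \<le> y \<Longrightarrow> 0 \<le> ln (1 + y) - y + y\<^sup>2 / 2" "\<bar>ln (1 + y) - y + y\<^sup>2 / 2\<bar> \<le> 2 / 3 * \<bar>y\<bar> ^ 3"
    by (cases "0 \<le> y"; force simp: g_def abs_if power3_eq_cube)+
qed

definition stirling_error :: "nat \<Rightarrow> real" where
  "stirling_error j = ln (fact j) - (real j + 1 / 2) * ln (real j) + real j"

lemma stirling_error_step:
  assumes "1 \<le> j"
  shows "\<bar>stirling_error (Suc j) - stirling_error j\<bar> \<le> 1 / (real j)\<^sup>2"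
proof -
  define y where "y = 1 / real j"
  have y: "0 < y" "y \<le> 1" using assms by (auto simp: y_def)
  define g where "g = ln (1 + y) - y + y\<^sup>2 / 2"
  have g: "0 \<le> g" "g \<le> 2 / 3 * y ^ 3"
    using ln_third_order[of y] y by (auto simp: g_def)
  have j: "real j = 1 / y" by (simp add: y_def)
  have l: "ln (real (Suc j)) = ln (real j) + ln (1 + y)"
  proof -
    have "real (Suc j) = real j * (1 + y)" using assms by (simp add: y_def field_simps)
    then show ?thesis using assms y by (simp add: ln_mult)
  qed
  have "ln (fact (Suc j) :: real) = ln (real (Suc j)) + ln (fact j)"
    by (simp add: ln_mult del: of_nat_Suc)
  then have "stirling_error j - stirling_error (Suc j) = (real j + 1 / 2) * ln (1 + y) - 1"
    unfolding stirling_error_def l by (simp add: algebra_simps l)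
  also have "ln (1 + y) = y - y\<^sup>2 / 2 + g" by (simp add: g_def)
  also have "(real j + 1 / 2) * (y - y\<^sup>2 / 2 + g) - 1 = - (y\<^sup>2) / 4 + (g / y + g / 2)"
    unfolding j using y by (simp add: field_simps power2_eq_square)
  finally have eq: "stirling_error j - stirling_error (Suc j) = - (y\<^sup>2) / 4 + (g / y + g / 2)" .
  have "g / y \<le> 2 / 3 * y\<^sup>2" using g y by (simp add: field_simps eval_nat_numeral)
  moreover have "g / 2 \<le> 1 / 3 * y\<^sup>2"
  proof -
    have "y ^ 3 \<le> y\<^sup>2" using y by (intro power_decreasing) auto
    then show ?thesis using g by linarith
  qed
  moreover have "0 \<le> g / y" using g y by simp
  ultimately have "\<bar>- (y\<^sup>2) / 4 + (g / y + g / 2)\<bar> \<le> y\<^sup>2"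
    using g(1) zero_le_power2[of y] unfolding abs_le_iff by linarith
  then show ?thesis unfolding eq[symmetric] by (simp add: y_def power_divide abs_minus_commute)
qed

text \<open>
  In the quotient \<open>(2 m)! / m!\<close> the constant of Stirling's formula cancels, so only the increments of the
  error matter.
\<close>

lemma stirling_error_double:
  assumes "1 \<le> m"
  shows "\<bar>stirling_error (2 * m) - stirling_error m\<bar> \<le> 1 / real m"
proof -
  have "stirling_error (2 * m) - stirling_error m = (\<Sum>j=m..<2 * m. stirling_error (Suc j) - stirling_error j)"
    by (rule sum_Suc_diff'[symmetric]) simp
  also have "\<bar>\<dots>\<bar> \<le> (\<Sum>j=m..<2 * m. \<bar>stirling_error (Suc j) - stirling_error j\<bar>)" by (rule sum_abs)
  also have "\<dots> \<le> (\<Sum>j=m..<2 * m. 1 / (real m)\<^sup>2)"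
  proof (rule sum_mono)
    fix j assume j: "j \<in> {m..<2 * m}"
    have "1 / (real j)\<^sup>2 \<le> 1 / (real m)\<^sup>2"
      using j assms by (intro divide_left_mono power_mono mult_pos_pos) auto
    then show "\<bar>stirling_error (Suc j) - stirling_error j\<bar> \<le> 1 / (real m)\<^sup>2"
      using stirling_error_step[of j] j assms by (meson atLeastLessThan_iff order_trans)
  qed
  also have "\<dots> = 1 / real m" using assms by (simp add: power2_eq_square field_simps)
  finally show ?thesis .
qed

text \<open>
  The number of perfect matchings of \<open>2 m\<close> points is \<open>(2 m)! / (m! 2\<^sup>m)\<close>.
\<close>

lemma ln_pairings:
  assumes "1 \<le> m"
  shows "\<bar>ln (fact (2 * m)) - ln (fact m) - real m * ln 2 -
    (real m * (ln (2 * real m) - 1) + ln 2 / 2)\<bar> \<le> 1 / real m"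
proof -
  have "ln (fact (2 * m)) - ln (fact m) - real m * ln 2 - (real m * (ln (2 * real m) - 1) + ln 2 / 2)
      = stirling_error (2 * m) - stirling_error m"
    using assms by (simp add: stirling_error_def ln_mult algebra_simps add_divide_distrib)
  then show ?thesis using stirling_error_double[OF assms] by simp
qed

text \<open>
  The left-hand side collects the terms of the logarithm of the estimate that come from the degree \<open>n - 1 - s\<close>
  of the complement and from the powers of \<open>n - 1\<close> and \<open>n\<close> belonging to the other factors. The three main terms expand to
  \<open>- n s / 2 + s\<^sup>2 / 4\<close>, \<open>n s ln n - s (s + 1) / 2\<close> and \<open>n s / 2 - n s ln n + s / 2\<close>, whose sum
  is \<open>- s\<^sup>2 / 4\<close>.
\<close>

lemma complement_asymptotics:
  assumes s: "1 \<le> s" "4 * s \<le> n"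
  shows "\<bar>real n * (real n - 1 - real s) / 2 * ln ((real n - 1 - real s) / (real n - 1))
      + real n * (\<Sum>j=1..s. ln (real n - real j))
      + real n * real s / 2 * (1 - ln (real n - 1) - ln (real n)) + (real s)\<^sup>2 / 4\<bar>
    \<le> 7 * (real s ^ 3 / real n)"
proof -
  define N where "N = real n - 1"
  define \<sigma> where "\<sigma> = real s"
  have \<sigma>: "1 \<le> \<sigma>" "4 * \<sigma> \<le> real n" using s by (auto simp: \<sigma>_def)
  have n: "4 \<le> real n" using \<sigma> by linarith
  have N: "real n / 2 \<le> N" "0 < N" using n by (auto simp: N_def)
  define e1 where "e1 = (\<Sum>j=1..s. ln (1 - real j / real n) + real j / real n)"
  have sum1: "(\<Sum>j=1..s. ln (real n - real j)) = \<sigma> * ln (real n) - \<sigma> * (\<sigma> + 1) / (2 * real n) + e1"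
  proof -
    have "ln (real n - real j) = ln (real n) + (ln (1 - real j / real n) + real j / real n) - real j / real n"
      if "j \<in> {1..s}" for j
    proof -
      have j: "real j < real n" using that s n by auto
      have "real n - real j = real n * (1 - real j / real n)" using n by (simp add: field_simps)
      moreover have "0 < 1 - real j / real n" using j n by simp
      ultimately show ?thesis using n by (simp add: ln_mult)
    qed
    then have "(\<Sum>j=1..s. ln (real n - real j)) =
        (\<Sum>j=1..s. ln (real n) + (ln (1 - real j / real n) + real j / real n) - real j / real n)"
      by (rule sum.cong[OF refl])
    also have "\<dots> = \<sigma> * ln (real n) + e1 - (\<Sum>j=1..s. real j) / real n"
      by (simp add: sum.distrib sum_subtractf e1_def \<sigma>_def sum_divide_distrib)
    also have "(\<Sum>j=1..s. real j) = \<sigma> * (\<sigma> + 1) / 2"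
      using double_gauss_sum_from_Suc_0[of s, where 'a = real] by (simp add: \<sigma>_def field_simps)
    finally show ?thesis by simp
  qed
  have e1: "\<bar>e1\<bar> \<le> 2 * \<sigma> ^ 3 / (real n)\<^sup>2"
  proof -
    have "\<bar>e1\<bar> \<le> (\<Sum>j=1..s. \<bar>ln (1 - real j / real n) + real j / real n\<bar>)"
      unfolding e1_def by (rule sum_abs)
    also have "\<dots> \<le> (\<Sum>j=1..s. 2 * (\<sigma> / real n)\<^sup>2)"
    proof (rule sum_mono)
      fix j assume j: "j \<in> {1..s}"
      have "\<bar>- (real j / real n)\<bar> \<le> 1 / 2" using j s n by (simp add: field_simps)
      then have "\<bar>ln (1 + - (real j / real n)) - - (real j / real n)\<bar> \<le> 2 * (- (real j / real n))\<^sup>2"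
        by (rule abs_ln_one_plus_x_minus_x_bound)
      also have "\<dots> \<le> 2 * (\<sigma> / real n)\<^sup>2"
        using j n by (auto simp: \<sigma>_def intro!: power_mono divide_right_mono)
      finally show "\<bar>ln (1 - real j / real n) + real j / real n\<bar> \<le> 2 * (\<sigma> / real n)\<^sup>2" by simp
    qed
    also have "\<dots> = 2 * \<sigma> ^ 3 / (real n)\<^sup>2"
      by (simp add: \<sigma>_def power_divide eval_nat_numeral)
    finally show ?thesis .
  qed
  define e2 where "e2 = ln (1 - 1 / real n) + 1 / real n"
  have lnN: "ln N = ln (real n) - 1 / real n + e2"
  proof -
    have "N = real n * (1 - 1 / real n)" using n by (simp add: N_def field_simps)
    moreover have "0 < 1 - 1 / real n" using n by simp
    ultimately show ?thesis using n by (simp add: ln_mult e2_def)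
  qed
  have e2: "\<bar>e2\<bar> \<le> 2 / (real n)\<^sup>2"
  proof -
    have "\<bar>ln (1 + - (1 / real n)) - - (1 / real n)\<bar> \<le> 2 * (- (1 / real n))\<^sup>2"
      by (rule abs_ln_one_plus_x_minus_x_bound) (use n in \<open>simp add: field_simps\<close>)
    then show ?thesis by (simp add: e2_def power_divide)
  qed
  define y where "y = \<sigma> / N"
  have y: "0 < y" "y \<le> 1 / 2" using \<sigma> N by (auto simp: y_def field_simps)
  define e3 where "e3 = ln (1 - y) + y + y\<^sup>2 / 2"
  have e3: "\<bar>e3\<bar> \<le> 2 / 3 * y ^ 3" using ln_third_order(1)[of "- y"] y by (simp add: e3_def)
  have frac: "(real n - 1 - real s) / (real n - 1) = 1 - y"
    using N by (simp add: y_def N_def \<sigma>_def field_simps)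
  have first: "real n * (real n - 1 - real s) / 2 * ln ((real n - 1 - real s) / (real n - 1))
      = - (real n * \<sigma> / 2) + real n * \<sigma>\<^sup>2 / (4 * N) + real n * N / 2 * (y ^ 3 / 2 + (1 - y) * e3)"
  proof -
    have a: "real n - 1 - real s = N * (1 - y)" using N by (simp add: y_def N_def \<sigma>_def field_simps)
    have "real n * (N * (1 - y)) / 2 * (- y - y\<^sup>2 / 2 + e3)
        = - (real n * (N * y) / 2) + real n * (N * y) * y / 4 + real n * N / 2 * (y ^ 3 / 2 + (1 - y) * e3)"
      by (simp add: field_simps eval_nat_numeral)
    also have "N * y = \<sigma>" using N by (simp add: y_def)
    also have "real n * \<sigma> * y / 4 = real n * \<sigma>\<^sup>2 / (4 * N)" by (simp add: y_def power2_eq_square)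
    finally show ?thesis unfolding frac unfolding a by (simp add: e3_def)
  qed
  have second: "real n * \<sigma>\<^sup>2 / (4 * N) = \<sigma>\<^sup>2 / 4 + \<sigma>\<^sup>2 / (4 * N)"
  proof -
    have "real n = N + 1" by (simp add: N_def)
    then show ?thesis using N(2) by (simp add: field_simps)
  qed
  let ?E = "\<sigma> ^ 3 / real n"
  have sq: "\<sigma> \<le> \<sigma> ^ 3" "\<sigma>\<^sup>2 \<le> \<sigma> ^ 3"
    using \<sigma> power_increasing[of 1 3 \<sigma>] power_increasing[of 2 3 \<sigma>] by auto
  have b1: "\<bar>real n * e1\<bar> \<le> 2 * ?E"
  proof -
    have "real n * \<bar>e1\<bar> \<le> real n * (2 * \<sigma> ^ 3 / (real n)\<^sup>2)" using e1 by (rule mult_left_mono) simp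
    then show ?thesis using n by (simp add: abs_mult power2_eq_square)
  qed
  have b2: "\<bar>real n * \<sigma> / 2 * e2\<bar> \<le> ?E"
  proof -
    have "real n * \<sigma> / 2 * \<bar>e2\<bar> \<le> real n * \<sigma> / 2 * (2 / (real n)\<^sup>2)" using e2 \<sigma> by (intro mult_left_mono) auto
    also have "\<dots> = \<sigma> / real n" using n by (simp add: power2_eq_square)
    also have "\<dots> \<le> ?E" using sq by (intro divide_right_mono) auto
    finally show ?thesis using \<sigma> by (simp add: abs_mult)
  qed
  have b3: "\<bar>\<sigma>\<^sup>2 / (4 * N)\<bar> \<le> ?E / 2"
  proof -
    have "\<sigma>\<^sup>2 / (4 * N) \<le> \<sigma>\<^sup>2 / (4 * (real n / 2))" using N n by (intro divide_left_mono) auto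
    also have "\<dots> \<le> \<sigma> ^ 3 / (4 * (real n / 2))" using sq n by (intro divide_right_mono) auto
    finally show ?thesis using N(2) by simp
  qed
  have b4: "\<bar>real n * N / 2 * (y ^ 3 / 2 + (1 - y) * e3)\<bar> \<le> 7 / 3 * ?E"
  proof -
    have "\<bar>y ^ 3 / 2 + (1 - y) * e3\<bar> \<le> y ^ 3 / 2 + 1 * (2 / 3 * y ^ 3)"
    proof -
      have "\<bar>(1 - y) * e3\<bar> \<le> 1 * (2 / 3 * y ^ 3)" unfolding abs_mult using e3 y by (intro mult_mono) auto
      then show ?thesis using abs_triangle_ineq[of "y ^ 3 / 2" "(1 - y) * e3"] y by simp
    qed
    then have "real n * N / 2 * \<bar>y ^ 3 / 2 + (1 - y) * e3\<bar> \<le> real n * N / 2 * (7 / 6 * y ^ 3)"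
      using N by (intro mult_left_mono) auto
    also have "\<dots> = 7 / 12 * (real n * \<sigma> ^ 3) / N\<^sup>2"
      using N by (simp add: y_def field_simps eval_nat_numeral)
    also have "\<dots> \<le> 7 / 12 * (real n * \<sigma> ^ 3) / (real n / 2)\<^sup>2"
      using N n \<sigma> by (intro divide_left_mono power_mono mult_nonneg_nonneg mult_pos_pos) auto
    also have "\<dots> = 7 / 3 * ?E" using n by (simp add: field_simps power2_eq_square)
    finally show ?thesis using N by (simp add: abs_mult)
  qed
  have "real n * (real n - 1 - real s) / 2 * ln ((real n - 1 - real s) / (real n - 1))
      + real n * (\<Sum>j=1..s. ln (real n - real j))
      + real n * real s / 2 * (1 - ln (real n - 1) - ln (real n)) + (real s)\<^sup>2 / 4
    = real n * e1 - real n * \<sigma> / 2 * e2 + \<sigma>\<^sup>2 / (4 * N) + real n * N / 2 * (y ^ 3 / 2 + (1 - y) * e3)"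
  proof -
    have "real n * (\<Sum>j=1..s. ln (real n - real j))
      = real n * \<sigma> * ln (real n) - (\<sigma>\<^sup>2 + \<sigma>) / 2 + real n * e1"
      unfolding sum1 using n by (simp add: field_simps power2_eq_square)
    moreover have "real n * real s / 2 * (1 - ln (real n - 1) - ln (real n))
      = real n * \<sigma> / 2 - real n * \<sigma> * ln (real n) + \<sigma> / 2 - real n * \<sigma> / 2 * e2"
      unfolding N_def[symmetric] lnN \<sigma>_def[symmetric] using n by (simp add: field_simps)
    moreover have "(\<sigma>\<^sup>2 + \<sigma>) / 2 = \<sigma>\<^sup>2 / 2 + \<sigma> / 2" by (rule add_divide_distrib)
    ultimately show ?thesis using first second unfolding \<sigma>_def[symmetric] by linarith
  qed
  also have "\<bar>\<dots>\<bar> \<le> 7 * ?E"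
  proof -
    have "\<bar>a - b + c + e\<bar> \<le> 7 * E" if "\<bar>a\<bar> \<le> 2 * E" "\<bar>b\<bar> \<le> E" "\<bar>c\<bar> \<le> E / 2" "\<bar>e\<bar> \<le> 7 / 3 * E" "0 \<le> E"
      for a b c e E :: real using that by linarith
    from this[OF b1 b2 b3 b4] show ?thesis using \<sigma> n by simp
  qed
  finally show ?thesis by (simp add: \<sigma>_def)
qed

section \<open>Sequences of factors\<close>

text \<open>
  The main term for the logarithm of the number of \<open>d\<close>-regular graphs that avoid an \<open>x\<close>-regular graph.
\<close>

definition factor_log :: "nat \<Rightarrow> nat \<Rightarrow> nat \<Rightarrow> real" where
  "factor_log n d x = real n * real d / 2 * (ln (real n * real d) - 1) + ln 2 / 2
     - real n * ln (fact d) - ((real d ^ 2 - 1) / 4 + real x * real d / 2)"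

lemma (in forbidden_graph) ln_card_disjoint_regular_stirling:
  assumes small: "100000 * (real d * (real d + real x)\<^sup>2) \<le> real n"
  shows "\<bar>ln (real (card (disjoint_regular n d F))) - factor_log n d x\<bar>
    \<le> 40002 * (real d * (real d + real x)\<^sup>2 / real n)"
proof -
  have d0: "0 < real d" using d1 by simp
  have "0 < real d * (real d + real x)\<^sup>2" using d0 by (simp add: add_pos_nonneg)
  then have n0: "0 < real n" using small by linarith
  have "0 < n * d" using n0 d1 by simp
  then have m1: "1 \<le> m" using m by linarith
  have rm: "2 * real m = real n * real d" using arg_cong[OF m, of real] by simp
  have "\<bar>ln (fact (n * d)) - ln (fact m) - real m * ln 2 - (real m * (ln (2 * real m) - 1) + ln 2 / 2)\<bar> \<le> 1 / real m"
    using ln_pairings[OF m1] unfolding m .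
  moreover have "real m * (ln (2 * real m) - 1) = real n * real d / 2 * (ln (real n * real d) - 1)"
    unfolding rm using rm by (simp add: field_simps)
  moreover have "1 / real m \<le> 2 * (real d * (real d + real x)\<^sup>2 / real n)"
  proof -
    have "1 / real m = 2 / (real n * real d)" using rm m1 n0 d0 by (simp add: field_simps)
    also have "\<dots> \<le> 2 / (real n * 1)" using n0 d1 by (intro divide_left_mono mult_left_mono) auto
    also have "\<dots> \<le> 2 * (real d * (real d + real x)\<^sup>2) / real n"
    proof -
      have "1 * 1 \<le> real d * (real d + real x)\<^sup>2"
        using d1 by (intro mult_mono one_le_power) auto
      then show ?thesis using n0 by (simp add: divide_right_mono)
    qed
    finally show ?thesis by simp
  qed
  moreover note ln_card_disjoint_regular(2)[OF small]
  ultimately show ?thesis unfolding factor_log_def by linarith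
qed

text \<open>
  The graphs \<open>D\<^sub>1, \<dots>, D\<^sub>t\<close> of a factorization. The graph with index 0 is left out since it is determined by
  the others.
\<close>

definition partial_factors :: "nat \<Rightarrow> (nat \<Rightarrow> nat) \<Rightarrow> nat \<Rightarrow> (nat \<Rightarrow> nat set set) set" where
  "partial_factors n d t = {D \<in> extensional {1..t}. (\<forall>i\<in>{1..t}. regular_spanning n (d i) (D i)) \<and>
     (\<forall>i\<in>{1..t}. \<forall>j\<in>{1..t}. i \<noteq> j \<longrightarrow> D i \<inter> D j = {})}"

lemma regular_spanning_Union:
  assumes D: "D \<in> partial_factors n d t"
  shows "regular_spanning n (\<Sum>i=1..t. d i) (\<Union>i\<in>{1..t}. D i)"
proof -
  have reg: "\<And>i. i \<in> {1..t} \<Longrightarrow> regular_spanning n (d i) (D i)"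
    and disj: "\<And>i j. i \<in> {1..t} \<Longrightarrow> j \<in> {1..t} \<Longrightarrow> i \<noteq> j \<Longrightarrow> D i \<inter> D j = {}"
    using D by (auto simp: partial_factors_def)
  show ?thesis
    unfolding regular_spanning_def
  proof (intro conjI allI impI)
    show "(\<Union>i\<in>{1..t}. D i) \<subseteq> complete_edges n" using reg unfolding regular_spanning_def by blast
    fix v assume v: "v < n"
    have "{e \<in> (\<Union>i\<in>{1..t}. D i). v \<in> e} = (\<Union>i\<in>{1..t}. {e \<in> D i. v \<in> e})" by auto
    also have "card \<dots> = (\<Sum>i=1..t. card {e \<in> D i. v \<in> e})"
    proof (rule card_UN_disjoint)
      show "\<forall>i\<in>{1..t}. finite {e \<in> D i. v \<in> e}" using card_regular_spanning(2)[OF reg] by simp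
      show "\<forall>i\<in>{1..t}. \<forall>j\<in>{1..t}. i \<noteq> j \<longrightarrow> {e \<in> D i. v \<in> e} \<inter> {e \<in> D j. v \<in> e} = {}"
        using disj by blast
    qed simp
    also have "\<dots> = (\<Sum>i=1..t. d i)"
      using reg v by (intro sum.cong) (auto simp: regular_spanning_def)
    finally show "card {e \<in> (\<Union>i\<in>{1..t}. D i). v \<in> e} = (\<Sum>i=1..t. d i)" .
  qed
qed

lemma finite_partial_factors: "finite (partial_factors n d t)"
proof (rule finite_subset)
  show "partial_factors n d t \<subseteq> {1..t} \<rightarrow>\<^sub>E Pow (complete_edges n)"
  proof
    fix D assume "D \<in> partial_factors n d t"
    then have "D \<in> extensional {1..t}" "\<forall>i\<in>{1..t}. D i \<subseteq> complete_edges n"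
      by (simp_all add: partial_factors_def regular_spanning_def)
    then show "D \<in> {1..t} \<rightarrow>\<^sub>E Pow (complete_edges n)" by (simp add: PiE_iff)
  qed
  show "finite ({1..t} \<rightarrow>\<^sub>E Pow (complete_edges n))"
    using finite_complete_edges by (intro finite_PiE) auto
qed

lemma card_partial_factors_Suc:
  "card (partial_factors n d (Suc t)) =
    (\<Sum>D\<in>partial_factors n d t. card (disjoint_regular n (d (Suc t)) (\<Union>i\<in>{1..t}. D i)))"
proof -
  let ?T = "SIGMA D:partial_factors n d t. disjoint_regular n (d (Suc t)) (\<Union>i\<in>{1..t}. D i)"
  let ?f = "\<lambda>(D, E). D(Suc t := E)" and ?g = "\<lambda>D. (restrict D {1..t}, D (Suc t))"
  have iv: "{1..Suc t} = insert (Suc t) {1..t}" by auto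
  have "bij_betw ?f ?T (partial_factors n d (Suc t))"
  proof (rule bij_betw_byWitness[where f' = ?g])
    show "\<forall>a\<in>?T. ?g (?f a) = a"
      by (auto simp: partial_factors_def fun_eq_iff extensional_def restrict_def)
    show "\<forall>D\<in>partial_factors n d (Suc t). ?f (?g D) = D"
      by (auto simp: partial_factors_def fun_eq_iff extensional_def restrict_def)
    show "?f ` ?T \<subseteq> partial_factors n d (Suc t)"
    proof
      fix D' assume "D' \<in> ?f ` ?T"
      then obtain D E where D': "D' = D(Suc t := E)" and D: "D \<in> partial_factors n d t"
        and E: "E \<in> disjoint_regular n (d (Suc t)) (\<Union>i\<in>{1..t}. D i)" by auto
      have "E \<inter> D i = {}" "D i \<inter> E = {}" if "i \<in> {1..t}" for i
        using E that unfolding disjoint_regular_def by blast+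
      then show "D' \<in> partial_factors n d (Suc t)"
        using D E unfolding D' partial_factors_def iv by (auto simp: extensional_def disjoint_regular_def)
    qed
    show "?g ` partial_factors n d (Suc t) \<subseteq> ?T"
    proof
      fix a assume "a \<in> ?g ` partial_factors n d (Suc t)"
      then obtain D where a: "a = ?g D" and D: "D \<in> partial_factors n d (Suc t)" by blast
      have "restrict D {1..t} \<in> partial_factors n d t"
        using D by (auto simp: partial_factors_def)
      moreover have "D (Suc t) \<inter> D i = {}" if "i \<in> {1..t}" for i
        using D that by (auto simp: partial_factors_def)
      then have "D (Suc t) \<inter> (\<Union>i\<in>{1..t}. D i) = {}" by blast
      then have "D (Suc t) \<inter> (\<Union>i\<in>{1..t}. restrict D {1..t} i) = {}" by simp
      ultimately show "a \<in> ?T" using D by (simp add: a partial_factors_def disjoint_regular_def)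
    qed
  qed
  then have "card (partial_factors n d (Suc t)) = card ?T" by (metis bij_betw_same_card)
  also have "\<dots> = (\<Sum>D\<in>partial_factors n d t. card (disjoint_regular n (d (Suc t)) (\<Union>i\<in>{1..t}. D i)))"
  proof (rule card_SigmaI[OF finite_partial_factors], intro ballI)
    fix D
    show "finite (disjoint_regular n (d (Suc t)) (\<Union>i\<in>{1..t}. D i))"
      by (rule finite_subset[of _ "Pow (complete_edges n)"])
        (use finite_complete_edges in \<open>auto simp: disjoint_regular_def regular_spanning_def\<close>)
  qed
  finally show ?thesis .
qed

lemma ln_sum_bounds:
  fixes c :: "'a \<Rightarrow> real"
  assumes "finite A" "A \<noteq> {}" "\<And>a. a \<in> A \<Longrightarrow> 0 < c a" "\<And>a. a \<in> A \<Longrightarrow> \<bar>ln (c a) - \<mu>\<bar> \<le> \<epsilon>"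
  shows "0 < (\<Sum>a\<in>A. c a)" "\<bar>ln (\<Sum>a\<in>A. c a) - (ln (real (card A)) + \<mu>)\<bar> \<le> \<epsilon>"
proof -
  have cA: "0 < real (card A)" using assms(1,2) by (simp add: card_gt_0_iff)
  have c: "exp (\<mu> - \<epsilon>) \<le> c a" "c a \<le> exp (\<mu> + \<epsilon>)" if "a \<in> A" for a
  proof -
    have "\<mu> - \<epsilon> \<le> ln (c a)" "ln (c a) \<le> \<mu> + \<epsilon>" using assms(4)[OF that] by (simp_all add: abs_le_iff)
    then have "exp (\<mu> - \<epsilon>) \<le> exp (ln (c a))" "exp (ln (c a)) \<le> exp (\<mu> + \<epsilon>)" by simp_all
    then show "exp (\<mu> - \<epsilon>) \<le> c a" "c a \<le> exp (\<mu> + \<epsilon>)" using assms(3)[OF that] by simp_all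
  qed
  have lo: "real (card A) * exp (\<mu> - \<epsilon>) \<le> (\<Sum>a\<in>A. c a)" by (rule sum_bounded_below) (rule c)
  have hi: "(\<Sum>a\<in>A. c a) \<le> real (card A) * exp (\<mu> + \<epsilon>)" by (rule sum_bounded_above) (rule c)
  show pos: "0 < (\<Sum>a\<in>A. c a)" using lo cA by (smt (verit) exp_gt_zero mult_pos_pos)
  have "ln (real (card A) * exp (\<mu> - \<epsilon>)) \<le> ln (\<Sum>a\<in>A. c a)" using lo cA pos by (intro ln_mono) auto
  moreover have "ln (\<Sum>a\<in>A. c a) \<le> ln (real (card A) * exp (\<mu> + \<epsilon>))" using hi cA pos by (intro ln_mono) auto
  ultimately show "\<bar>ln (\<Sum>a\<in>A. c a) - (ln (real (card A)) + \<mu>)\<bar> \<le> \<epsilon>"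
    using cA by (simp add: ln_mult abs_le_iff)
qed

text \<open>
  The estimate for a single factor depends on the previous factors only through the degree of their union, so it
  multiplies up.
\<close>

lemma ln_card_partial_factors:
  assumes "\<And>i. i \<in> {1..k} \<Longrightarrow> 1 \<le> d i" "\<And>i. i \<in> {1..k} \<Longrightarrow> even (n * d i)"
    and s: "s = (\<Sum>i=1..k. d i)" "100000 * real s ^ 3 \<le> real n" and "t \<le> k"
  shows "partial_factors n d t \<noteq> {} \<and>
    \<bar>ln (real (card (partial_factors n d t))) - (\<Sum>i=1..t. factor_log n (d i) (\<Sum>j=1..i - 1. d j))\<bar>
      \<le> (\<Sum>i=1..t. 40002 * (real (d i) * (real s)\<^sup>2 / real n))"
  using \<open>t \<le> k\<close>
proof (induction t)
  case 0
  have "partial_factors n d 0 = {\<lambda>_. undefined}" by (auto simp: partial_factors_def)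
  then show ?case by simp
next
  case (Suc t)
  let ?x = "\<Sum>i=1..t. d i" and ?d = "d (Suc t)"
  let ?G = "\<lambda>D. disjoint_regular n ?d (\<Union>i\<in>{1..t}. D i)"
  have IH: "partial_factors n d t \<noteq> {}"
    "\<bar>ln (real (card (partial_factors n d t))) - (\<Sum>i=1..t. factor_log n (d i) (\<Sum>j=1..i - 1. d j))\<bar>
      \<le> (\<Sum>i=1..t. 40002 * (real (d i) * (real s)\<^sup>2 / real n))"
    using Suc by auto
  have d1: "1 \<le> ?d" and ev: "even (n * ?d)" using assms(1,2) Suc.prems by auto
  have "?x + ?d = (\<Sum>i=1..Suc t. d i)" by simp
  also have "\<dots> \<le> s" unfolding s(1) using Suc.prems by (intro sum_mono2) auto
  finally have xs: "?x + ?d \<le> s" .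
  have mono: "real ?d * (real ?d + real ?x)\<^sup>2 \<le> real ?d * (real s)\<^sup>2"
  proof (intro mult_left_mono power_mono add_nonneg_nonneg of_nat_0_le_iff)
    show "real ?d + real ?x \<le> real s"
      using of_nat_mono[OF xs, where 'a = real] by (simp only: of_nat_add add.commute)
  qed
  also have "\<dots> \<le> real s * (real s)\<^sup>2" using xs by (intro mult_right_mono) auto
  also have "\<dots> = real s ^ 3" by (simp only: power3_eq_cube power2_eq_square mult.assoc)
  finally have "real ?d * (real ?d + real ?x)\<^sup>2 \<le> real s ^ 3" .
  then have small: "100000 * (real ?d * (real ?d + real ?x)\<^sup>2) \<le> real n"
    using s(2) mult_left_mono[of "real ?d * (real ?d + real ?x)\<^sup>2" "real s ^ 3" 100000] by (meson order_trans zero_le_numeral)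
  have each: "0 < real (card (?G D)) \<and>
      \<bar>ln (real (card (?G D))) - factor_log n ?d ?x\<bar> \<le> 40002 * (real ?d * (real s)\<^sup>2 / real n)"
    if D: "D \<in> partial_factors n d t" for D
  proof -
    interpret forbidden_graph n ?d ?x "n * ?d div 2" "\<Union>i\<in>{1..t}. D i"
      using regular_spanning_Union[OF D] d1 ev by unfold_locales auto
    have "finite (?G D)"
      by (rule finite_subset[of _ "Pow (complete_edges n)"])
        (use finite_complete_edges in \<open>auto simp: disjoint_regular_def regular_spanning_def\<close>)
    then have "0 < real (card (?G D))"
      using ln_card_disjoint_regular(1)[OF small] by (simp add: card_gt_0_iff)
    moreover have "40002 * (real ?d * (real ?d + real ?x)\<^sup>2 / real n) \<le> 40002 * (real ?d * (real s)\<^sup>2 / real n)"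
      by (intro mult_left_mono divide_right_mono mono) simp_all
    ultimately show ?thesis using ln_card_disjoint_regular_stirling[OF small] by linarith
  qed
  have eq: "real (card (partial_factors n d (Suc t))) = (\<Sum>D\<in>partial_factors n d t. real (card (?G D)))"
    unfolding card_partial_factors_Suc by simp
  have "0 < (\<Sum>D\<in>partial_factors n d t. real (card (?G D)))"
    "\<bar>ln (\<Sum>D\<in>partial_factors n d t. real (card (?G D))) - (ln (real (card (partial_factors n d t))) + factor_log n ?d ?x)\<bar>
      \<le> 40002 * (real ?d * (real s)\<^sup>2 / real n)"
    using each by (auto intro!: ln_sum_bounds[OF finite_partial_factors IH(1)])
  then have pos: "0 < real (card (partial_factors n d (Suc t)))"
    and b: "\<bar>ln (real (card (partial_factors n d (Suc t)))) - (ln (real (card (partial_factors n d t))) + factor_log n ?d ?x)\<bar>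
      \<le> 40002 * (real ?d * (real s)\<^sup>2 / real n)"
    unfolding eq by auto
  have "partial_factors n d (Suc t) \<noteq> {}" using pos by auto
  moreover have "(\<Sum>i=1..Suc t. factor_log n (d i) (\<Sum>j=1..i - 1. d j))
      = (\<Sum>i=1..t. factor_log n (d i) (\<Sum>j=1..i - 1. d j)) + factor_log n ?d ?x" by simp
  moreover have "(\<Sum>i=1..Suc t. 40002 * (real (d i) * (real s)\<^sup>2 / real n))
      = (\<Sum>i=1..t. 40002 * (real (d i) * (real s)\<^sup>2 / real n)) + 40002 * (real ?d * (real s)\<^sup>2 / real n)" by simp
  ultimately show ?case using IH(2) b by linarith
qed

lemma card_star: "v < n \<Longrightarrow> card {e \<in> complete_edges n. v \<in> e} = n - 1"
proof -
  assume v: "v < n"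
  have "bij_betw (\<lambda>u. {v, u}) ({..<n} - {v}) {e \<in> complete_edges n. v \<in> e}"
  proof (rule bij_betw_imageI)
    show "inj_on (\<lambda>u. {v, u}) ({..<n} - {v})" by (auto intro!: inj_onI simp: doubleton_eq_iff)
    show "(\<lambda>u. {v, u}) ` ({..<n} - {v}) = {e \<in> complete_edges n. v \<in> e}"
    proof (intro equalityI subsetI)
      fix e assume e: "e \<in> {e \<in> complete_edges n. v \<in> e}"
      then have "e \<subseteq> {..<n}" "card e = 2" by (auto simp: complete_edges_def)
      then obtain a b where ab: "e = {a, b}" "a \<noteq> b" by (auto simp: card_2_iff)
      then show "e \<in> (\<lambda>u. {v, u}) ` ({..<n} - {v})"
        using e \<open>e \<subseteq> {..<n}\<close> by (cases "v = a") (auto simp: insert_commute)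
    qed (use v in \<open>auto simp: complete_edges_def\<close>)
  qed
  from bij_betw_same_card[OF this] show ?thesis using v by simp
qed

lemma num_factorizations_eq:
  assumes "(\<Sum>j=0..k. d j) = n - 1"
  shows "num_factorizations n k d = card (partial_factors n d k)"
  unfolding num_factorizations_def
proof -
  let ?f = "\<lambda>D :: nat \<Rightarrow> nat set set. restrict D {1..k}"
  let ?g = "\<lambda>D. D(0 := complete_edges n - (\<Union>i\<in>{1..k}. D i))"
  have iv: "{..k} = insert 0 {1..k}" by auto
  have all: "(\<forall>i\<le>k. Q i) \<longleftrightarrow> Q 0 \<and> (\<forall>i\<in>{1..k}. Q i)" for Q :: "nat \<Rightarrow> bool"
    using iv by (metis atMost_iff insert_iff)
  have "bij_betw ?f (regular_factorizations n k d) (partial_factors n d k)"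
  proof (rule bij_betw_byWitness[where f' = ?g])
    show "\<forall>D\<in>regular_factorizations n k d. ?g (?f D) = D"
    proof
      fix D assume "D \<in> regular_factorizations n k d"
      then have D: "D \<in> extensional {..k}" "D 0 \<subseteq> complete_edges n"
        "\<And>i. i \<in> {1..k} \<Longrightarrow> D 0 \<inter> D i = {}" "D 0 \<union> (\<Union>i\<in>{1..k}. D i) = complete_edges n"
        by (auto simp: regular_factorizations_def iv regular_spanning_def all)
      have "complete_edges n - (\<Union>i\<in>{1..k}. D i) = D 0" using D(3,4) by blast
      then show "?g (?f D) = D" using D(1) by (auto simp: fun_eq_iff extensional_def)
    qed
    show "\<forall>D\<in>partial_factors n d k. ?f (?g D) = D"
      by (auto simp: partial_factors_def fun_eq_iff extensional_def)
    show "?f ` regular_factorizations n k d \<subseteq> partial_factors n d k"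
    proof
      fix D' assume "D' \<in> ?f ` regular_factorizations n k d"
      then obtain D where D': "D' = ?f D" and D: "D \<in> regular_factorizations n k d" by blast
      have "D i \<inter> D j = {}" if "i \<in> {1..k}" "j \<in> {1..k}" "i \<noteq> j" for i j
        using D that by (simp add: regular_factorizations_def)
      moreover have "regular_spanning n (d i) (D i)" if "i \<in> {1..k}" for i
        using D that by (simp add: regular_factorizations_def)
      ultimately show "D' \<in> partial_factors n d k"
        unfolding D' partial_factors_def by simp
    qed
    show "?g ` partial_factors n d k \<subseteq> regular_factorizations n k d"
    proof
      fix D' assume "D' \<in> ?g ` partial_factors n d k"
      then obtain D where D': "D' = ?g D" and D: "D \<in> partial_factors n d k" by blast
      let ?U = "\<Union>i\<in>{1..k}. D i"
      have U: "regular_spanning n (\<Sum>i=1..k. d i) ?U" by (rule regular_spanning_Union[OF D])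
      have dsum: "d 0 + (\<Sum>i=1..k. d i) = n - 1"
        using assms by (simp add: sum.atLeast_Suc_atMost)
      have "regular_spanning n (d 0) (complete_edges n - ?U)"
        unfolding regular_spanning_def
      proof (intro conjI allI impI)
        fix v assume v: "v < n"
        have "{e \<in> complete_edges n - ?U. v \<in> e} = {e \<in> complete_edges n. v \<in> e} - {e \<in> ?U. v \<in> e}" by auto
        also have "card \<dots> = card {e \<in> complete_edges n. v \<in> e} - card {e \<in> ?U. v \<in> e}"
        proof (rule card_Diff_subset)
          show sub: "{e \<in> ?U. v \<in> e} \<subseteq> {e \<in> complete_edges n. v \<in> e}"
            using U unfolding regular_spanning_def by blast
          show "finite {e \<in> ?U. v \<in> e}" using finite_subset[OF sub] finite_complete_edges by simp
        qed
        also have "\<dots> = d 0" using card_star[OF v] U v dsum by (simp add: regular_spanning_def)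
        finally show "card {e \<in> complete_edges n - ?U. v \<in> e} = d 0" .
      qed auto
      moreover have "D' i = D i" if "i \<in> {1..k}" for i using that by (simp add: D')
      moreover have "D' 0 = complete_edges n - ?U" by (simp add: D')
      moreover have "?U \<subseteq> complete_edges n" using U by (simp add: regular_spanning_def)
      moreover have "D' \<in> extensional {..k}"
        using D by (auto simp: D' partial_factors_def extensional_def)
      moreover have "\<forall>i\<in>{1..k}. regular_spanning n (d i) (D i)" "\<forall>i\<in>{1..k}. \<forall>j\<in>{1..k}. i \<noteq> j \<longrightarrow> D i \<inter> D j = {}"
        using D by (auto simp: partial_factors_def)
      moreover have "(\<Union>i\<le>k. D' i) = complete_edges n"
      proof -
        have "(\<Union>i\<le>k. D' i) = D' 0 \<union> (\<Union>i\<in>{1..k}. D' i)" unfolding iv by simp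
        also have "(\<Union>i\<in>{1..k}. D' i) = ?U" by (simp add: D')
        finally show ?thesis using \<open>?U \<subseteq> complete_edges n\<close> by (auto simp: D')
      qed
      ultimately show "D' \<in> regular_factorizations n k d"
        unfolding regular_factorizations_def mem_Collect_eq all by auto
    qed
  qed
  then show "card (regular_factorizations n k d) = card (partial_factors n d k)" by (rule bij_betw_same_card)
qed

text \<open>
  The expected numbers of loops, of double edges within a factor and of edges shared by two factors combine to
  a square.
\<close>

lemma sum_means: "(\<Sum>i=1..k. (real (d i) ^ 2 - 1) / 4 + real (\<Sum>j=1..i - 1. d j) * real (d i) / 2)
    = (real (\<Sum>i=1..k. d i) ^ 2 - real k) / 4"
  by (induction k) (simp_all add: power2_eq_square field_simps)

lemma ln_falling_factorial:
  "s \<le> n - 1 \<Longrightarrow> ln (fact (n - 1)) = ln (fact (n - 1 - s)) + (\<Sum>j=1..s. ln (real n - real j))"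
proof (induction s)
  case (Suc s)
  define a where "a = n - 1 - Suc s"
  have a: "n - 1 - s = Suc a" using Suc.prems by (simp add: a_def)
  have ra: "real (Suc a) = real n - real (Suc s)" using a Suc.prems by linarith
  have "ln (fact (n - 1)) = ln (fact (Suc a)) + (\<Sum>j=1..s. ln (real n - real j))"
    using Suc a by simp
  also have "ln (fact (Suc a) :: real) = ln (fact a) + ln (real n - real (Suc s))"
    unfolding ra[symmetric] by (simp add: ln_mult del: of_nat_Suc)
  finally show ?case by (simp add: a_def)
qed simp

lemma estimate_pos:
  assumes k: "1 \<le> k" and d1: "\<And>j. j \<le> k \<Longrightarrow> 1 \<le> d j" and dsum: "(\<Sum>j=0..k. d j) = n - 1"
  shows "0 < estimate n k d"
proof -
  have "1 \<le> d 0" "1 \<le> d 1" using d1 k by auto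
  moreover have "(\<Sum>j\<in>{0, 1}. d j) \<le> (\<Sum>j=0..k. d j)" using k by (intro sum_mono2) auto
  ultimately have n: "3 \<le> n" using dsum by simp
  have "0 < density n d i" if "i \<le> k" for i
    using d1[OF that] n by (simp add: density_def)
  then have "0 < (\<Prod>i\<le>k. density n d i powr density n d i)"
    by (intro prod_pos) (simp add: less_imp_neq[symmetric])
  moreover have "0 < multinomial_coeff (n - 1) k d" by (simp add: multinomial_coeff_def prod_pos)
  ultimately show ?thesis by (simp add: estimate_def)
qed

text \<open>
  The factorials \<open>d\<^sub>i!\<close> for \<open>i \<ge> 1\<close> and the powers of 2 occur on both sides. What remains is the
  expression treated in \<open>complement_asymptotics\<close>.
\<close>

lemma ln_estimate:
  assumes k: "1 \<le> k" and d1: "\<And>j. j \<le> k \<Longrightarrow> 1 \<le> d j" and dsum: "(\<Sum>j=0..k. d j) = n - 1"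
    and s: "s = (\<Sum>i=1..k. d i)" "4 * s \<le> n"
  shows "\<bar>ln (estimate n k d) - (\<Sum>i=1..k. factor_log n (d i) (\<Sum>j=1..i - 1. d j))\<bar> \<le> 7 * (real s ^ 3 / real n)"
proof -
  define N where "N = real n - 1"
  have iv: "{..k} = insert 0 {1..k}" by auto
  have s1: "1 \<le> s" using d1[of 1] k member_le_sum[of 1 "{1..k}" d] unfolding s(1) by fastforce
  have d0s: "d 0 + s = n - 1" using dsum by (simp add: s(1) sum.atLeast_Suc_atMost)
  have n: "4 \<le> n" using s s1 by linarith
  have N0: "0 < N" using n by (simp add: N_def)
  have dpos: "0 < real (d i)" if "i \<le> k" for i using d1[OF that] by simp
  have dens: "density n d i = real (d i) / N" for i by (simp add: density_def N_def)
  have dens0: "0 < density n d i" if "i \<le> k" for i using dpos[OF that] N0 by (simp add: dens)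
  have prod0: "0 < (\<Prod>i\<le>k. density n d i powr density n d i)" using dens0 by (intro prod_pos) (simp add: less_imp_neq[symmetric])
  have mult0: "0 < multinomial_coeff (n - 1) k d" by (simp add: multinomial_coeff_def prod_pos)
  have lnprod: "ln (\<Prod>i\<le>k. density n d i powr density n d i) = (\<Sum>i\<le>k. real (d i) / N * (ln (real (d i)) - ln N))"
  proof -
    have "ln (\<Prod>i\<le>k. density n d i powr density n d i) = (\<Sum>i\<le>k. ln (density n d i powr density n d i))"
      using dens0 by (intro ln_prod) (auto simp: less_imp_neq[symmetric])
    also have "\<dots> = (\<Sum>i\<le>k. real (d i) / N * (ln (real (d i)) - ln N))"
    proof (rule sum.cong[OF refl])
      fix i assume "i \<in> {..k}"
      then show "ln (density n d i powr density n d i) = real (d i) / N * (ln (real (d i)) - ln N)"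
        using dpos[of i] N0 by (simp add: ln_powr dens ln_div)
    qed
    finally show ?thesis .
  qed
  have lnmult: "ln (multinomial_coeff (n - 1) k d) = ln (fact (n - 1)) - (\<Sum>i\<le>k. ln (fact (d i)))"
    unfolding multinomial_coeff_def by (simp add: ln_div prod_pos ln_prod)
  have choose: "real (n choose 2) = real n * N / 2"
  proof -
    have "even (n * (n - 1))" by (cases n) auto
    then have "real (n * (n - 1) div 2) = real (n * (n - 1)) / 2" using real_of_nat_div[of 2 "n * (n - 1)"] by simp
    then show ?thesis using n by (simp add: choose_two N_def of_nat_diff)
  qed
  have "ln (p ^ c * q ^ n * exp e * 2 powr r) = real c * ln p + real n * ln q + e + r * ln 2"
    if "0 < p" "0 < q" for p q e r :: real and c
    using that by (simp add: ln_mult ln_realpow ln_powr)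
  from this[OF prod0 mult0] have "ln (estimate n k d) = real (n choose 2) * (\<Sum>i\<le>k. real (d i) / N * (ln (real (d i)) - ln N))
      + real n * (ln (fact (n - 1)) - (\<Sum>i\<le>k. ln (fact (d i)))) + real k / 4 + real k / 2 * ln 2"
    unfolding estimate_def lnprod lnmult .
  also have "real (n choose 2) * (\<Sum>i\<le>k. real (d i) / N * (ln (real (d i)) - ln N))
      = (\<Sum>i\<le>k. real n * real (d i) / 2 * (ln (real (d i)) - ln N))"
    unfolding choose sum_distrib_left using N0 by (intro sum.cong) auto
  finally have est: "ln (estimate n k d) =
      real n * real (d 0) / 2 * (ln (real (d 0)) - ln N) + (\<Sum>i=1..k. real n * real (d i) / 2 * (ln (real (d i)) - ln N))
      + real n * (ln (fact (n - 1)) - ln (fact (d 0))) - real n * (\<Sum>i=1..k. ln (fact (d i))) + real k / 4 + real k / 2 * ln 2"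
    unfolding iv by (simp add: algebra_simps)
  have "(\<Sum>i=1..k. factor_log n (d i) (\<Sum>j=1..i - 1. d j))
      = (\<Sum>i=1..k. real n * real (d i) / 2 * (ln (real n * real (d i)) - 1)) + real k * (ln 2 / 2)
        - real n * (\<Sum>i=1..k. ln (fact (d i))) - ((real s)\<^sup>2 - real k) / 4"
    unfolding factor_log_def s(1) sum_means[symmetric]
    by (simp add: sum.distrib sum_subtractf sum_distrib_left)
  moreover have "(\<Sum>i=1..k. real n * real (d i) / 2 * (ln (real (d i)) - ln N))
      = (\<Sum>i=1..k. real n * real (d i) / 2 * (ln (real n * real (d i)) - 1)) + real n * real s / 2 * (1 - ln N - ln (real n))"
  proof -
    have "(\<Sum>i=1..k. real n * real (d i) / 2 * (ln (real (d i)) - ln N))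
      = (\<Sum>i=1..k. real n * real (d i) / 2 * (ln (real n * real (d i)) - 1) + real (d i) * (real n / 2 * (1 - ln N - ln (real n))))"
    proof (rule sum.cong[OF refl])
      fix i assume "i \<in> {1..k}"
      then have "ln (real n * real (d i)) = ln (real n) + ln (real (d i))"
        using dpos[of i] n by (simp add: ln_mult)
      then show "real n * real (d i) / 2 * (ln (real (d i)) - ln N) =
          real n * real (d i) / 2 * (ln (real n * real (d i)) - 1) + real (d i) * (real n / 2 * (1 - ln N - ln (real n)))"
        by (simp add: field_simps)
    qed
    also have "\<dots> = (\<Sum>i=1..k. real n * real (d i) / 2 * (ln (real n * real (d i)) - 1)) + real s * (real n / 2 * (1 - ln N - ln (real n)))"
      unfolding s(1) of_nat_sum sum_distrib_right sum.distrib ..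
    finally show ?thesis by simp
  qed
  moreover have "ln (fact (n - 1)) - ln (fact (d 0)) = (\<Sum>j=1..s. ln (real n - real j))"
    using ln_falling_factorial[of s n] d0s by (metis add_diff_cancel_left' add_diff_cancel_right' le_add2)
  moreover have "real n * real (d 0) / 2 * (ln (real (d 0)) - ln N)
      = real n * (real n - 1 - real s) / 2 * ln ((real n - 1 - real s) / (real n - 1))"
  proof -
    have "real (d 0) = real n - 1 - real s" using d0s n by linarith
    then show ?thesis using dpos[of 0] N0 by (simp add: ln_div N_def)
  qed
  ultimately have "ln (estimate n k d) - (\<Sum>i=1..k. factor_log n (d i) (\<Sum>j=1..i - 1. d j))
    = real n * (real n - 1 - real s) / 2 * ln ((real n - 1 - real s) / (real n - 1))
      + real n * (\<Sum>j=1..s. ln (real n - real j))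
      + real n * real s / 2 * (1 - ln (real n - 1) - ln (real n)) + (real s)\<^sup>2 / 4"
    unfolding est N_def by (simp add: diff_divide_distrib)
  then show "\<bar>ln (estimate n k d) - (\<Sum>i=1..k. factor_log n (d i) (\<Sum>j=1..i - 1. d j))\<bar> \<le> 7 * (real s ^ 3 / real n)"
    using complement_asymptotics[OF s1 s(2)] by simp
qed

lemma factorizations_relative_error:
  assumes k: "1 \<le> k" and d1: "\<And>j. j \<le> k \<Longrightarrow> 1 \<le> d j" and dsum: "(\<Sum>j=0..k. d j) = n - 1"
    and even: "\<And>j. odd n \<Longrightarrow> j \<le> k \<Longrightarrow> even (d j)"
    and small: "100000 * real (degree_sum k d) ^ 3 \<le> real n"
  shows "\<bar>real (num_factorizations n k d) / estimate n k d - 1\<bar> \<le> 100000 * (real (degree_sum k d) ^ 3 / real n)"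
proof -
  define s where "s = (\<Sum>i=1..k. d i)"
  have ds: "degree_sum k d = s" by (simp add: degree_sum_def s_def)
  have s1: "1 \<le> s" using d1[of 1] k member_le_sum[of 1 "{1..k}" d] unfolding s_def by fastforce
  have "real s \<le> real s ^ 3" using s1 power_increasing[of 1 3 "real s"] by simp
  then have ns: "100000 * real s \<le> real n" using small unfolding ds by linarith
  then have n0: "0 < real n" and s4: "4 * s \<le> n" using s1 by linarith+
  let ?M = "\<Sum>i=1..k. factor_log n (d i) (\<Sum>j=1..i - 1. d j)"
  let ?R = "real (num_factorizations n k d)"
  have pf: "partial_factors n d k \<noteq> {} \<and> \<bar>ln (real (card (partial_factors n d k))) - ?M\<bar>
      \<le> (\<Sum>i=1..k. 40002 * (real (d i) * (real s)\<^sup>2 / real n))"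
    using d1 even small unfolding ds by (intro ln_card_partial_factors[OF _ _ s_def]) auto
  have "(\<Sum>i=1..k. 40002 * (real (d i) * (real s)\<^sup>2 / real n)) = 40002 * (real s ^ 3 / real n)"
    by (simp add: s_def sum_distrib_left[symmetric] sum_distrib_right[symmetric] sum_divide_distrib[symmetric]
        power3_eq_cube power2_eq_square)
  then have 1: "\<bar>ln ?R - ?M\<bar> \<le> 40002 * (real s ^ 3 / real n)"
    using pf unfolding num_factorizations_eq[OF dsum] by simp
  have R0: "0 < ?R" unfolding num_factorizations_eq[OF dsum] using pf finite_partial_factors by (simp add: card_gt_0_iff)
  note est = estimate_pos[OF k d1 dsum] ln_estimate[OF k d1 dsum s_def s4]
  define u where "u = ln ?R - ln (estimate n k d)"
  have u: "\<bar>u\<bar> \<le> 40009 * (real s ^ 3 / real n)" using 1 est(2) unfolding u_def by linarith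
  have "100000 * (real s ^ 3 / real n) \<le> 1" using small n0 unfolding ds by (simp add: field_simps)
  then have "\<bar>u\<bar> \<le> 1 / 2" using u by linarith
  then have "exp u \<le> 1 + 2 * \<bar>u\<bar>" using exp_bound_lemma[of u] by simp
  then have "\<bar>exp u - 1\<bar> \<le> 2 * \<bar>u\<bar>"
    using exp_ge_add_one_self[of u] by linarith
  moreover have "exp u = ?R / estimate n k d" unfolding u_def using R0 est(1) by (simp add: exp_diff)
  moreover have "0 \<le> real s ^ 3 / real n" by simp
  ultimately show ?thesis using u unfolding ds by linarith
qed

theorem theorem3p6:
  fixes S :: "nat set" and k :: "nat \<Rightarrow> nat" and d :: "nat \<Rightarrow> nat \<Rightarrow> nat"
    and F :: "nat filter"
  defines "F \<equiv> inf sequentially (principal S)"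
  assumes "infinite S"
    and "\<And>n. n \<in> S \<Longrightarrow> k n \<ge> 1"
    and "\<And>n j. n \<in> S \<Longrightarrow> j \<le> k n \<Longrightarrow> d n j \<ge> 1"
    and "\<And>n. n \<in> S \<Longrightarrow> (\<Sum>j=0..k n. d n j) = n - 1"
    and "\<And>n j. n \<in> S \<Longrightarrow> odd n \<Longrightarrow> j \<le> k n \<Longrightarrow> even (d n j)"
    and "(\<lambda>n. real (mixed_sum (k n) (d n))) \<in> o[F](\<lambda>n. real n)"
    and "(\<lambda>n. real (degree_sum (k n) (d n)) ^ 3) \<in> o[F](\<lambda>n. real n)"
  shows "\<exists>\<eta>. \<eta> \<in> O[F](\<lambda>n. real (degree_sum (k n) (d n)) ^ 3 / real n
                            + 1 / real n * real (mixed_sum (k n) (d n))) \<and>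
             (\<forall>n\<in>S. real (num_factorizations n (k n) (d n))
                      = estimate n (k n) (d n) * (1 + \<eta> n))"
proof -
  define \<eta> where "\<eta> n = real (num_factorizations n (k n) (d n)) / estimate n (k n) (d n) - 1" for n
  show ?thesis
  proof (intro exI[of _ \<eta>] conjI ballI)
    have "eventually (\<lambda>n. norm (real (degree_sum (k n) (d n)) ^ 3) \<le> 1 / 100000 * norm (real n)) F"
      using landau_o.smallD[OF assms(8), of "1 / 100000"] by simp
    moreover have "eventually (\<lambda>n. n \<in> S) F" unfolding F_def by (simp add: eventually_inf_principal)
    ultimately have "eventually (\<lambda>n. norm (\<eta> n) \<le> 100000 * norm (real (degree_sum (k n) (d n)) ^ 3 / real n
        + 1 / real n * real (mixed_sum (k n) (d n)))) F"
    proof eventually_elim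
      case (elim n)
      then have "\<bar>\<eta> n\<bar> \<le> 100000 * (real (degree_sum (k n) (d n)) ^ 3 / real n)"
        unfolding \<eta>_def using assms(3-6) by (intro factorizations_relative_error) auto
      moreover have "0 \<le> 1 / real n * real (mixed_sum (k n) (d n))" "0 \<le> real (degree_sum (k n) (d n)) ^ 3 / real n"
        by simp_all
      moreover have "\<bar>e\<bar> \<le> 100000 * \<bar>a + b\<bar>" if "\<bar>e\<bar> \<le> 100000 * a" "0 \<le> b" "0 \<le> a" for a b e :: real
      proof -
        have "\<bar>a + b\<bar> = a + b" using that by simp
        then show ?thesis using that by simp
      qed
      ultimately show ?case by (simp only: real_norm_def)
    qed
    then show "\<eta> \<in> O[F](\<lambda>n. real (degree_sum (k n) (d n)) ^ 3 / real n + 1 / real n * real (mixed_sum (k n) (d n)))"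
      by (rule bigoI)
    fix n assume n: "n \<in> S"
    have "0 < estimate n (k n) (d n)" using assms(3-5) n by (intro estimate_pos) auto
    then show "real (num_factorizations n (k n) (d n)) = estimate n (k n) (d n) * (1 + \<eta> n)"
      by (simp add: \<eta>_def)
  qed
qed

end
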